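(* Let $V^{[*]}$ be a dg vertex operator algebra. Then $\operatorname{gr}^{[*]}A(V^{[*]})$ is a graded commutative dg Poisson algebra. The product is induced by $\ast$, the Poisson bracket is $\{-,-\}_{F^\bullet}$ and has degree $-2$, and the differential is induced by $d_V$. In particular, for dg homogeneous $\widetilde x,\widetilde y\in\operatorname{gr}^{[*]}A(V^{[*]})$ with respective preimages $u\in V^{[|\widetilde x|]}$, $v\in V^{[|\widetilde y|]}$, one has $$\widetilde x\ast\widetilde y=\widetilde{[u_{-1}v]}\quad\text{and}\quad\{\widetilde x,\widetilde y\}_{F^\bullet}=\widetilde{[u_0v]}.$$
   Context: All vector spaces are over $\mathbb C$. A (cochain) complex $V^{[*]}=\bigoplus_{p\in\mathbb Z}V^{[p]}$ has a differential $d_V$ of degree $+1$ with $d_V^2=0$; $|v|=p$ for $v\in V^{[p]}$ (dg homogeneous elements). $\operatorname{End}^{[*]}(V^{[*]})=\bigoplus_p\operatorname{End}^{[p]}(V^{[*]})$, where $\operatorname{End}^{[p]}$ is the space of linear maps of degree $p$. A dg vertex algebra $(V^{[*]},d_V,Y(\cdot,x),\mathbf 1)$ is a complex with a linear map $v\mapsto Y(v,x)=\sum_{n\in\mathbb Z}v_nx^{-n-1}\in\operatorname{End}^{[*]}(V^{[*]})[[x,x^{-1}]]$ such that for $v\in V^{[p]}$ one has $v_n\in\operatorname{End}^{[p-2n-2]}(V^{[*]})$ and $(d_Vv)_n=d_V\circ v_n-(-1)^{p}v_n\circ d_V$, and a vector $\mathbf 1\in V^{[0]}$ with $d_V\mathbf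 1=0$, such that: $u_nv=0$ for $n$ sufficiently large; $Y(\mathbf 1,x)=\operatorname{id}$; $Y(v,x)\mathbf 1\in V^{[*]}[[x]]$ with constant term $v$; and (Jacobi identity) for homogeneous $u,v$ and all $l,m,n\in\mathbb Z$, $$\sum_{i\ge0}(-1)^i\binom li\left(u_{m+l-i}v_{n+i}-(-1)^{l}(-1)^{|u||v|}v_{n+l-i}u_{m+i}\right)=\sum_{i\ge0}\binom mi(u_{l+i}v)_{m+n-i}.$$ A dg vertex operator algebra is a dg vertex algebra with $\omega\in V^{[4]}$, $d_V\omega=0$, such that, writing $Y(\omega,x)=\sum_nL(n)x^{-n-2}$: $[L(m),L(n)]=(m-n)L(m+n)+\frac1{12}(m^3-m)\delta_{m+n,0}c_V$ for some $c_V\in\mathbb C$; $L(0)$ is semisimple with $V^{[*]}=\bigoplus_{n\in\frac12\mathbb Z}V_n^{[*]}$, $V_n^{[*]}$ the eigenspace of eigenvalue (weight) $n$, $\omega\in V_2^{[*]}$, $\dim V_n^{[*]}<\infty$, $V_n^{[*]}=0$ for $n\ll0$; and $L(-1)v=v_{-2}\mathbf 1$. Write $\operatorname{wt}(u)=n$ for $u\in V_n^{[*]}$. Zhu algebra: for $u$ weight homogeneous and $v\in V^{[*]}$ (extended linearly in $u$), $u\ast v=\sum_{n\ge0}\binom{\operatorname{wt}(u)}{n}u_{n-1}v$ and $u\circ v=\sum_{n\ge0}\binom{\operatorname{wt}(u)}{n}u_{n-2}v$. $O(V^{[*]})$ is the span of all $u\circ v$, and $A(V^{[*]})=V^{[*]}/O(V^{[*]})$,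 $[v]$ denoting the class of $v$; $\ast$ descends to an associative unital product on $A(V^{[*]})$, and $d_V$ preserves $O(V^{[*]})$. $F^pA(V^{[*]})$ is the image of $\bigoplus_{q\le p}V^{[q]}$, and $\operatorname{gr}^{[*]}A(V^{[*]})=\bigoplus_p\operatorname{gr}^{[p]}A(V^{[*]})$ with $\operatorname{gr}^{[p]}A(V^{[*]})=F^pA(V^{[*]})/F^{p-1}A(V^{[*]})$; $\widetilde x$ denotes the class of $x\in F^pA(V^{[*]})$ in $\operatorname{gr}^{[p]}A(V^{[*]})$ (in the displayed formulas the classes are taken in degrees $|\widetilde x|+|\widetilde y|$ and $|\widetilde x|+|\widetilde y|-2$ respectively). A preimage of $\widetilde x\in\operatorname{gr}^{[p]}$ is $u\in V^{[p]}$ with $[u]-x\in F^{p-1}A(V^{[*]})$. Bracket: for $\widetilde x\in\operatorname{gr}^{[p]}$, $\widetilde y\in\operatorname{gr}^{[q]}$ with preimages $u\in V^{[p]}$, $v\in V^{[q]}$, $\{\widetilde x,\widetilde y\}_{F^\bullet}=[u]\ast[v]-(-1)^{pq}[v]\ast[u]\bmod F^{p+q-3}A(V^{[*]})$, an element of $\operatorname{gr}^{[p+q-2]}A(V^{[*]})$ independent of the choices. A graded commutative dg Poisson algebra with bracket of even degree $k$ is an associative dg algebra $(R^{[*]},d)$ with $ab=(-1)^{|a||b|}ba$ and a bracket $R^{[p]}\times R^{[q]}\to R^{[p+q+k]}$ such that for homogeneous $a,b,c$: $\{a,b\}=-(-1)^{|a||b|}\{b,a\}$; $\{a,\{b,c\}\}=\{\{a,b\},c\}+(-1)^{|a||b|}\{b,\{a,c\}\}$;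 $\{a,bc\}=\{a,b\}c+(-1)^{|a||b|}b\{a,c\}$; $d\{a,b\}=\{da,b\}+(-1)^{|a|}\{a,db\}$. *)

theory Defs
  imports
    Complex_Main
    "HOL-Library.Groups_Big_Fun"
    "HOL-Algebra.QuotRing"
    "HOL-Algebra.Algebraic_Closure_Type"
begin

text \<open>
  Vector spaces over the complex numbers which are given from the start are types with an explicit
  scalar multiplication (locale \<^locale>\<open>vector_space\<close>); the quotients formed from them are structures
  with a carrier in the sense of HOL-Algebra, their elements being cosets.
\<close>

abbreviation complex_field :: "complex ring" where
  "complex_field \<equiv> ring_of_type_algebra"


section \<open>Internal direct sums\<close>

definition is_decomposition :: "(int \<Rightarrow> 'v::ab_group_add set) \<Rightarrow> 'v \<Rightarrow> (int \<Rightarrow> 'v) \<Rightarrow> bool" where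
  "is_decomposition W v f \<longleftrightarrow>
     (\<forall>i. f i \<in> W i) \<and> finite {i. f i \<noteq> 0} \<and> Sum_any f = v"

definition internal_direct_sum ::
    "(complex \<Rightarrow> 'v \<Rightarrow> 'v::ab_group_add) \<Rightarrow> (int \<Rightarrow> 'v set) \<Rightarrow> bool" where
  "internal_direct_sum s W \<longleftrightarrow>
     (\<forall>i. Modules.module.subspace s (W i)) \<and> (\<forall>v. \<exists>!f. is_decomposition W v f)"

definition homogeneous_component :: "(int \<Rightarrow> 'v::ab_group_add set) \<Rightarrow> int \<Rightarrow> 'v \<Rightarrow> 'v" where
  "homogeneous_component W i v = (THE f. is_decomposition W v f) i"


section \<open>dg vertex operator algebras\<close>

text \<open>
  \<open>vdeg V p\<close> is the space of elements of cohomological degree \<open>p\<close>, and \<open>vmode V v n\<close> is the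
  endomorphism \<open>v\<^sub>n\<close>, the coefficient of \<open>x\<^sup>-\<^sup>n\<^sup>-\<^sup>1\<close> in \<open>Y(v,x)\<close>.
\<close>

record 'v dg_vertex_data =
  vscale :: "complex \<Rightarrow> 'v \<Rightarrow> 'v"
  vdeg   :: "int \<Rightarrow> 'v set"
  vdiff  :: "'v \<Rightarrow> 'v"
  vmode  :: "'v \<Rightarrow> int \<Rightarrow> 'v \<Rightarrow> 'v"
  vvac   :: 'v

record 'v dg_voa_data = "'v dg_vertex_data" +
  vomega :: 'v

abbreviation vlinear :: "('v::ab_group_add, 'm) dg_vertex_data_scheme \<Rightarrow> ('v \<Rightarrow> 'v) \<Rightarrow> bool" where
  "vlinear V \<equiv> Vector_Spaces.linear (vscale V) (vscale V)"

abbreviation vspan :: "('v::ab_group_add, 'm) dg_vertex_data_scheme \<Rightarrow> 'v set \<Rightarrow> 'v set" where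
  "vspan V \<equiv> Modules.module.span (vscale V)"

text \<open>
  Since the modes are linear maps that are homogeneous for homogeneous \<open>v\<close>, all \<open>v\<^sub>n\<close> lie in the
  direct sum of the spaces of homogeneous endomorphisms. The Jacobi identity is evaluated on
  vectors; by truncation each of its sums then has only finitely many non-zero terms, so that
  \<^const>\<open>Sum_any\<close> is the actual sum.
\<close>

locale dg_vertex_algebra = vector_space "vscale V"
  for V :: "('v::ab_group_add, 'm) dg_vertex_data_scheme" +
  assumes grading: "internal_direct_sum (vscale V) (vdeg V)"
    and diff_linear: "vlinear V (vdiff V)"
    and diff_degree: "v \<in> vdeg V p \<Longrightarrow> vdiff V v \<in> vdeg V (p + 1)"
    and diff_diff: "vdiff V (vdiff V v) = 0"
    and mode_linear_state: "vlinear V (\<lambda>v. vmode V v n w)"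
    and mode_linear: "vlinear V (vmode V v n)"
    and mode_degree:
      "v \<in> vdeg V p \<Longrightarrow> w \<in> vdeg V q \<Longrightarrow> vmode V v n w \<in> vdeg V (p - 2 * n - 2 + q)"
    and diff_mode: "v \<in> vdeg V p \<Longrightarrow>
      vmode V (vdiff V v) n w =
        vdiff V (vmode V v n w) - vscale V ((- 1) powi p) (vmode V v n (vdiff V w))"
    and vac_degree: "vvac V \<in> vdeg V 0"
    and vac_closed: "vdiff V (vvac V) = 0"
    and truncation: "\<exists>N. \<forall>n\<ge>N. vmode V u n v = 0"
    and vac_mode: "vmode V (vvac V) n v = (if n = - 1 then v else 0)"
    and creation_regular: "n \<ge> 0 \<Longrightarrow> vmode V v n (vvac V) = 0"
    and creation: "vmode V v (- 1) (vvac V) = v"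
    and jacobi: "u \<in> vdeg V p \<Longrightarrow> v \<in> vdeg V q \<Longrightarrow>
      Sum_any (\<lambda>i::nat. vscale V ((- 1) ^ i * (of_int l gchoose i))
        (vmode V u (m + l - int i) (vmode V v (n + int i) w)
         - vscale V ((- 1) powi l * (- 1) powi (p * q))
             (vmode V v (n + l - int i) (vmode V u (m + int i) w))))
      = Sum_any (\<lambda>i::nat. vscale V (of_int m gchoose i)
          (vmode V (vmode V u (l + int i) v) (m + n - int i) w))"

definition vir :: "('v, 'm) dg_voa_data_scheme \<Rightarrow> int \<Rightarrow> 'v \<Rightarrow> 'v" where
  "vir V n = vmode V (vomega V) (n + 1)"

definition weight_space :: "('v, 'm) dg_voa_data_scheme \<Rightarrow> complex \<Rightarrow> 'v set" where
  "weight_space V h = {v. vir V 0 v = vscale V h v}"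

text \<open>Half-integral weights are indexed by the integer \<open>k\<close> which is twice the weight.\<close>

abbreviation half_weight_space :: "('v, 'm) dg_voa_data_scheme \<Rightarrow> int \<Rightarrow> 'v set" where
  "half_weight_space V k \<equiv> weight_space V (of_int k / 2)"

locale dg_vertex_operator_algebra = dg_vertex_algebra V
  for V :: "('v::ab_group_add, 'm) dg_voa_data_scheme" +
  assumes omega_degree: "vomega V \<in> vdeg V 4"
    and omega_closed: "vdiff V (vomega V) = 0"
    and virasoro: "\<exists>c::complex. \<forall>m n v.
      vir V m (vir V n v) - vir V n (vir V m v) =
        vscale V (of_int (m - n)) (vir V (m + n) v)
        + vscale V (if m + n = 0 then of_int (m ^ 3 - m) / 12 * c else 0) v"
    and weight_grading: "internal_direct_sum (vscale V) (half_weight_space V)"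
    and omega_weight: "vomega V \<in> weight_space V 2"
    and weight_finite: "\<exists>B. finite B \<and> half_weight_space V k \<subseteq> vspan V B"
    and weight_bounded: "\<exists>N. \<forall>k<N. half_weight_space V k = {0}"
    and translation: "vir V (- 1) v = vmode V v (- 2) (vvac V)"


section \<open>The Zhu algebra\<close>

text \<open>The weight is only half-integral, so the binomial coefficients are generalised ones.\<close>

definition zhu_star :: "('v::ab_group_add, 'm) dg_voa_data_scheme \<Rightarrow> 'v \<Rightarrow> 'v \<Rightarrow> 'v" where
  "zhu_star V u v = Sum_any (\<lambda>k. Sum_any (\<lambda>n::nat.
     vscale V ((of_int k / 2) gchoose n)
       (vmode V (homogeneous_component (half_weight_space V) k u) (int n - 1) v)))"

definition zhu_circ :: "('v::ab_group_add, 'm) dg_voa_data_scheme \<Rightarrow> 'v \<Rightarrow> 'v \<Rightarrow> 'v" where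
  "zhu_circ V u v = Sum_any (\<lambda>k. Sum_any (\<lambda>n::nat.
     vscale V ((of_int k / 2) gchoose n)
       (vmode V (homogeneous_component (half_weight_space V) k u) (int n - 2) v)))"

definition zhu_O :: "('v::ab_group_add, 'm) dg_voa_data_scheme \<Rightarrow> 'v set" where
  "zhu_O V = vspan V {zhu_circ V u v | u v. True}"

definition zhu_class :: "('v::ab_group_add, 'm) dg_voa_data_scheme \<Rightarrow> 'v \<Rightarrow> 'v set" where
  "zhu_class V v = {w. w - v \<in> zhu_O V}"

text \<open>
  As for \<^const>\<open>rcoset_mult\<close>, operations on quotients are unions over all representatives; such a
  union is again a class exactly if the operation does not depend on the representatives.
\<close>

definition zhu_algebra ::
    "('v::ab_group_add, 'm) dg_voa_data_scheme \<Rightarrow> (complex, 'v set) module" where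
  "zhu_algebra V = \<lparr>
     carrier = range (zhu_class V),
     monoid.mult = (\<lambda>S T. \<Union>u\<in>S. \<Union>v\<in>T. zhu_class V (zhu_star V u v)),
     monoid.one = zhu_class V (vvac V),
     ring.zero = zhu_class V 0,
     ring.add = (\<lambda>S T. \<Union>u\<in>S. \<Union>v\<in>T. zhu_class V (u + v)),
     module.smult = (\<lambda>c S. \<Union>u\<in>S. zhu_class V (vscale V c u))\<rparr>"

definition zhu_diff :: "('v::ab_group_add, 'm) dg_voa_data_scheme \<Rightarrow> 'v set \<Rightarrow> 'v set" where
  "zhu_diff V S = (\<Union>u\<in>S. zhu_class V (vdiff V u))"

definition zhu_filt :: "('v::ab_group_add, 'm) dg_voa_data_scheme \<Rightarrow> int \<Rightarrow> 'v set set" where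
  "zhu_filt V p = zhu_class V ` vspan V (\<Union>q\<in>{..p}. vdeg V q)"


section \<open>The associated graded of the Zhu algebra\<close>

text \<open>
  \<open>gr_piece V p\<close> is the additive quotient group of step \<open>p\<close> of the filtration by step \<open>p - 1\<close>.
  The library writes factor groups multiplicatively, so its operation is the addition of classes
  and its unit is the zero class.
\<close>

definition gr_piece ::
    "('v::ab_group_add, 'm) dg_voa_data_scheme \<Rightarrow> int \<Rightarrow> 'v set set monoid" where
  "gr_piece V p = (zhu_algebra V)\<lparr>carrier := zhu_filt V p\<rparr> A_Mod zhu_filt V (p - 1)"

definition gr_class ::
    "('v::ab_group_add, 'm) dg_voa_data_scheme \<Rightarrow> int \<Rightarrow> 'v set \<Rightarrow> 'v set set" where
  "gr_class V p x = zhu_filt V (p - 1) +>\<^bsub>zhu_algebra V\<^esub> x"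

definition gr_preimages ::
    "('v::ab_group_add, 'm) dg_voa_data_scheme \<Rightarrow> int \<Rightarrow> 'v set set \<Rightarrow> 'v set" where
  "gr_preimages V p S = {u \<in> vdeg V p. \<exists>x\<in>zhu_filt V p.
     S = gr_class V p x \<and> zhu_class V u \<ominus>\<^bsub>zhu_algebra V\<^esub> x \<in> zhu_filt V (p - 1)}"

definition zhu_commutator ::
    "('v::ab_group_add, 'm) dg_voa_data_scheme \<Rightarrow> int \<Rightarrow> int \<Rightarrow> 'v set \<Rightarrow> 'v set \<Rightarrow> 'v set" where
  "zhu_commutator V p q x y =
     x \<otimes>\<^bsub>zhu_algebra V\<^esub> y
     \<ominus>\<^bsub>zhu_algebra V\<^esub> ((- 1) powi (p * q) \<odot>\<^bsub>zhu_algebra V\<^esub> (y \<otimes>\<^bsub>zhu_algebra V\<^esub> x))"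

definition gr_piece_smult ::
    "('v::ab_group_add, 'm) dg_voa_data_scheme \<Rightarrow> int \<Rightarrow> complex \<Rightarrow> 'v set set \<Rightarrow> 'v set set" where
  "gr_piece_smult V p c S = (\<Union>x\<in>S. gr_class V p (c \<odot>\<^bsub>zhu_algebra V\<^esub> x))"

definition gr_piece_mult :: "('v::ab_group_add, 'm) dg_voa_data_scheme \<Rightarrow>
    int \<Rightarrow> int \<Rightarrow> 'v set set \<Rightarrow> 'v set set \<Rightarrow> 'v set set" where
  "gr_piece_mult V p q S T =
     (\<Union>x\<in>S. \<Union>y\<in>T. gr_class V (p + q) (x \<otimes>\<^bsub>zhu_algebra V\<^esub> y))"

definition gr_piece_bracket :: "('v::ab_group_add, 'm) dg_voa_data_scheme \<Rightarrow>
    int \<Rightarrow> int \<Rightarrow> 'v set set \<Rightarrow> 'v set set \<Rightarrow> 'v set set" where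
  "gr_piece_bracket V p q S T =
     (\<Union>u\<in>gr_preimages V p S. \<Union>v\<in>gr_preimages V q T.
        gr_class V (p + q - 2) (zhu_commutator V p q (zhu_class V u) (zhu_class V v)))"

definition gr_piece_diff ::
    "('v::ab_group_add, 'm) dg_voa_data_scheme \<Rightarrow> int \<Rightarrow> 'v set set \<Rightarrow> 'v set set" where
  "gr_piece_diff V p S = (\<Union>x\<in>S. gr_class V (p + 1) (zhu_diff V x))"

text \<open>
  The associated graded algebra is the external direct sum of the pieces: its elements are the
  finitely supported families \<open>x\<close> with \<open>x p\<close> in the piece of degree \<open>p\<close>, and the operations are
  extended bilinearly from the pieces. In the component of degree \<open>n\<close> the summation index \<open>p\<close> is the
  degree of the left factor; the right one has degree \<open>n - p\<close> for the product and \<open>n + 2 - p\<close> for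
  the bracket of degree \<open>-2\<close>.
\<close>

definition gr_support ::
    "('v::ab_group_add, 'm) dg_voa_data_scheme \<Rightarrow> (int \<Rightarrow> 'v set set) \<Rightarrow> int set" where
  "gr_support V x = {p. x p \<noteq> \<one>\<^bsub>gr_piece V p\<^esub>}"

definition gr_incl ::
    "('v::ab_group_add, 'm) dg_voa_data_scheme \<Rightarrow> int \<Rightarrow> 'v set set \<Rightarrow> int \<Rightarrow> 'v set set" where
  "gr_incl V p S = (\<lambda>q. if q = p then S else \<one>\<^bsub>gr_piece V q\<^esub>)"

definition gr_algebra ::
    "('v::ab_group_add, 'm) dg_voa_data_scheme \<Rightarrow> (complex, int \<Rightarrow> 'v set set) module" where
  "gr_algebra V = \<lparr>
     carrier = {x. (\<forall>p. x p \<in> carrier (gr_piece V p)) \<and> finite (gr_support V x)},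
     monoid.mult = (\<lambda>x y n. \<Otimes>\<^bsub>gr_piece V n\<^esub>p\<in>gr_support V x.
       gr_piece_mult V p (n - p) (x p) (y (n - p))),
     monoid.one = gr_incl V 0 (gr_class V 0 \<one>\<^bsub>zhu_algebra V\<^esub>),
     ring.zero = (\<lambda>p. \<one>\<^bsub>gr_piece V p\<^esub>),
     ring.add = (\<lambda>x y p. x p \<otimes>\<^bsub>gr_piece V p\<^esub> y p),
     module.smult = (\<lambda>c x p. gr_piece_smult V p c (x p))\<rparr>"

definition gr_bracket :: "('v::ab_group_add, 'm) dg_voa_data_scheme \<Rightarrow>
    (int \<Rightarrow> 'v set set) \<Rightarrow> (int \<Rightarrow> 'v set set) \<Rightarrow> int \<Rightarrow> 'v set set" where
  "gr_bracket V x y = (\<lambda>n. \<Otimes>\<^bsub>gr_piece V n\<^esub>p\<in>gr_support V x.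
     gr_piece_bracket V p (n + 2 - p) (x p) (y (n + 2 - p)))"

definition gr_diff :: "('v::ab_group_add, 'm) dg_voa_data_scheme \<Rightarrow>
    (int \<Rightarrow> 'v set set) \<Rightarrow> int \<Rightarrow> 'v set set" where
  "gr_diff V x = (\<lambda>n. gr_piece_diff V (n - 1) (x (n - 1)))"

definition gr_deg ::
    "('v::ab_group_add, 'm) dg_voa_data_scheme \<Rightarrow> int \<Rightarrow> (int \<Rightarrow> 'v set set) set" where
  "gr_deg V p = gr_incl V p ` carrier (gr_piece V p)"

text \<open>The class, written with a tilde, of an element of step \<open>p\<close> of the filtration.\<close>

definition gr_tilde ::
    "('v::ab_group_add, 'm) dg_voa_data_scheme \<Rightarrow> int \<Rightarrow> 'v set \<Rightarrow> int \<Rightarrow> 'v set set" where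
  "gr_tilde V p x = gr_incl V p (gr_class V p x)"


section \<open>Graded commutative dg Poisson algebras\<close>

locale dg_algebra = Module.module complex_field R + ring R
  for R :: "(complex, 'r) module" (structure) +
  fixes G :: "int \<Rightarrow> 'r set" and d :: "'r \<Rightarrow> 'r"
  assumes smult_mult_left: "a \<in> carrier R \<Longrightarrow> b \<in> carrier R \<Longrightarrow>
      (c \<odot>\<^bsub>R\<^esub> a) \<otimes>\<^bsub>R\<^esub> b = c \<odot>\<^bsub>R\<^esub> (a \<otimes>\<^bsub>R\<^esub> b)"
    and smult_mult_right: "a \<in> carrier R \<Longrightarrow> b \<in> carrier R \<Longrightarrow>
      a \<otimes>\<^bsub>R\<^esub> (c \<odot>\<^bsub>R\<^esub> b) = c \<odot>\<^bsub>R\<^esub> (a \<otimes>\<^bsub>R\<^esub> b)"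
    and homogeneous_submodule: "submodule (G p) complex_field R"
    and direct_sum: "a \<in> carrier R \<Longrightarrow>
      \<exists>!f. (\<forall>p. f p \<in> G p) \<and> finite {p. f p \<noteq> \<zero>\<^bsub>R\<^esub>}
         \<and> (\<Oplus>\<^bsub>R\<^esub>p\<in>{p. f p \<noteq> \<zero>\<^bsub>R\<^esub>}. f p) = a"
    and one_degree: "\<one>\<^bsub>R\<^esub> \<in> G 0"
    and mult_degree: "a \<in> G p \<Longrightarrow> b \<in> G q \<Longrightarrow> a \<otimes>\<^bsub>R\<^esub> b \<in> G (p + q)"
    and d_add: "a \<in> carrier R \<Longrightarrow> b \<in> carrier R \<Longrightarrow> d (a \<oplus>\<^bsub>R\<^esub> b) = d a \<oplus>\<^bsub>R\<^esub> d b"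
    and d_smult: "a \<in> carrier R \<Longrightarrow> d (c \<odot>\<^bsub>R\<^esub> a) = c \<odot>\<^bsub>R\<^esub> d a"
    and d_degree: "a \<in> G p \<Longrightarrow> d a \<in> G (p + 1)"
    and d_d: "a \<in> carrier R \<Longrightarrow> d (d a) = \<zero>\<^bsub>R\<^esub>"
    and d_mult: "a \<in> G p \<Longrightarrow> b \<in> G q \<Longrightarrow>
      d (a \<otimes>\<^bsub>R\<^esub> b) = d a \<otimes>\<^bsub>R\<^esub> b \<oplus>\<^bsub>R\<^esub> (- 1) powi p \<odot>\<^bsub>R\<^esub> (a \<otimes>\<^bsub>R\<^esub> d b)"

locale graded_commutative_dg_poisson_algebra = dg_algebra R G d
  for R :: "(complex, 'r) module" (structure) and G :: "int \<Rightarrow> 'r set" and d :: "'r \<Rightarrow> 'r" +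
  fixes br :: "'r \<Rightarrow> 'r \<Rightarrow> 'r" and k :: int
  assumes even_degree: "even k"
    and graded_commutative: "a \<in> G p \<Longrightarrow> b \<in> G q \<Longrightarrow>
      a \<otimes>\<^bsub>R\<^esub> b = (- 1) powi (p * q) \<odot>\<^bsub>R\<^esub> (b \<otimes>\<^bsub>R\<^esub> a)"
    and br_add_left: "a \<in> carrier R \<Longrightarrow> a' \<in> carrier R \<Longrightarrow> b \<in> carrier R \<Longrightarrow>
      br (a \<oplus>\<^bsub>R\<^esub> a') b = br a b \<oplus>\<^bsub>R\<^esub> br a' b"
    and br_add_right: "a \<in> carrier R \<Longrightarrow> b \<in> carrier R \<Longrightarrow> b' \<in> carrier R \<Longrightarrow>
      br a (b \<oplus>\<^bsub>R\<^esub> b') = br a b \<oplus>\<^bsub>R\<^esub> br a b'"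
    and br_smult_left: "a \<in> carrier R \<Longrightarrow> b \<in> carrier R \<Longrightarrow> br (c \<odot>\<^bsub>R\<^esub> a) b = c \<odot>\<^bsub>R\<^esub> br a b"
    and br_smult_right: "a \<in> carrier R \<Longrightarrow> b \<in> carrier R \<Longrightarrow> br a (c \<odot>\<^bsub>R\<^esub> b) = c \<odot>\<^bsub>R\<^esub> br a b"
    and br_degree: "a \<in> G p \<Longrightarrow> b \<in> G q \<Longrightarrow> br a b \<in> G (p + q + k)"
    and br_antisym: "a \<in> G p \<Longrightarrow> b \<in> G q \<Longrightarrow>
      br a b = \<ominus>\<^bsub>R\<^esub> ((- 1) powi (p * q) \<odot>\<^bsub>R\<^esub> br b a)"
    and br_jacobi: "a \<in> G p \<Longrightarrow> b \<in> G q \<Longrightarrow> c' \<in> G r \<Longrightarrow>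
      br a (br b c') = br (br a b) c' \<oplus>\<^bsub>R\<^esub> (- 1) powi (p * q) \<odot>\<^bsub>R\<^esub> br b (br a c')"
    and br_leibniz: "a \<in> G p \<Longrightarrow> b \<in> G q \<Longrightarrow> c' \<in> G r \<Longrightarrow>
      br a (b \<otimes>\<^bsub>R\<^esub> c') =
        br a b \<otimes>\<^bsub>R\<^esub> c' \<oplus>\<^bsub>R\<^esub> (- 1) powi (p * q) \<odot>\<^bsub>R\<^esub> (b \<otimes>\<^bsub>R\<^esub> br a c')"
    and d_br: "a \<in> G p \<Longrightarrow> b \<in> G q \<Longrightarrow>
      d (br a b) = br (d a) b \<oplus>\<^bsub>R\<^esub> (- 1) powi p \<odot>\<^bsub>R\<^esub> br a (d b)"

end

theory Submission
  imports Defs "HOL-Computational_Algebra.Formal_Laurent_Series"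
begin

text \<open>
  Write \<open>O\<close> for \<open>O(V)\<close>. Every product that occurs is a residue of \<open>f(x) Y(u,x) v\<close> for a Laurent
  series \<open>f\<close>. For \<open>u\<close> of weight \<open>a\<close> the kernel is \<open>(1 + x)\<^sup>a / x\<close> for \<open>u * v\<close> and
  \<open>(1 + x)\<^sup>a / x\<^sup>2\<close> for \<open>u \<circ> v\<close>. Only the power series expansion of \<open>(1 + x)\<^sup>a\<close> is used, so half-integral
  weights cause no difficulty.

  Integrating by parts one sees that kernels \<open>(1 + x)\<^sup>a h(1/x) / x\<^sup>2\<close> with a polynomial \<open>h\<close> also give
  elements of \<open>O\<close> (\<open>res_polar_in_O\<close>). With the commutator formula for residues it follows that
  \<open>O\<close> is stable under left multiplication by \<open>u\<close> and under the operator with kernel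
  \<open>(1 + x)\<^sup>a\<^sup>-\<^sup>1\<close>, called the bracket with \<open>u\<close> below (\<open>res_preserves_O\<close>). Skew symmetry and a
  Vandermonde convolution show that, modulo \<open>O\<close>, the graded commutator of \<open>u\<close> and \<open>v\<close> for the
  product \<open>*\<close> is this bracket (\<open>star_commutator_mod_O\<close>). Since \<open>O\<close> is graded by the parity of the
  cohomological degree (\<open>O_parity\<close>), it follows that \<open>O\<close> is a two-sided ideal.

  The mode \<open>u\<^sub>n v\<close> has degree \<open>|u| + |v| - 2 n - 2\<close>. Hence \<open>u * v\<close> has leading term \<open>u\<^sub>-\<^sub>1 v\<close>, the
  bracket has leading term \<open>u\<^sub>0 v\<close>, all further terms being lower by at least two, and
  \<open>u\<^sub>n v\<close> with \<open>n \<le> - 2\<close> is the leading term of an element of \<open>O\<close> (\<open>gr_kernel_pole\<close>). So the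
  associated graded is a quotient of \<open>V\<close> in which all \<open>u\<^sub>n v\<close> with \<open>n \<le> - 2\<close> vanish, with product
  \<open>u\<^sub>-\<^sub>1 v\<close>, bracket \<open>u\<^sub>0 v\<close> and differential \<open>d\<close>. The axioms of a Poisson algebra are then direct
  consequences of skew symmetry and the Jacobi identity, as for Zhu's algebra \<open>V / C\<^sub>2(V)\<close>.

  That these operations descend to the quotient is where the ideal property of \<open>O\<close> enters. For the
  bracket one needs the grading by parity once more: if a vector of degree \<open>p\<close> is congruent to one
  of lower degree, it is congruent to one of the same parity and of degree at most \<open>p - 2\<close>
  (\<open>gr_kernel_parity\<close>).
\<close>


section \<open>Graded vector spaces\<close>

lemmas vs_linear_module_hom = Vector_Spaces.linear.axioms(3)

lemmas vs_linear_0 = module_hom.zero[OF vs_linear_module_hom]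
  and vs_linear_add = module_hom.add[OF vs_linear_module_hom]
  and vs_linear_scale = module_hom.scale[OF vs_linear_module_hom]
  and vs_linear_diff = module_hom.diff[OF vs_linear_module_hom]
  and vs_linear_sum = module_hom.sum[OF vs_linear_module_hom]

locale graded_vector_space = vector_space s
  for s :: "complex \<Rightarrow> 'v::ab_group_add \<Rightarrow> 'v" +
  fixes W :: "int \<Rightarrow> 'v set"
  assumes decomp: "internal_direct_sum s W"
begin

abbreviation comp :: "int \<Rightarrow> 'v \<Rightarrow> 'v" where
  "comp i v \<equiv> homogeneous_component W i v"

lemma subspace_piece: "subspace (W i)"
  using decomp by (simp add: internal_direct_sum_def)

lemma is_decomposition_comp: "is_decomposition W v (\<lambda>i. comp i v)"
proof -
  have "\<exists>!f. is_decomposition W v f"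
    using decomp by (simp add: internal_direct_sum_def)
  from theI'[OF this] show ?thesis
    by (simp add: homogeneous_component_def[abs_def])
qed

lemma comp_eqI: "is_decomposition W v f \<Longrightarrow> comp i v = f i"
  using decomp is_decomposition_comp[of v] unfolding internal_direct_sum_def by metis

lemma comp_in [simp, intro]: "comp i v \<in> W i"
  and finite_comp: "finite {i. comp i v \<noteq> 0}"
  using is_decomposition_comp[of v] by (auto simp: is_decomposition_def)

lemma sum_comp: "(\<Sum>i\<in>{i. comp i v \<noteq> 0}. comp i v) = v"
  using is_decomposition_comp[of v] by (simp add: is_decomposition_def Sum_any.expand_set)

lemma sum_comp_superset:
  assumes "finite F" "{i. comp i v \<noteq> 0} \<subseteq> F"
  shows "(\<Sum>i\<in>F. comp i v) = v"
  by (subst sum_comp[of v, symmetric], rule sum.mono_neutral_right) (use assms in auto)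

lemma comp_add: "comp i (u + v) = comp i u + comp i v"
proof (rule comp_eqI)
  have fin: "finite {i. comp i u + comp i v \<noteq> 0}"
    by (rule finite_subset[OF _ finite_UnI[OF finite_comp[of u] finite_comp[of v]]]) auto
  have "Sum_any (\<lambda>i. comp i u + comp i v) = Sum_any (\<lambda>i. comp i u) + Sum_any (\<lambda>i. comp i v)"
    by (rule Sum_any.distrib[OF finite_comp finite_comp])
  also have "\<dots> = u + v"
    using is_decomposition_comp by (simp add: is_decomposition_def)
  finally show "is_decomposition W (u + v) (\<lambda>i. comp i u + comp i v)"
    using fin by (simp add: is_decomposition_def subspace_add[OF subspace_piece])
qed

lemma comp_scale: "comp i (s c v) = s c (comp i v)"
proof (rule comp_eqI)
  have fin: "finite {i. s c (comp i v) \<noteq> 0}"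
    by (rule finite_subset[OF _ finite_comp[of v]]) auto
  have "Sum_any (\<lambda>i. s c (comp i v)) = (\<Sum>i\<in>{i. comp i v \<noteq> 0}. s c (comp i v))"
    by (rule Sum_any.expand_superset) (use finite_comp in auto)
  also have "\<dots> = s c v"
    by (simp flip: scale_sum_right add: sum_comp)
  finally show "is_decomposition W (s c v) (\<lambda>i. s c (comp i v))"
    using fin by (simp add: is_decomposition_def subspace_scale[OF subspace_piece])
qed

lemma linear_comp: "Vector_Spaces.linear s s (comp i)"
  by unfold_locales (simp_all add: comp_add comp_scale)

lemma comp_zero [simp]: "comp i 0 = 0"
  by (rule vs_linear_0[OF linear_comp])

lemma comp_diff: "comp i (u - v) = comp i u - comp i v"
  by (rule vs_linear_diff[OF linear_comp])

lemma comp_sum: "comp i (sum f A) = (\<Sum>a\<in>A. comp i (f a))"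
  by (rule vs_linear_sum[OF linear_comp])

lemma comp_homogeneous: "v \<in> W i \<Longrightarrow> comp j v = (if j = i then v else 0)"
  by (rule comp_eqI)
    (auto simp: is_decomposition_def subspace_0[OF subspace_piece] if_distrib)

lemma homogeneous_iff: "v \<in> W i \<longleftrightarrow> (\<forall>j. j \<noteq> i \<longrightarrow> comp j v = 0)"
proof
  assume "\<forall>j. j \<noteq> i \<longrightarrow> comp j v = 0"
  hence "{j. comp j v \<noteq> 0} \<subseteq> {i}" by auto
  from sum_comp_superset[OF _ this] have "comp i v = v" by simp
  thus "v \<in> W i" by (metis comp_in)
qed (simp add: comp_homogeneous)

lemma eq_if_comp_eq: "(\<And>i. comp i u = comp i v) \<Longrightarrow> u = v"
  by (metis (no_types, lifting) Collect_cong sum.cong sum_comp)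

lemma homogeneous_induct [case_names homogeneous add]:
  assumes hom: "\<And>i v. v \<in> W i \<Longrightarrow> P v"
    and add: "\<And>u v. P u \<Longrightarrow> P v \<Longrightarrow> P (u + v)"
  shows "P v"
proof -
  have "P (\<Sum>i\<in>F. comp i v)" if "finite F" for F
    using that
  proof induction
    case empty
    show ?case using hom[of 0 0] subspace_0[OF subspace_piece] by simp
  next
    case (insert i F)
    thus ?case by (simp add: add hom[OF comp_in])
  qed
  from this[OF finite_comp[of v]] show ?thesis by (simp only: sum_comp)
qed

lemma linear_eq_on_homogeneous:
  assumes "Vector_Spaces.linear s s f" "Vector_Spaces.linear s s g"
    and "\<And>i v. v \<in> W i \<Longrightarrow> f v = g v"
  shows "f v = g v"
  by (induction v rule: homogeneous_induct)
    (simp_all add: assms(3) vs_linear_add[OF assms(1)] vs_linear_add[OF assms(2)])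

lemma comp_linear_shift:
  assumes lin: "Vector_Spaces.linear s s f"
    and deg: "\<And>i v. v \<in> W i \<Longrightarrow> f v \<in> W (i + k)"
  shows "comp i (f v) = f (comp (i - k) v)"
proof (induction v rule: homogeneous_induct)
  case (homogeneous j v)
  show ?case
    by (auto simp: comp_homogeneous[OF homogeneous] comp_homogeneous[OF deg[OF homogeneous]]
        vs_linear_0[OF lin])
next
  case (add u v)
  thus ?case by (simp add: vs_linear_add[OF lin] comp_add)
qed

definition supported :: "int set \<Rightarrow> 'v set" where
  "supported S = {v. \<forall>i. comp i v \<noteq> 0 \<longrightarrow> i \<in> S}"

lemma subspace_supported: "subspace (supported S)"
  unfolding subspace_def supported_def by (simp add: comp_add comp_scale) (metis add_0)

lemma supported_mono: "S \<subseteq> T \<Longrightarrow> supported S \<subseteq> supported T"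
  by (auto simp: supported_def)

lemma homogeneous_supported: "v \<in> W i \<Longrightarrow> i \<in> S \<Longrightarrow> v \<in> supported S"
  by (auto simp: supported_def comp_homogeneous split: if_splits)

lemma supported_disjoint: "v \<in> supported S \<Longrightarrow> v \<in> supported T \<Longrightarrow> S \<inter> T = {} \<Longrightarrow> v = 0"
  by (rule eq_if_comp_eq) (auto simp: supported_def)

lemma supported_induct [consumes 1, case_names zero homogeneous add]:
  assumes v: "v \<in> supported S"
    and zero: "P 0"
    and hom: "\<And>i v. i \<in> S \<Longrightarrow> v \<in> W i \<Longrightarrow> P v"
    and add: "\<And>u v. P u \<Longrightarrow> P v \<Longrightarrow> P (u + v)"
  shows "P v"
proof -
  have "P (\<Sum>i\<in>F. comp i v)" if "finite F" "F \<subseteq> S" for F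
    using that by (induction F) (auto simp: zero add hom)
  from this[OF finite_comp[of v]] show ?thesis
    using v by (auto simp: sum_comp supported_def)
qed

lemma span_pieces_eq_supported: "span (\<Union>i\<in>S. W i) = supported S"
proof
  show "span (\<Union>i\<in>S. W i) \<subseteq> supported S"
    by (rule span_minimal) (auto intro: homogeneous_supported subspace_supported)
  show "supported S \<subseteq> span (\<Union>i\<in>S. W i)"
  proof
    fix v assume "v \<in> supported S"
    thus "v \<in> span (\<Union>i\<in>S. W i)"
      by (induction rule: supported_induct) (auto intro: span_zero span_base span_add)
  qed
qed

lemma supported_split:
  assumes "v \<in> supported S"
  obtains v0 v1 where "v = v0 + v1" "v0 \<in> supported (S \<inter> A)" "v1 \<in> supported (S - A)"
proof -
  from assms have "\<exists>v0 v1. v = v0 + v1 \<and> v0 \<in> supported (S \<inter> A) \<and> v1 \<in> supported (S - A)"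
  proof (induction rule: supported_induct)
    case zero
    show ?case using subspace_0[OF subspace_supported] by force
  next
    case (homogeneous i v)
    show ?case
    proof (cases "i \<in> A")
      case True
      thus ?thesis using homogeneous subspace_0[OF subspace_supported]
        by (intro exI[of _ v] exI[of _ 0]) (auto intro: homogeneous_supported)
    next
      case False
      thus ?thesis using homogeneous subspace_0[OF subspace_supported]
        by (intro exI[of _ 0] exI[of _ v]) (auto intro: homogeneous_supported)
    qed
  next
    case (add u v)
    then obtain u0 u1 v0 v1 where "u = u0 + u1" "v = v0 + v1"
      "u0 \<in> supported (S \<inter> A)" "v0 \<in> supported (S \<inter> A)"
      "u1 \<in> supported (S - A)" "v1 \<in> supported (S - A)" by blast
    thus ?case
      by (intro exI[of _ "u0 + v0"] exI[of _ "u1 + v1"])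
        (auto intro: subspace_add[OF subspace_supported])
  qed
  thus ?thesis using that by blast
qed

end


section \<open>Formal Laurent series\<close>

definition xpow :: "int \<Rightarrow> complex fls" where
  "xpow n = fls_shift (- n) 1"

lemma xpow_nth [simp]: "fls_nth (xpow n) k = (if k = n then 1 else 0)"
  by (simp add: xpow_def)

lemma mult_xpow_nth [simp]: "fls_nth (f * xpow n) k = fls_nth f (k - n)"
  by (simp add: xpow_def fls_X_intpow_times_conv_shift)

lemma xpow_mult: "xpow m * xpow n = xpow (m + n)"
  by (rule fls_eqI) auto

lemma xpow_0 [simp]: "xpow 0 = 1"
  by (simp add: xpow_def)

lemma deriv_xpow: "fls_deriv (xpow n) = fls_const (of_int n) * xpow (n - 1)"
  by (rule fls_eqI) auto

lemma mult_vanishes_below: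
  fixes f g :: "complex fls"
  assumes "\<And>k. k < a \<Longrightarrow> fls_nth f k = 0" "\<And>k. k < b \<Longrightarrow> fls_nth g k = 0" "k < a + b"
  shows "fls_nth (f * g) k = 0"
proof (cases "f = 0 \<or> g = 0")
  case False
  hence "a \<le> fls_subdegree f" "b \<le> fls_subdegree g"
    using assms(1,2) by (auto intro: fls_subdegree_geI)
  thus ?thesis using assms(3) by (intro fls_times_nth_eq0) simp
qed auto

text \<open>
  The divided powers of the derivative, i.e. the Taylor coefficients: formally
  \<open>f(x + z) = \<Sum>\<^sub>i (hasse_deriv i f)(x) z\<^sup>i\<close>.
\<close>

definition hasse_deriv :: "nat \<Rightarrow> complex fls \<Rightarrow> complex fls" where
  "hasse_deriv i f = fls_const (1 / fact i) * (fls_deriv ^^ i) f"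

lemma hasse_deriv_0 [simp]: "hasse_deriv 0 f = f"
  by (simp add: hasse_deriv_def)

lemma hasse_deriv_Suc:
  "hasse_deriv (Suc i) f = fls_const (1 / of_nat (Suc i)) * fls_deriv (hasse_deriv i f)"
proof -
  have "fls_const (1 / of_nat (Suc i)) * fls_deriv (hasse_deriv i f)
      = fls_const (1 / of_nat (Suc i)) * fls_const (1 / fact i) * (fls_deriv ^^ Suc i) f"
    by (simp add: hasse_deriv_def mult.assoc)
  also have "fls_const (1 / of_nat (Suc i)) * fls_const (1 / fact i)
      = (fls_const (1 / fact (Suc i)) :: complex fls)"
    by (simp only: fls_const_mult_const) simp
  finally show ?thesis by (simp add: hasse_deriv_def)
qed

lemma hasse_deriv_add: "hasse_deriv i (f + g) = hasse_deriv i f + hasse_deriv i g"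
  by (induction i) (simp_all add: hasse_deriv_Suc distrib_left)

lemma hasse_deriv_const_mult: "hasse_deriv i (fls_const c * f) = fls_const c * hasse_deriv i f"
  by (induction i) (simp_all add: hasse_deriv_Suc mult.left_commute)

lemma hasse_deriv_xpow:
  "hasse_deriv i (xpow n) = fls_const (of_int n gchoose i) * xpow (n - int i)"
proof (induction i)
  case (Suc i)
  have "1 / of_nat (Suc i) * ((of_int n gchoose i) * of_int (n - int i))
      = (of_int n gchoose Suc i :: complex)"
    using gbinomial_mult_1[of "of_int n :: complex" i]
    by (simp add: field_simps del: of_nat_Suc)
  moreover have "hasse_deriv (Suc i) (xpow n) = fls_const (1 / of_nat (Suc i)
      * ((of_int n gchoose i) * of_int (n - int i))) * xpow (n - int i - 1)"
    unfolding hasse_deriv_Suc Suc.IH fls_deriv_mult_const_left deriv_xpow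
    by (simp only: fls_const_mult_const[symmetric] mult.assoc)
  ultimately show ?case by (simp add: algebra_simps)
qed simp

lemma hasse_deriv_vanishes_below:
  assumes "\<And>k. k < a \<Longrightarrow> fls_nth f k = 0" "k < a - int i"
  shows "fls_nth (hasse_deriv i f) k = 0"
  using assms(2) by (induction i arbitrary: k) (auto simp: hasse_deriv_Suc assms(1))

text \<open>
  A linear map that does not see the coefficients beyond some index only sees a Laurent polynomial,
  so it vanishes if it does on all powers of the variable. Identities between residues thereby
  reduce to identities between single modes, without any rearrangement of double sums.
\<close>

lemma fls_functional_zero:
  fixes L :: "complex fls \<Rightarrow> 'v::ab_group_add"
  assumes add: "\<And>f g. L (f + g) = L f + L g"
    and scale: "\<And>c f. L (fls_const c * f) = s c (L f)"
    and s0: "\<And>c. s c 0 = 0"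
    and pow: "\<And>n. L (xpow n) = 0"
    and high: "\<And>h. (\<And>k. k < M \<Longrightarrow> fls_nth h k = 0) \<Longrightarrow> L h = 0"
  shows "L f = 0"
proof -
  define p where "p = (\<Sum>k\<in>{fls_subdegree f..<M}. fls_const (fls_nth f k) * xpow k)"
  have nth_p: "fls_nth p k = (if k \<in> {fls_subdegree f..<M} then fls_nth f k else 0)" for k
    by (simp add: p_def fls_nth_sum if_distrib sum.delta' cong: if_cong)
  have "L 0 = 0" using add[of 0 0] by simp
  have "L (sum F A) = (\<Sum>k\<in>A. L (F k))" for F and A :: "int set"
    by (induction A rule: infinite_finite_induct) (simp_all add: \<open>L 0 = 0\<close> add)
  hence "L p = 0" by (simp add: p_def scale pow s0)
  have "fls_nth (f - p) k = 0" if "k < M" for k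
    using that by (auto simp: nth_p)
  hence "L (f - p) = 0" by (rule high)
  moreover have "L f = L (f - p) + L p" by (simp flip: add)
  ultimately show ?thesis using \<open>L p = 0\<close> by simp
qed


section \<open>Residues of vertex operators\<close>

context dg_vertex_algebra
begin

sublocale deg: graded_vector_space "vscale V" "vdeg V"
  by unfold_locales (rule grading)

abbreviation sc (infixr "\<cdot>" 75) where "sc \<equiv> vscale V"
abbreviation mode where "mode \<equiv> vmode V"

lemmas mode_add_left = vs_linear_add[OF mode_linear_state]
  and mode_scale_left = vs_linear_scale[OF mode_linear_state]
  and mode_zero_left [simp] = vs_linear_0[OF mode_linear_state]
  and mode_diff_left = vs_linear_diff[OF mode_linear_state]
  and mode_sum_left = vs_linear_sum[OF mode_linear_state]
  and mode_add_right = vs_linear_add[OF mode_linear]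
  and mode_scale_right = vs_linear_scale[OF mode_linear]
  and mode_zero_right [simp] = vs_linear_0[OF mode_linear]
  and mode_diff_right = vs_linear_diff[OF mode_linear]
  and diff_add = vs_linear_add[OF diff_linear]
  and diff_scale = vs_linear_scale[OF diff_linear]
  and diff_zero [simp] = vs_linear_0[OF diff_linear]

definition trunc :: "'v \<Rightarrow> 'v \<Rightarrow> int" where
  "trunc u v = (SOME N. \<forall>n\<ge>N. mode u n v = 0)"

lemma mode_trunc: "trunc u v \<le> n \<Longrightarrow> mode u n v = 0"
  using someI_ex[OF truncation[of u v]] by (simp add: trunc_def)

text \<open>The residue of \<open>f(x) Y(u,x) v\<close>.\<close>

definition res :: "complex fls \<Rightarrow> 'v \<Rightarrow> 'v \<Rightarrow> 'v" where
  "res f u v = Sum_any (\<lambda>n. fls_nth f n \<cdot> mode u n v)"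

lemma res_eq_sum:
  assumes "\<And>n. n < A \<Longrightarrow> fls_nth f n = 0" "\<And>n. M \<le> n \<Longrightarrow> fls_nth f n \<noteq> 0 \<Longrightarrow> mode u n v = 0"
  shows "res f u v = (\<Sum>n\<in>{A..<M}. fls_nth f n \<cdot> mode u n v)"
  unfolding res_def
proof (rule Sum_any.expand_superset)
  show "{n. fls_nth f n \<cdot> mode u n v \<noteq> 0} \<subseteq> {A..<M}"
    by clarsimp (metis assms not_le)
qed simp

lemma finite_res: "finite {n. fls_nth f n \<cdot> mode u n v \<noteq> 0}"
  by (rule finite_subset[of _ "{fls_subdegree f..<trunc u v}"])
    ((clarsimp, metis mode_trunc fls_eq0_below_subdegree not_le), simp)

lemma res_add: "res (f + g) u v = res f u v + res g u v"
  by (simp add: res_def scale_left_distrib Sum_any.distrib[OF finite_res finite_res])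

lemma res_const_mult: "res (fls_const c * f) u v = c \<cdot> res f u v"
proof -
  have "res (fls_const c * f) u v = (\<Sum>n\<in>{fls_subdegree f..<trunc u v}. (c * fls_nth f n) \<cdot> mode u n v)"
    by (subst res_eq_sum[where A = "fls_subdegree f" and M = "trunc u v"]) (auto simp: mode_trunc)
  also have "\<dots> = c \<cdot> res f u v"
    by (subst res_eq_sum[where A = "fls_subdegree f" and M = "trunc u v"])
      (auto simp: mode_trunc scale_sum_right)
  finally show ?thesis .
qed

lemma res_xpow [simp]: "res (xpow n) u v = mode u n v"
proof -
  have "res (xpow n) u v = (\<Sum>k\<in>{n..<n+1}. fls_nth (xpow n) k \<cdot> mode u k v)"
    by (rule res_eq_sum) (auto split: if_splits)
  also have "{n..<n+1} = {n}" by auto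
  finally show ?thesis by simp
qed

lemma res_zero_series [simp]: "res 0 u v = 0"
  using res_const_mult[of 0 0] by simp

lemma res_sum_series: "res (sum f I) u v = (\<Sum>i\<in>I. res (f i) u v)"
  by (induction I rule: infinite_finite_induct) (simp_all add: res_add)

lemma res_vanishes:
  assumes "\<And>k. k < trunc u v \<Longrightarrow> fls_nth f k = 0"
  shows "res f u v = 0"
  by (subst res_eq_sum[where A = "trunc u v" and M = "trunc u v"]) (auto simp: assms mode_trunc)

lemma linear_res_state: "vlinear V (\<lambda>u. res f u v)"
proof unfold_locales
  show "res f (u + u') v = res f u v + res f u' v" for u u'
    by (simp add: res_def mode_add_left scale_right_distrib
        Sum_any.distrib[OF finite_res finite_res])
  show "res f (c \<cdot> u) v = c \<cdot> res f u v" for c u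
    by (simp add: res_const_mult[symmetric]) (simp add: res_def mode_scale_left mult.commute)
qed

lemma linear_res: "vlinear V (res f u)"
proof unfold_locales
  show "res f u (v + v') = res f u v + res f u v'" for v v'
    by (simp add: res_def mode_add_right scale_right_distrib
        Sum_any.distrib[OF finite_res finite_res])
  show "res f u (c \<cdot> v) = c \<cdot> res f u v" for c v
    by (simp add: res_const_mult[symmetric]) (simp add: res_def mode_scale_right mult.commute)
qed

lemmas res_add_left = vs_linear_add[OF linear_res_state]
  and res_scale_left = vs_linear_scale[OF linear_res_state]
  and res_zero_left [simp] = vs_linear_0[OF linear_res_state]
  and res_add_right = vs_linear_add[OF linear_res]
  and res_scale_right = vs_linear_scale[OF linear_res]
  and res_zero_right [simp] = vs_linear_0[OF linear_res]


section \<open>Consequences of the Jacobi identity\<close>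

abbreviation parity_sign :: "int \<Rightarrow> complex" where "parity_sign p \<equiv> (- 1) powi p"

lemma parity_sign_square [simp]: "parity_sign a * parity_sign a = 1"
  by (simp add: power_int_mult_distrib[symmetric])

lemma mode_commutator:
  assumes "u \<in> vdeg V p" "v \<in> vdeg V q" "\<And>i. I \<le> i \<Longrightarrow> mode u (int i) v = 0"
  shows "mode u m (mode v n w) - parity_sign (p * q) \<cdot> mode v n (mode u m w)
    = (\<Sum>i<I. (of_int m gchoose i) \<cdot> mode (mode u (int i) v) (m + n - int i) w)"
proof -
  have "Sum_any (\<lambda>i::nat. vscale V ((- 1) ^ i * (of_int 0 gchoose i))
        (vmode V u (m + 0 - int i) (vmode V v (n + int i) w)
         - vscale V ((- 1) powi 0 * (- 1) powi (p * q))
             (vmode V v (n + 0 - int i) (vmode V u (m + int i) w))))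
      = mode u m (mode v n w) - parity_sign (p * q) \<cdot> mode v n (mode u m w)"
    by (subst Sum_any.expand_superset[where A = "{0}"]) (auto simp: gbinomial_0_left split: if_splits)
  moreover have "Sum_any (\<lambda>i::nat. vscale V (of_int m gchoose i)
          (vmode V (vmode V u (0 + int i) v) (m + n - int i) w))
      = (\<Sum>i<I. (of_int m gchoose i) \<cdot> mode (mode u (int i) v) (m + n - int i) w)"
    by (subst Sum_any.expand_superset[where A = "{..<I}"])
      (use assms(3) in \<open>auto simp flip: not_le\<close>)
  ultimately show ?thesis using jacobi[OF assms(1,2), of 0 m n w] by simp
qed

text \<open>
  The commutator formula for arbitrary kernels. Both sides are linear in \<open>f\<close> and in \<open>g\<close> and blind
  to high powers, so it is enough to know it for powers of the variable.
\<close>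

lemma res_commutator:
  assumes "u \<in> vdeg V p" "v \<in> vdeg V q" "\<And>i. I \<le> i \<Longrightarrow> mode u (int i) v = 0"
  shows "res f u (res g v w) - parity_sign (p * q) \<cdot> res g v (res f u w)
    = (\<Sum>i<I. res (hasse_deriv i f * g) (mode u (int i) v) w)"
proof -
  define D where "D f g = res f u (res g v w) - parity_sign (p * q) \<cdot> res g v (res f u w)
    - (\<Sum>i<I. res (hasse_deriv i f * g) (mode u (int i) v) w)" for f g
  have D_pow: "D (xpow m) (xpow n) = 0" for m n
    by (simp add: D_def mode_commutator[OF assms] hasse_deriv_xpow mult.assoc xpow_mult
        res_const_mult diff_add_eq)
  have D_pow_left: "D (xpow m) g = 0" for m g
  proof -
    \<comment> \<open>A kernel \<open>g\<close> starting at \<open>x\<^sup>M\<close> annihilates each of the finitely many vectors involved.\<close>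
    define M where "M = Max ({trunc v w, trunc v (mode u m w)}
      \<union> (\<lambda>i. trunc (mode u (int i) v) w - m + int i) ` {..<I})"
    have M: "trunc v w \<le> M" "trunc v (mode u m w) \<le> M"
        "i < I \<Longrightarrow> trunc (mode u (int i) v) w - m + int i \<le> M" for i
      unfolding M_def by (rule Max_ge; auto)+
    show ?thesis
    proof (rule fls_functional_zero[where s = sc and M = M and L = "D (xpow m)"])
    fix g h :: "complex fls" and c
    show "D (xpow m) (g + h) = D (xpow m) g + D (xpow m) h"
      by (simp add: D_def res_add res_add_right distrib_left scale_right_distrib sum.distrib)
    show "D (xpow m) (fls_const c * g) = c \<cdot> D (xpow m) g"
      by (simp add: D_def res_const_mult res_scale_right mult.left_commute scale_right_diff_distrib
          scale_sum_right mult.commute[of _ c])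
  next
    fix h :: "complex fls" assume h: "\<And>k. k < M \<Longrightarrow> fls_nth h k = 0"
    have "res (hasse_deriv i (xpow m) * h) (mode u (int i) v) w = 0" if "i < I" for i
      by (rule res_vanishes, rule mult_vanishes_below[where a = "m - int i" and b = M])
        (use M(3)[OF that] h in \<open>auto simp: hasse_deriv_xpow\<close>)
    moreover have "res h v w = 0" "res h v (mode u m w) = 0"
      using M(1,2) h by (auto intro!: res_vanishes)
    ultimately show "D (xpow m) h = 0" by (simp add: D_def)
    qed (simp_all add: D_pow)
  qed
  have "D f g = 0"
  proof -
    define b where "b = fls_subdegree g"
    define M where "M = Max ({trunc u w, trunc u (res g v w)}
      \<union> (\<lambda>i. trunc (mode u (int i) v) w - b + int i) ` {..<I})"
    have M: "trunc u w \<le> M" "trunc u (res g v w) \<le> M"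
        "i < I \<Longrightarrow> trunc (mode u (int i) v) w - b + int i \<le> M" for i
      unfolding M_def by (rule Max_ge; auto)+
    show ?thesis
    proof (rule fls_functional_zero[where s = sc and M = M and L = "\<lambda>f. D f g"])
    fix f h :: "complex fls" and c
    show "D (f + h) g = D f g + D h g"
      by (simp add: D_def res_add res_add_right distrib_right scale_right_distrib sum.distrib
          hasse_deriv_add)
    show "D (fls_const c * f) g = c \<cdot> D f g"
      by (simp add: D_def res_const_mult res_scale_right scale_right_diff_distrib mult.assoc
          scale_sum_right mult.commute[of _ c] hasse_deriv_const_mult)
  next
    fix h :: "complex fls" assume h: "\<And>k. k < M \<Longrightarrow> fls_nth h k = 0"
    have "res (hasse_deriv i h * g) (mode u (int i) v) w = 0" if "i < I" for i
      by (rule res_vanishes, rule mult_vanishes_below[where a = "M - int i" and b = b])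
        (use M(3)[OF that] h in \<open>auto simp: b_def intro!: hasse_deriv_vanishes_below[where a = M]\<close>)
    moreover have "res h u w = 0" "res h u (res g v w) = 0"
      using M(1,2) h by (auto intro!: res_vanishes)
    ultimately show "D h g = 0" by (simp add: D_def)
    qed (simp_all add: D_pow_left)
  qed
  thus ?thesis by (simp add: D_def)
qed

text \<open>
  \<open>u\<^sub>-\<^sub>2 \<one>\<close> is the translate of \<open>u\<close>, and translation acts as \<open>d/dx\<close> on vertex operators. This is the
  Jacobi identity with the vacuum in the second argument, \<open>l = - 2\<close> and \<open>m = 0\<close>, where the
  identity mode of the vacuum leaves a single term: the one from the first product if \<open>n < 0\<close>, and the one from the
  second if \<open>n > 0\<close>.
\<close>

lemma mode_translate: "mode (mode u (- 2) (vvac V)) n w = (- of_int n) \<cdot> mode u (n - 1) w"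
proof (rule deg.linear_eq_on_homogeneous[where v = u])
  show "vlinear V (\<lambda>u. mode (mode u (- 2) (vvac V)) n w)"
    by unfold_locales (simp_all add: mode_add_left mode_scale_left)
  show "vlinear V (\<lambda>u. (- of_int n) \<cdot> mode u (n - 1) w)"
    by unfold_locales (simp_all add: mode_add_left mode_scale_left scale_right_distrib mult.commute)
next
  fix p u assume u: "u \<in> vdeg V p"
  have bin: "(- 1) ^ i * ((- 2 :: complex) gchoose i) = of_nat (Suc i)" for i
  proof -
    have "(- 2 :: complex) gchoose i = (- 1) ^ i * ((2 + of_nat i - 1) gchoose i)"
      using gbinomial_minus[of "2 :: complex" i] by simp
    also have "(2 + of_nat i - 1 :: complex) = of_nat (Suc i)" by simp
    also have "(of_nat (Suc i) gchoose i :: complex) = of_nat (Suc i)"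
      by (simp only: binomial_gbinomial[symmetric]) simp
    finally show ?thesis by (simp flip: power_mult_distrib add: mult.assoc[symmetric])
  qed
  have "Sum_any (\<lambda>i::nat. vscale V ((- 1) ^ i * (of_int (- 2) gchoose i))
        (vmode V u (0 + (- 2) - int i) (vmode V (vvac V) (n + int i) w)
         - vscale V ((- 1) powi (- 2) * (- 1) powi (p * 0))
             (vmode V (vvac V) (n + (- 2) - int i) (vmode V u (0 + int i) w))))
      = (- of_int n) \<cdot> mode u (n - 1) w" (is "Sum_any ?f = _")
  proof -
    have "Sum_any ?f = (\<Sum>i\<in>{nat (if n \<ge> 1 then n - 1 else - 1 - n)}. ?f i)"
      by (rule Sum_any.expand_superset) (auto simp: vac_mode split: if_splits)
    thus ?thesis by (auto simp: bin vac_mode simp del: of_nat_Suc) (simp_all flip: scale_minus_left)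
  qed
  moreover have "Sum_any (\<lambda>i::nat. vscale V (of_int 0 gchoose i)
          (vmode V (vmode V u (- 2 + int i) (vvac V)) (0 + n - int i) w))
      = mode (mode u (- 2) (vvac V)) n w"
    by (subst Sum_any.expand_superset[where A = "{0}"]) (auto simp: gbinomial_0_left split: if_splits)
  ultimately show "mode (mode u (- 2) (vvac V)) n w = (- of_int n) \<cdot> mode u (n - 1) w"
    using jacobi[OF u vac_degree, of "- 2" 0 n w] by simp
qed

text \<open>Integration by parts: the residue of the derivative of \<open>f(x) Y(u,x)\<close> vanishes.\<close>

lemma res_translate: "res f (mode u (- 2) (vvac V)) w = - res (fls_deriv f) u w"
proof -
  have "res f (mode u (- 2) (vvac V)) w + res (fls_deriv f) u w = 0"
  proof (rule fls_functional_zero[where s = sc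
        and L = "\<lambda>f. res f (mode u (- 2) (vvac V)) w + res (fls_deriv f) u w"])
    fix h :: "complex fls"
    assume "\<And>k. k < max (trunc (mode u (- 2) (vvac V)) w) (trunc u w + 1) \<Longrightarrow> fls_nth h k = 0"
    thus "res h (mode u (- 2) (vvac V)) w + res (fls_deriv h) u w = 0"
      by (simp add: res_vanishes)
  qed (simp_all add: res_add res_const_mult scale_right_distrib mode_translate deriv_xpow)
  thus ?thesis by (simp add: eq_neg_iff_add_eq_0)
qed

text \<open>
  Apply the Jacobi identity with \<open>m = - 1\<close>, \<open>n = 0\<close> to the vacuum: the modes \<open>v\<^sub>i\<close> and \<open>u\<^sub>i\<close> with
  \<open>i \<ge> 0\<close> annihilate it, and \<open>u\<^sub>-\<^sub>1 \<one> = u\<close>.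
\<close>

lemma skew_symmetry:
  assumes "u \<in> vdeg V p" "v \<in> vdeg V q" "\<And>i. I \<le> i \<Longrightarrow> mode u (l + int i) v = 0"
  shows "mode v l u = (- parity_sign (p * q) * parity_sign l) \<cdot>
    (\<Sum>i<I. (- 1) ^ i \<cdot> mode (mode u (l + int i) v) (- 1 - int i) (vvac V))"
proof -
  have "Sum_any (\<lambda>i::nat. vscale V ((- 1) ^ i * (of_int l gchoose i))
        (vmode V u (- 1 + l - int i) (vmode V v (0 + int i) (vvac V))
         - vscale V ((- 1) powi l * (- 1) powi (p * q))
             (vmode V v (0 + l - int i) (vmode V u (- 1 + int i) (vvac V)))))
      = - ((parity_sign l * parity_sign (p * q)) \<cdot> mode v l u)" (is "Sum_any ?f = _")
  proof -
    have "Sum_any ?f = (\<Sum>i\<in>{0}. ?f i)"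
    proof (rule Sum_any.expand_superset)
      have "?f i = 0" if "i > 0" for i
        using that by (simp add: creation_regular)
      thus "{i. ?f i \<noteq> 0} \<subseteq> {0}" by (auto)
    qed simp
    thus ?thesis by (simp add: creation_regular creation)
  qed
  moreover have "Sum_any (\<lambda>i::nat. vscale V (of_int (- 1) gchoose i)
          (vmode V (vmode V u (l + int i) v) (- 1 + 0 - int i) (vvac V)))
      = (\<Sum>i<I. (- 1) ^ i \<cdot> mode (mode u (l + int i) v) (- 1 - int i) (vvac V))"
    (is "Sum_any ?g = _")
  proof -
    have bin: "(of_int (- 1) gchoose i :: complex) = (- 1) ^ i" for i
      by (simp only: of_int_gbinomial[symmetric] uminus_one_gbinomial) simp
    have "Sum_any ?g = (\<Sum>i<I. ?g i)"
    proof (rule Sum_any.expand_superset)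
      have "?g i = 0" if "I \<le> i" for i
        by (simp add: assms(3)[OF that])
      thus "{i. ?g i \<noteq> 0} \<subseteq> {..<I}" by (metis (mono_tags, lifting) lessThan_iff mem_Collect_eq not_le subsetI)
    qed simp
    also have "\<dots> = (\<Sum>i<I. (- 1) ^ i \<cdot> mode (mode u (l + int i) v) (- 1 - int i) (vvac V))"
      by (simp only: bin) simp
    finally show ?thesis .
  qed
  ultimately have "(\<Sum>i<I. (- 1) ^ i \<cdot> mode (mode u (l + int i) v) (- 1 - int i) (vvac V))
      = - ((parity_sign l * parity_sign (p * q)) \<cdot> mode v l u)"
    using jacobi[OF assms(1,2), of l "- 1" 0 "vvac V"] by simp
  moreover have "parity_sign (p * q) * parity_sign l * (parity_sign l * parity_sign (p * q)) = 1"
    by (simp add: power_int_minus_one_minus power_int_mult_distrib[symmetric] flip: power_int_add)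
  ultimately show ?thesis by simp
qed

end


section \<open>Powers of 1 + x\<close>

definition binom_series :: "complex \<Rightarrow> complex fls" where
  "binom_series a = fps_to_fls (fps_binomial a)"

lemma binom_series_nth [simp]:
  "fls_nth (binom_series a) n = (if n < 0 then 0 else a gchoose nat n)"
  by (simp add: binom_series_def)

lemma binom_series_mult: "binom_series a * binom_series b = binom_series (a + b)"
  by (simp add: binom_series_def fls_times_fps_to_fls[symmetric] fps_binomial_add_mult)

lemma binom_series_1: "binom_series 1 = 1 + xpow 1"
proof (rule fls_eqI)
  fix n :: int
  have "(1 :: complex) gchoose nat n = of_nat (1 choose nat n)"
    by (simp add: binomial_gbinomial)
  thus "fls_nth (binom_series 1) n = fls_nth (1 + xpow 1) n"
    by (auto simp: binomial_eq_0)
qed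

lemma binom_series_Suc: "binom_series (a + 1) = binom_series a * (1 + xpow 1)"
  by (simp flip: binom_series_mult add: binom_series_1)

lemma deriv_binom_series: "fls_deriv (binom_series a) = fls_const a * binom_series (a - 1)"
proof (rule fls_eqI)
  fix n :: int
  show "fls_nth (fls_deriv (binom_series a)) n = fls_nth (fls_const a * binom_series (a - 1)) n"
  proof (cases "n \<ge> 0")
    case True
    hence "nat (n + 1) = Suc (nat n)" "of_int (n + 1) = (of_nat (Suc (nat n)) :: complex)" by auto
    thus ?thesis using True gbinomial_absorption[of "nat n" a] by (simp add: add.commute)
  next
    case False
    thus ?thesis by (cases "n = - 1") auto
  qed
qed

text \<open>As Laurent series have finitely many negative powers, these are the polynomials in \<open>1/x\<close>.\<close>

definition polar :: "complex fls \<Rightarrow> bool" where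
  "polar h \<longleftrightarrow> (\<forall>n>0. fls_nth h n = 0)"

text \<open>
  Polynomials in \<open>1/x\<close> are stable under \<open>(1 + x) d/dx\<close>; hence all derivatives of \<open>(1 + x)\<^sup>b h(1/x)\<close>
  are again of that form, the exponent dropping by one each time.
\<close>

lemma hasse_deriv_binom_polar:
  assumes "polar h"
  shows "\<exists>h'. polar h' \<and> hasse_deriv i (binom_series b * h) = binom_series (b - of_nat i) * h'"
proof (induction i)
  case 0
  show ?case using assms by auto
next
  case (Suc i)
  then obtain h' where h': "polar h'"
    "hasse_deriv i (binom_series b * h) = binom_series (b - of_nat i) * h'" by blast
  define c where "c = b - of_nat i"
  define h'' where
    "h'' = fls_const (1 / of_nat (Suc i)) * (fls_const c * h' + (1 + xpow 1) * fls_deriv h')"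
  have "(1 + xpow 1) * fls_deriv h' = fls_deriv h' + fls_deriv h' * xpow 1"
    by (simp add: algebra_simps)
  hence "polar h''"
    using h'(1) by (auto simp: polar_def h''_def distrib_left simp del: of_nat_Suc)
  moreover have "fls_deriv (binom_series c * h') =
      binom_series (c - 1) * (fls_const c * h' + (1 + xpow 1) * fls_deriv h')"
  proof -
    have "fls_deriv (binom_series c * h')
        = binom_series c * fls_deriv h' + fls_const c * binom_series (c - 1) * h'"
      by (simp only: fls_deriv_mult deriv_binom_series)
    also have "binom_series c * fls_deriv h' = binom_series (c - 1) * (1 + xpow 1) * fls_deriv h'"
      using binom_series_Suc[of "c - 1"] by simp
    finally show ?thesis by (simp only: distrib_left distrib_right mult_1_left mult_ac add_ac)
  qed
  hence "hasse_deriv (Suc i) (binom_series b * h) = binom_series (b - of_nat (Suc i)) * h''"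
    by (simp add: hasse_deriv_Suc h'(2) c_def[symmetric] h''_def mult.left_commute del: of_nat_Suc)
      (simp add: c_def algebra_simps)
  ultimately show ?case by blast
qed

lemma polar_eq_sum:
  assumes "polar h"
  shows "h = (\<Sum>n\<in>{fls_subdegree h..0}. fls_const (fls_nth h n) * xpow n)"
proof (rule fls_eqI)
  fix k
  show "fls_nth h k = fls_nth (\<Sum>n\<in>{fls_subdegree h..0}. fls_const (fls_nth h n) * xpow n) k"
    using assms by (simp add: fls_nth_sum if_distrib cong: if_cong) (auto simp: polar_def)
qed


section \<open>Weights\<close>

context dg_vertex_algebra
begin

lemma linear_mode_right_deg:
  assumes "u \<in> vdeg V p"
  shows "deg.comp i (mode u n v) = mode u n (deg.comp (i - (p - 2 * n - 2)) v)"
  by (rule deg.comp_linear_shift[OF mode_linear])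
    (use mode_degree[OF assms] in \<open>simp add: algebra_simps\<close>)

lemma res_degrees:
  assumes uv: "u \<in> vdeg V p" "v \<in> vdeg V q" and f: "\<And>k. k < m \<Longrightarrow> fls_nth f k = 0"
  shows "res f u v \<in> deg.supported {d. d \<le> p + q - 2 * m - 2 \<and> even (d - p - q)}"
proof -
  have "res f u v = (\<Sum>n\<in>{m..<trunc u v}. fls_nth f n \<cdot> mode u n v)"
    by (rule res_eq_sum) (auto simp: f mode_trunc)
  also have "\<dots> \<in> deg.supported {d. d \<le> p + q - 2 * m - 2 \<and> even (d - p - q)}"
    by (intro subspace_sum subspace_scale deg.subspace_supported
        deg.homogeneous_supported[OF mode_degree[OF uv]]) auto
  finally show ?thesis .
qed

lemma res_binom_eq_sum_nat:
  "Sum_any (\<lambda>n::nat. (a gchoose n) \<cdot> mode u (int n - d) v) = res (binom_series a * xpow (- d)) u v"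
proof -
  define N where "N = nat (trunc u v + d)"
  have "Sum_any (\<lambda>n::nat. (a gchoose n) \<cdot> mode u (int n - d) v)
      = (\<Sum>n<N. (a gchoose n) \<cdot> mode u (int n - d) v)"
  proof (rule Sum_any.expand_superset)
    have "mode u (int n - d) v = 0" if "N \<le> n" for n
      using that by (intro mode_trunc) (auto simp: N_def)
    thus "{n. (a gchoose n) \<cdot> mode u (int n - d) v \<noteq> 0} \<subseteq> {..<N}"
      by clarsimp (metis not_le)
  qed simp
  also have "\<dots> = (\<Sum>k\<in>{- d..<trunc u v}. fls_nth (binom_series a * xpow (- d)) k \<cdot> mode u k v)"
    by (rule sum.reindex_bij_witness[of _ "\<lambda>k. nat (k + d)" "\<lambda>n. int n - d"]) (auto simp: N_def)
  also have "\<dots> = res (binom_series a * xpow (- d)) u v"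
    by (rule res_eq_sum[symmetric]) (auto simp: mode_trunc)
  finally show ?thesis .
qed

end

context dg_vertex_operator_algebra
begin

sublocale wt: graded_vector_space "vscale V" "half_weight_space V"
  by unfold_locales (rule weight_grading)

lemma weight_space_iff: "v \<in> weight_space V h \<longleftrightarrow> mode (vomega V) 1 v = h \<cdot> v"
  by (simp add: weight_space_def vir_def)

lemma translation_eq: "mode (vomega V) 0 v = mode v (- 2) (vvac V)"
  using translation[of v] by (simp add: vir_def)

text \<open>
  The commutator formula for \<open>L(0) = \<omega>\<^sub>1\<close>; only \<open>\<omega>\<^sub>0 u\<close>, the translate of \<open>u\<close>, and \<open>\<omega>\<^sub>1 u\<close> contribute.
  No sign occurs since \<open>\<omega>\<close> has even degree.
\<close>

lemma L0_mode:
  "mode (vomega V) 1 (mode u n w) = mode u n (mode (vomega V) 1 w)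
     + mode (mode (vomega V) 1 u) n w - of_int (n + 1) \<cdot> mode u n w"
proof (induction u rule: deg.homogeneous_induct)
  case (homogeneous p u)
  have "parity_sign (4 * p) = 1" by (simp add: power_int_mult)
  \<comment> \<open>At least \<open>2\<close>, so that the two terms with a non-zero binomial coefficient are within the range.\<close>
  define I where "I = 2 + nat (trunc (vomega V) u)"
  have "mode (vomega V) 1 (mode u n w) - mode u n (mode (vomega V) 1 w)
      = (\<Sum>i<I. (of_int 1 gchoose i) \<cdot> mode (mode (vomega V) (int i) u) (1 + n - int i) w)"
    using mode_commutator[OF omega_degree homogeneous, of I 1 n w] \<open>parity_sign (4 * p) = 1\<close>
    by (simp add: I_def mode_trunc)
  also have "\<dots> = (\<Sum>i\<in>{0,1}. (of_int 1 gchoose i) \<cdot> mode (mode (vomega V) (int i) u) (1 + n - int i) w)"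
  proof (rule sum.mono_neutral_right)
    have "(1 gchoose i :: complex) = 0" if "i \<notin> {0,1}" for i
    proof -
      have "(1 gchoose i :: complex) = of_nat (1 choose i)" by (simp add: binomial_gbinomial)
      thus ?thesis using that by (simp add: binomial_eq_0)
    qed
    thus "\<forall>i\<in>{..<I} - {0,1}. (of_int 1 gchoose i) \<cdot> mode (mode (vomega V) (int i) u) (1 + n - int i) w = 0"
      by simp
  qed (auto simp: I_def)
  also have "\<dots> = mode (mode (vomega V) 1 u) n w - of_int (n + 1) \<cdot> mode u n w"
    by (simp add: translation_eq mode_translate scale_left_distrib algebra_simps)
  finally show ?case by (simp add: algebra_simps)
next
  case (add u v)
  have "mode (vomega V) 1 (mode (u + v) n w)
      = mode (vomega V) 1 (mode u n w) + mode (vomega V) 1 (mode v n w)"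
    by (simp add: mode_add_left mode_add_right)
  also note add(1)
  also note add(2)
  finally show ?case
    by (simp add: mode_add_left mode_add_right scale_right_distrib)
qed

lemma mode_weight:
  "u \<in> weight_space V a \<Longrightarrow> v \<in> weight_space V b \<Longrightarrow> mode u n v \<in> weight_space V (a + b - of_int n - 1)"
  by (simp add: weight_space_iff L0_mode mode_scale_left mode_scale_right algebra_simps)

lemma mode_half_weight:
  assumes "u \<in> half_weight_space V k" "v \<in> half_weight_space V l"
  shows "mode u n v \<in> half_weight_space V (k + l - 2 * n - 2)"
proof -
  have "of_int k / 2 + of_int l / 2 - of_int n - 1 = (of_int (k + l - 2 * n - 2) / 2 :: complex)"
    by (simp add: field_simps)
  thus ?thesis using mode_weight[OF assms, of n] by (simp only:)
qed

lemma vac_half_weight: "vvac V \<in> half_weight_space V 0"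
  by (simp add: weight_space_iff creation_regular)

lemma translate_half_weight:
  "u \<in> half_weight_space V k \<Longrightarrow> mode u (- 2) (vvac V) \<in> half_weight_space V (k + 2)"
  using mode_half_weight[OF _ vac_half_weight, of u k "- 2"] by (simp add: add.commute)

lemma diff_half_weight: "v \<in> half_weight_space V k \<Longrightarrow> vdiff V v \<in> half_weight_space V k"
proof -
  have "vdiff V (mode (vomega V) 1 v) = mode (vomega V) 1 (vdiff V v)"
    using diff_mode[OF omega_degree, of 1 v] by (simp add: omega_closed)
  thus "v \<in> half_weight_space V k \<Longrightarrow> vdiff V v \<in> half_weight_space V k"
    by (metis weight_space_iff diff_scale)
qed

text \<open>
  \<open>L(0)\<close> has cohomological degree \<open>0\<close>, so the two gradings are compatible and identities that are
  additive can be tested on bihomogeneous vectors.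
\<close>

lemma deg_comp_half_weight:
  assumes "v \<in> half_weight_space V k"
  shows "deg.comp p v \<in> half_weight_space V k"
  using linear_mode_right_deg[OF omega_degree, of p 1 v] assms
  by (simp add: weight_space_iff deg.comp_scale)

lemma wt_comp_degree:
  assumes "v \<in> vdeg V p"
  shows "wt.comp k v \<in> vdeg V p"
proof -
  have "deg.comp j (wt.comp k v) = wt.comp k (deg.comp j v)" for j
    using wt.comp_linear_shift[OF deg.linear_comp, of j 0 k v] by (simp add: deg_comp_half_weight)
  thus ?thesis using assms by (simp add: deg.homogeneous_iff)
qed

lemma vdeg_induct [consumes 1, case_names bihomogeneous add]:
  assumes v: "v \<in> vdeg V p"
    and hom: "\<And>k v. v \<in> vdeg V p \<Longrightarrow> v \<in> half_weight_space V k \<Longrightarrow> P v"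
    and add: "\<And>u v. P u \<Longrightarrow> P v \<Longrightarrow> P (u + v)"
  shows "P v"
proof -
  have "P 0"
    using hom[of 0 0] subspace_0[OF deg.subspace_piece] subspace_0[OF wt.subspace_piece] by blast
  have "P (\<Sum>k\<in>F. wt.comp k v)" if "finite F" for F
    using that
  proof induction
    case (insert k F)
    thus ?case by (simp add: add hom[OF wt_comp_degree[OF v] wt.comp_in])
  qed (simp add: \<open>P 0\<close>)
  from this[OF wt.finite_comp[of v]] show ?thesis by (simp only: wt.sum_comp)
qed

lemma bihomogeneous_induct [case_names bihomogeneous add]:
  assumes hom: "\<And>p k v. v \<in> vdeg V p \<Longrightarrow> v \<in> half_weight_space V k \<Longrightarrow> P v"
    and add: "\<And>u v. P u \<Longrightarrow> P v \<Longrightarrow> P (u + v)"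
  shows "P v"
  by (induction v rule: deg.homogeneous_induct, erule vdeg_induct) (auto intro: hom add)


section \<open>The products of the Zhu algebra as residues\<close>

text \<open>
  Residues whose kernel depends on the weight of the state. Both products of Zhu and the bracket
  below are of this form.
\<close>

definition weighted_res :: "(complex \<Rightarrow> complex fls) \<Rightarrow> 'v \<Rightarrow> 'v \<Rightarrow> 'v" where
  "weighted_res F u v = Sum_any (\<lambda>k. res (F (of_int k / 2)) (wt.comp k u) v)"

lemma finite_weighted_res: "finite {k. res (F (of_int k / 2)) (wt.comp k u) v \<noteq> 0}"
  by (rule finite_subset[OF _ wt.finite_comp[of u]]) auto

lemma weighted_res_homogeneous:
  assumes "u \<in> half_weight_space V k"
  shows "weighted_res F u v = res (F (of_int k / 2)) u v"
  unfolding weighted_res_def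
  by (subst Sum_any.expand_superset[where A = "{k}"])
    (auto simp: wt.comp_homogeneous[OF assms] split: if_splits)

lemma linear_weighted_res_state: "vlinear V (\<lambda>u. weighted_res F u v)"
proof unfold_locales
  show "weighted_res F (u + u') v = weighted_res F u v + weighted_res F u' v" for u u'
    by (simp add: weighted_res_def wt.comp_add res_add_left
        Sum_any.distrib[OF finite_weighted_res finite_weighted_res])
  show "weighted_res F (c \<cdot> u) v = c \<cdot> weighted_res F u v" for c u
  proof -
    have "weighted_res F (c \<cdot> u) v
        = (\<Sum>k\<in>{k. wt.comp k u \<noteq> 0}. c \<cdot> res (F (of_int k / 2)) (wt.comp k u) v)"
      unfolding weighted_res_def
      by (subst Sum_any.expand_superset[OF wt.finite_comp[of u]])
        (auto simp: wt.comp_scale res_scale_left)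
    also have "\<dots> = c \<cdot> weighted_res F u v"
      unfolding weighted_res_def
      by (subst Sum_any.expand_superset[OF wt.finite_comp[of u]]) (auto simp: scale_sum_right)
    finally show ?thesis .
  qed
qed

lemma linear_weighted_res: "vlinear V (weighted_res F u)"
proof unfold_locales
  have eq: "weighted_res F u v = (\<Sum>k\<in>{k. wt.comp k u \<noteq> 0}. res (F (of_int k / 2)) (wt.comp k u) v)" for v
    unfolding weighted_res_def
    by (subst Sum_any.expand_superset[OF wt.finite_comp[of u]]) auto
  show "weighted_res F u (v + v') = weighted_res F u v + weighted_res F u v'" for v v'
    by (simp add: eq res_add_right sum.distrib)
  show "weighted_res F u (c \<cdot> v) = c \<cdot> weighted_res F u v" for c v
    by (simp add: eq res_scale_right scale_sum_right)
qed

lemma zhu_star_eq: "zhu_star V = weighted_res (\<lambda>a. binom_series a * xpow (- 1))"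
  using res_binom_eq_sum_nat[where d = 1]
  by (intro ext) (simp add: zhu_star_def weighted_res_def)

lemma zhu_circ_eq: "zhu_circ V = weighted_res (\<lambda>a. binom_series a * xpow (- 2))"
  using res_binom_eq_sum_nat[where d = 2]
  by (intro ext) (simp add: zhu_circ_def weighted_res_def)

text \<open>
  The residue of \<open>(1 + x)\<^sup>a\<^sup>-\<^sup>1 Y(u,x) v\<close> for \<open>u\<close> of weight \<open>a\<close>. Modulo \<open>O(V)\<close> this is the graded
  commutator for the product of the Zhu algebra.
\<close>

definition zhu_bracket :: "'v \<Rightarrow> 'v \<Rightarrow> 'v" where
  "zhu_bracket = weighted_res (\<lambda>a. binom_series (a - 1))"

lemmas linear_star_left = linear_weighted_res_state[of "\<lambda>a. binom_series a * xpow (- 1)", folded zhu_star_eq]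
  and linear_star_right = linear_weighted_res[of "\<lambda>a. binom_series a * xpow (- 1)", folded zhu_star_eq]
  and linear_circ_left = linear_weighted_res_state[of "\<lambda>a. binom_series a * xpow (- 2)", folded zhu_circ_eq]
  and linear_circ_right = linear_weighted_res[of "\<lambda>a. binom_series a * xpow (- 2)", folded zhu_circ_eq]
  and linear_bracket_left = linear_weighted_res_state[of "\<lambda>a. binom_series (a - 1)", folded zhu_bracket_def]
  and linear_bracket_right = linear_weighted_res[of "\<lambda>a. binom_series (a - 1)", folded zhu_bracket_def]

lemmas star_add_left = vs_linear_add[OF linear_star_left]
  and star_diff_left = vs_linear_diff[OF linear_star_left]
  and star_zero_left = vs_linear_0[OF linear_star_left]
  and star_add_right = vs_linear_add[OF linear_star_right]
  and star_diff_right = vs_linear_diff[OF linear_star_right]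
  and star_zero_right = vs_linear_0[OF linear_star_right]
  and circ_add_left = vs_linear_add[OF linear_circ_left]
  and circ_add_right = vs_linear_add[OF linear_circ_right]
  and zhu_bracket_add_left = vs_linear_add[OF linear_bracket_left]
  and zhu_bracket_zero_left = vs_linear_0[OF linear_bracket_left]
  and zhu_bracket_add_right = vs_linear_add[OF linear_bracket_right]
  and zhu_bracket_zero_right = vs_linear_0[OF linear_bracket_right]

lemma star_homogeneous:
  "u \<in> half_weight_space V k \<Longrightarrow> zhu_star V u v = res (binom_series (of_int k / 2) * xpow (- 1)) u v"
  and circ_homogeneous:
  "u \<in> half_weight_space V k \<Longrightarrow> zhu_circ V u v = res (binom_series (of_int k / 2) * xpow (- 2)) u v"
  and bracket_homogeneous:
  "u \<in> half_weight_space V k \<Longrightarrow> zhu_bracket u v = res (binom_series (of_int k / 2 - 1)) u v"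
  by (simp_all add: zhu_star_eq zhu_circ_eq zhu_bracket_def weighted_res_homogeneous)


section \<open>The subspace O(V)\<close>

lemma subspace_O: "subspace (zhu_O V)"
  by (simp add: zhu_O_def)

lemmas O_0 = subspace_0[OF subspace_O]
  and O_add = subspace_add[OF subspace_O]
  and O_diff = subspace_diff[OF subspace_O]
  and O_neg = subspace_neg[OF subspace_O]
  and O_scale = subspace_scale[OF subspace_O]
  and O_sum = subspace_sum[OF subspace_O]

lemma circ_in_O: "zhu_circ V u v \<in> zhu_O V"
  unfolding zhu_O_def by (rule span_base) blast

lemma O_induct [consumes 1, case_names circ zero add scale]:
  assumes x: "x \<in> zhu_O V"
    and circ: "\<And>p q k u v. u \<in> vdeg V p \<Longrightarrow> u \<in> half_weight_space V k \<Longrightarrow> v \<in> vdeg V q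
      \<Longrightarrow> P (zhu_circ V u v)"
    and zero: "P 0"
    and add: "\<And>x y. P x \<Longrightarrow> P y \<Longrightarrow> P (x + y)"
    and scale: "\<And>c x. P x \<Longrightarrow> P (c \<cdot> x)"
  shows "P x"
proof -
  have P_circ: "P (zhu_circ V u v)" for u v
  proof (induction u rule: bihomogeneous_induct)
    case (bihomogeneous p k u)
    show ?case
      by (induction v rule: deg.homogeneous_induct) (auto simp: circ_add_right intro: circ bihomogeneous add)
  qed (simp add: circ_add_left add)
  show ?thesis
    using x unfolding zhu_O_def
    by (induction rule: span_induct_alt) (auto intro: zero add scale P_circ)
qed

text \<open>
  The kernel in the definition of \<open>O(V)\<close> has a pole of order two. Higher poles do not lead out of
  \<open>O(V)\<close>: apply the relation for a pole of order \<open>m\<close> to the translate of \<open>u\<close>, whose weight is one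
  more, and integrate by parts; the derivative of the kernel has a pole of order \<open>m + 1\<close>.
\<close>

lemma res_pole_in_O:
  "u \<in> half_weight_space V k \<Longrightarrow>
     res (binom_series (of_int k / 2) * xpow (- int (j + 2))) u v \<in> zhu_O V"
proof (induction j arbitrary: u k)
  case 0
  thus ?case using circ_in_O[of u v] by (simp add: circ_homogeneous)
next
  case (Suc j)
  define a :: complex where "a = of_int k / 2"
  define m :: int where "m = int (j + 2)"
  define u' where "u' = mode u (- 2) (vvac V)"
  have wt: "of_int (k + 2) / 2 = a + 1" by (simp add: a_def field_simps)
  have IH: "res (binom_series (a + 1) * xpow (- m)) u' v \<in> zhu_O V"
    using Suc.IH[OF translate_half_weight[OF Suc.prems]] by (simp only: wt m_def u'_def)
  have IH': "res (binom_series a * xpow (- m)) u v \<in> zhu_O V"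
    using Suc.IH[OF Suc.prems] by (simp only: a_def m_def)
  have "fls_deriv (binom_series (a + 1) * xpow (- m))
      = fls_const (a + 1) * (binom_series a * xpow (- m))
        + fls_const (- of_int m) * (binom_series a * (1 + xpow 1) * xpow (- m - 1))"
    by (simp add: deriv_binom_series deriv_xpow binom_series_Suc[symmetric] mult_ac)
  also have "binom_series a * (1 + xpow 1) * xpow (- m - 1)
      = binom_series a * xpow (- m - 1) + binom_series a * xpow (- m)"
    by (simp add: algebra_simps xpow_mult)
  finally have deriv: "res (binom_series (a + 1) * xpow (- m)) u' v
      = of_int m \<cdot> (res (binom_series a * xpow (- m - 1)) u v + res (binom_series a * xpow (- m)) u v)
        - (a + 1) \<cdot> res (binom_series a * xpow (- m)) u v"
    by (simp only: u'_def res_translate res_add res_const_mult) simp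
  have "of_int m \<cdot> res (binom_series a * xpow (- m - 1)) u v \<in> zhu_O V"
  proof -
    have "of_int m \<cdot> res (binom_series a * xpow (- m - 1)) u v
      = res (binom_series (a + 1) * xpow (- m)) u' v
        + (a + 1 - of_int m) \<cdot> res (binom_series a * xpow (- m)) u v"
      by (simp add: deriv scale_right_distrib scale_left_diff_distrib)
    thus ?thesis by (simp only: O_add[OF IH O_scale[OF IH']])
  qed
  hence "(1 / of_int m) \<cdot> (of_int m \<cdot> res (binom_series a * xpow (- m - 1)) u v) \<in> zhu_O V"
    by (rule O_scale)
  moreover have "(of_int m :: complex) \<noteq> 0" unfolding of_int_eq_0_iff by (simp add: m_def)
  ultimately have "res (binom_series a * xpow (- m - 1)) u v \<in> zhu_O V" by simp
  thus ?case by (simp add: a_def m_def algebra_simps)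
qed

lemma res_polar_in_O:
  assumes u: "u \<in> half_weight_space V k" and h: "polar h"
  shows "res (binom_series (of_int k / 2) * xpow (- 2) * h) u v \<in> zhu_O V"
proof -
  let ?B = "binom_series (of_int k / 2)"
  have "?B * xpow (- 2) * (fls_const c * xpow n) = fls_const c * (?B * xpow (n - 2))" for n c
  proof -
    have "?B * xpow (- 2) * (fls_const c * xpow n) = fls_const c * (?B * (xpow (- 2) * xpow n))"
      by (simp only: mult_ac)
    thus ?thesis by (simp add: xpow_mult)
  qed
  hence "res (?B * xpow (- 2) * h) u v
      = (\<Sum>n\<in>{fls_subdegree h..0}. fls_nth h n \<cdot> res (?B * xpow (n - 2)) u v)"
    by (subst polar_eq_sum[OF h]) (simp only: sum_distrib_left res_sum_series res_const_mult)
  also have "\<dots> \<in> zhu_O V"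
  proof (intro O_sum O_scale)
    fix n assume "n \<in> {fls_subdegree h..0}"
    hence "n - 2 = - int (nat (- n) + 2)" by simp
    thus "res (?B * xpow (n - 2)) u v \<in> zhu_O V"
      using res_pole_in_O[OF u, of "nat (- n)" v] by (simp only:)
  qed
  finally show ?thesis .
qed

text \<open>
  By the commutator formula, such an operator maps \<open>a \<circ> b\<close> to another element \<open>a \<circ> b'\<close> plus
  residues of \<open>Y(u\<^sub>i a, x) b\<close>, whose kernels are again of the form allowed in \<open>res_polar_in_O\<close>
  because each derivative lowers the exponent of \<open>1 + x\<close> by one, just as the weight of \<open>u\<^sub>i a\<close>
  drops by one when \<open>i\<close> grows. Left multiplication by \<open>u\<close> (where \<open>h = 1 + 1/x\<close>) and the bracket
  with \<open>u\<close> (where \<open>h = 1\<close>) are of this form.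
\<close>

lemma res_preserves_O:
  assumes u: "u \<in> vdeg V p" "u \<in> half_weight_space V k" and h: "polar h" and x: "x \<in> zhu_O V"
  shows "res (binom_series (of_int k / 2 - 1) * h) u x \<in> zhu_O V"
  using x
proof (induction rule: O_induct)
  case (circ q r l a b)
  define f where "f = binom_series (of_int k / 2 - 1) * h"
  define g where "g = binom_series (of_int l / 2) * xpow (- 2)"
  define I where "I = nat (trunc u a)"
  have summand: "res (hasse_deriv i f * g) (mode u (int i) a) b \<in> zhu_O V" for i
  proof -
    obtain h' where h': "polar h'"
      "hasse_deriv i f = binom_series (of_int k / 2 - 1 - of_nat i) * h'"
      using hasse_deriv_binom_polar[OF h, of i "of_int k / 2 - 1"] unfolding f_def by blast
    have "hasse_deriv i f * g
        = binom_series (of_int k / 2 - 1 - of_nat i) * binom_series (of_int l / 2) * xpow (- 2) * h'"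
      by (simp add: h'(2) g_def mult_ac)
    also have "\<dots> = binom_series (of_int (k + l - 2 * int i - 2) / 2) * xpow (- 2) * h'"
      by (simp add: binom_series_mult field_simps)
    finally show ?thesis
      using res_polar_in_O[OF mode_half_weight[OF u(2) circ(2), of "int i"] h'(1)] by simp
  qed
  have "res f u (res g a b) - parity_sign (p * q) \<cdot> res g a (res f u b)
      = (\<Sum>i<I. res (hasse_deriv i f * g) (mode u (int i) a) b)"
    by (rule res_commutator[OF u(1) circ(1)]) (simp add: I_def mode_trunc)
  hence "res f u (res g a b) = parity_sign (p * q) \<cdot> res g a (res f u b)
      + (\<Sum>i<I. res (hasse_deriv i f * g) (mode u (int i) a) b)"
    by (simp add: algebra_simps)
  moreover have "res g a (res f u b) \<in> zhu_O V"
    using circ_in_O[of a "res f u b"] by (simp add: circ_homogeneous[OF circ(2)] g_def)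
  ultimately have "res f u (res g a b) \<in> zhu_O V"
    by (simp only: O_add O_scale O_sum summand)
  thus ?case by (simp add: f_def g_def circ_homogeneous[OF circ(2)])
qed (auto simp: res_add_right res_scale_right intro: O_0 O_add O_scale)

lemma star_kernel: "binom_series a * xpow (- 1) = binom_series (a - 1) * (1 + xpow (- 1))"
  using binom_series_Suc[of "a - 1"] by (simp add: algebra_simps xpow_mult)

lemma star_O_right: "x \<in> zhu_O V \<Longrightarrow> zhu_star V u x \<in> zhu_O V"
proof (induction u rule: bihomogeneous_induct)
  case (bihomogeneous p k u)
  have "polar (1 + xpow (- 1))" by (simp add: polar_def)
  from res_preserves_O[OF bihomogeneous(1,2) this bihomogeneous(3)] show ?case
    by (simp only: star_homogeneous[OF bihomogeneous(2)] star_kernel)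
qed (simp add: star_add_left O_add)

lemma bracket_O_right: "x \<in> zhu_O V \<Longrightarrow> zhu_bracket u x \<in> zhu_O V"
proof (induction u rule: bihomogeneous_induct)
  case (bihomogeneous p k u)
  have "polar 1" by (simp add: polar_def)
  from res_preserves_O[OF bihomogeneous(1,2) this bihomogeneous(3)] show ?case
    by (simp add: bracket_homogeneous[OF bihomogeneous(2)])
qed (simp add: zhu_bracket_add_left O_add)


section \<open>Skew symmetry modulo O(V)\<close>

lemma translate_mod_O:
  assumes "w \<in> half_weight_space V k"
  shows "mode w (- 2) (vvac V) + (of_int k / 2) \<cdot> w \<in> zhu_O V"
proof -
  have "res (binom_series a * xpow (- 2)) w (vvac V) = mode w (- 2) (vvac V) + a \<cdot> w" for a
  proof -
    have "res (binom_series a * xpow (- 2)) w (vvac V)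
        = (\<Sum>n\<in>{- 2..<0}. fls_nth (binom_series a * xpow (- 2)) n \<cdot> mode w n (vvac V))"
      by (rule res_eq_sum) (auto simp: creation_regular)
    also have "{- 2..<0} = {- 2, - 1 :: int}" by auto
    finally show ?thesis by (simp add: creation)
  qed
  thus ?thesis using circ_in_O[of w "vvac V"] by (simp add: circ_homogeneous[OF assms])
qed

text \<open>
  Since \<open>L(-1) w\<close> is congruent to \<open>- wt(w) w\<close>, the creation operators act modulo \<open>O(V)\<close> as
  \<open>Y(w,x) \<one> = (1 + x)\<^sup>-\<^sup>w\<^sup>t\<^sup>(\<^sup>w\<^sup>) w\<close>.
\<close>

lemma creation_mod_O:
  "w \<in> half_weight_space V k \<Longrightarrow>
     mode w (- 1 - int i) (vvac V) - ((- of_int k / 2) gchoose i) \<cdot> w \<in> zhu_O V"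
proof (induction i arbitrary: w k)
  case 0
  show ?case by (simp add: creation O_0)
next
  case (Suc i)
  define a :: complex where "a = of_int k / 2"
  define w' where "w' = mode w (- 2) (vvac V)"
  define t where "t = mode w (- 1 - int (Suc i)) (vvac V)"
  have t: "mode w' (- 1 - int i) (vvac V) = of_nat (Suc i) \<cdot> t"
    by (simp add: w'_def t_def mode_translate algebra_simps)
  have "- of_int (k + 2) / 2 = - a - 1" by (simp add: a_def field_simps)
  hence "of_nat (Suc i) \<cdot> t - ((- a - 1) gchoose i) \<cdot> w' \<in> zhu_O V"
    using Suc.IH[OF translate_half_weight[OF Suc.prems]] by (simp only: w'_def[symmetric] t)
  moreover have "((- a - 1) gchoose i) \<cdot> (w' + a \<cdot> w) \<in> zhu_O V"
    using translate_mod_O[OF Suc.prems] by (simp add: w'_def a_def O_scale)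
  ultimately have "(of_nat (Suc i) \<cdot> t - ((- a - 1) gchoose i) \<cdot> w')
      + ((- a - 1) gchoose i) \<cdot> (w' + a \<cdot> w) \<in> zhu_O V"
    by (rule O_add)
  also have "(of_nat (Suc i) \<cdot> t - ((- a - 1) gchoose i) \<cdot> w')
      + ((- a - 1) gchoose i) \<cdot> (w' + a \<cdot> w)
      = of_nat (Suc i) \<cdot> t - (- a * ((- a - 1) gchoose i)) \<cdot> w"
    by (simp add: scale_right_distrib mult.commute)
  also have "\<dots> = of_nat (Suc i) \<cdot> (t - ((- a) gchoose Suc i) \<cdot> w)"
    by (simp only: gbinomial_absorption[symmetric] scale_right_diff_distrib scale_scale)
  finally have "(1 / of_nat (Suc i)) \<cdot> (of_nat (Suc i) \<cdot> (t - ((- a) gchoose Suc i) \<cdot> w)) \<in> zhu_O V"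
    by (rule O_scale)
  hence "t - ((- a) gchoose Suc i) \<cdot> w \<in> zhu_O V" by (simp del: of_nat_Suc)
  thus ?case by (simp add: t_def a_def)
qed

text \<open>
  Insert skew symmetry into \<open>v * u\<close>, replace the creation operators by their values modulo
  \<open>O(V)\<close>, and collect the coefficient of each \<open>u\<^sub>m\<^sub>-\<^sub>1 v\<close>: it is a Vandermonde convolution.
\<close>

lemma star_swap_mod_O:
  assumes u: "u \<in> vdeg V p" "u \<in> half_weight_space V k"
    and v: "v \<in> vdeg V q" "v \<in> half_weight_space V l"
  shows "zhu_star V v u - parity_sign (p * q) \<cdot> res (binom_series (of_int k / 2 - 1) * xpow (- 1)) u v
    \<in> zhu_O V"
proof -
  define a b :: complex where "a = of_int k / 2" and "b = of_int l / 2"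
  \<comment> \<open>The coefficient with index \<open>n\<close> belongs to the mode \<open>n - 1\<close>, hence the successor.\<close>
  define N where "N = Suc (nat (max (trunc u v) (trunc v u)))"
  define y where "y m = mode u (int m - 1) v" for m
  define c where "c n i = (b gchoose n) * ((- 1) ^ (n + i) * ((of_nat (n + i) - a - b) gchoose i))" for n i
  have bound: "mode u (int n - 1) v = 0" "mode v (int n - 1) u = 0" if "N \<le> n" for n
    using that by (auto simp: N_def intro!: mode_trunc)
  have res_eq: "res (binom_series e * xpow (- 1)) x z = (\<Sum>n<N. (e gchoose n) \<cdot> mode x (int n - 1) z)"
    if "\<And>n. N \<le> n \<Longrightarrow> mode x (int n - 1) z = 0" for e x z
  proof -
    have "{n. (e gchoose n) \<cdot> mode x (int n - 1) z \<noteq> 0} \<subseteq> {..<N}"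
      using that by clarsimp (metis not_le)
    thus ?thesis
      by (subst res_binom_eq_sum_nat[symmetric], subst Sum_any.expand_superset) auto
  qed
  have step: "mode v (int n - 1) u - parity_sign (p * q) \<cdot> (\<Sum>i<N - n.
      ((- 1) ^ (n + i) * ((of_nat (n + i) - a - b) gchoose i)) \<cdot> y (n + i)) \<in> zhu_O V" for n
  proof -
    have idx: "int n - 1 + int i = int (n + i) - 1" for i by simp
    have sg: "parity_sign (int n - 1) = - ((- 1) ^ n)"
      by (simp add: power_int_diff power_int_of_nat)
    have "mode v (int n - 1) u = (- parity_sign (p * q) * parity_sign (int n - 1)) \<cdot>
      (\<Sum>i<N - n. (- 1) ^ i \<cdot> mode (mode u (int n - 1 + int i) v) (- 1 - int i) (vvac V))"
      by (rule skew_symmetry[OF u(1) v(1)]) (simp add: idx bound del: of_nat_add)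
    also have "\<dots> = parity_sign (p * q) \<cdot>
      (\<Sum>i<N - n. (- 1) ^ (n + i) \<cdot> mode (y (n + i)) (- 1 - int i) (vvac V))"
      by (simp only: idx y_def[symmetric] sg) (simp add: scale_sum_right power_add mult.assoc)
    finally have "mode v (int n - 1) u - parity_sign (p * q) \<cdot> (\<Sum>i<N - n.
        ((- 1) ^ (n + i) * ((of_nat (n + i) - a - b) gchoose i)) \<cdot> y (n + i))
      = parity_sign (p * q) \<cdot> (\<Sum>i<N - n. (- 1) ^ (n + i) \<cdot> (mode (y (n + i)) (- 1 - int i) (vvac V)
          - ((of_nat (n + i) - a - b) gchoose i) \<cdot> y (n + i)))"
      by (simp add: scale_right_diff_distrib sum_subtractf)
    also have "\<dots> \<in> zhu_O V"
    proof (intro O_scale O_sum)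
      fix i
      have wt: "y (n + i) \<in> half_weight_space V (k + l - 2 * int (n + i))"
        using mode_half_weight[OF u(2) v(2), of "int (n + i) - 1"] by (simp add: y_def algebra_simps)
      have "- of_int (k + l - 2 * int (n + i)) / 2 = of_nat (n + i) - a - b"
        by (simp add: a_def b_def field_simps)
      thus "mode (y (n + i)) (- 1 - int i) (vvac V)
          - ((of_nat (n + i) - a - b) gchoose i) \<cdot> y (n + i) \<in> zhu_O V"
        using creation_mod_O[OF wt, of i] by (simp only:)
    qed
    finally show ?thesis .
  qed
  have vandermonde: "(\<Sum>n\<le>m. c n (m - n)) = (a - 1) gchoose m" for m
  proof -
    have "(\<Sum>n\<le>m. c n (m - n))
        = (- 1) ^ m * (\<Sum>n\<in>{0..m}. (b gchoose n) * ((of_nat m - a - b) gchoose (m - n)))"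
      by (simp add: c_def sum_distrib_left atLeast0AtMost mult_ac)
    also have "\<dots> = (- 1) ^ m * ((of_nat m - (a - 1) - 1) gchoose m)"
      by (subst gbinomial_Vandermonde) (simp add: algebra_simps)
    also have "\<dots> = (a - 1) gchoose m" by (rule gbinomial_negated_upper[symmetric])
    finally show ?thesis .
  qed
  have "(\<Sum>n<N. \<Sum>i<N - n. c n i \<cdot> y (n + i)) = (\<Sum>(n,i)\<in>{(n,i). n + i < N}. c n i \<cdot> y (n + i))"
  proof -
    have "{(n,i). n + i < N} = Sigma {..<N} (\<lambda>n. {..<N - n})" by auto
    thus ?thesis by (simp add: sum.Sigma)
  qed
  also have "\<dots> = (\<Sum>m<N. \<Sum>n\<le>m. c n (m - n) \<cdot> y (n + (m - n)))"
    by (rule sum.triangle_reindex)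
  also have "\<dots> = (\<Sum>m<N. ((a - 1) gchoose m) \<cdot> y m)"
    by (simp flip: vandermonde add: scale_sum_left)
  also have "\<dots> = res (binom_series (a - 1) * xpow (- 1)) u v"
    by (subst res_eq) (auto simp: bound y_def)
  finally have total: "(\<Sum>n<N. \<Sum>i<N - n. c n i \<cdot> y (n + i))
      = res (binom_series (a - 1) * xpow (- 1)) u v" .
  have "parity_sign (p * q) \<cdot> res (binom_series (a - 1) * xpow (- 1)) u v
      = (\<Sum>n<N. (b gchoose n) \<cdot> (parity_sign (p * q) \<cdot> (\<Sum>i<N - n.
          ((- 1) ^ (n + i) * ((of_nat (n + i) - a - b) gchoose i)) \<cdot> y (n + i))))"
    by (subst total[symmetric]) (simp add: c_def scale_sum_right mult.left_commute)
  moreover have "zhu_star V v u = (\<Sum>n<N. (b gchoose n) \<cdot> mode v (int n - 1) u)"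
    by (simp add: star_homogeneous[OF v(2)] res_eq bound b_def)
  ultimately have "zhu_star V v u - parity_sign (p * q) \<cdot> res (binom_series (a - 1) * xpow (- 1)) u v
    = (\<Sum>n<N. (b gchoose n) \<cdot> (mode v (int n - 1) u - parity_sign (p * q) \<cdot> (\<Sum>i<N - n.
        ((- 1) ^ (n + i) * ((of_nat (n + i) - a - b) gchoose i)) \<cdot> y (n + i))))"
    by (simp only: scale_right_diff_distrib sum_subtractf)
  also have "\<dots> \<in> zhu_O V"
    by (intro O_sum O_scale step)
  finally show ?thesis by (simp add: a_def)
qed

text \<open>
  The kernels \<open>(1 + x)\<^sup>a / x\<close> of \<open>u * v\<close> and \<open>(1 + x)\<^sup>a\<^sup>-\<^sup>1 / x\<close> of the swapped product differ by
  \<open>(1 + x)\<^sup>a\<^sup>-\<^sup>1\<close>.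
\<close>

lemma star_commutator_mod_O:
  assumes u: "u \<in> vdeg V p" and v: "v \<in> vdeg V q"
  shows "zhu_star V u v - parity_sign (p * q) \<cdot> zhu_star V v u - zhu_bracket u v \<in> zhu_O V"
  using u
proof (induction rule: vdeg_induct)
  case (bihomogeneous k u)
  show ?case using v
  proof (induction rule: vdeg_induct)
    case v: (bihomogeneous l v)
    define z where "z = res (binom_series (of_int k / 2 - 1) * xpow (- 1)) u v"
    have "zhu_star V u v = res (binom_series (of_int k / 2 - 1) * (1 + xpow (- 1))) u v"
      by (simp only: star_homogeneous[OF bihomogeneous(2)] star_kernel)
    hence z: "zhu_star V u v = zhu_bracket u v + z"
      by (simp add: bracket_homogeneous[OF bihomogeneous(2)] z_def distrib_left res_add)
    have "zhu_star V u v - parity_sign (p * q) \<cdot> zhu_star V v u - zhu_bracket u v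
        = z - parity_sign (p * q) \<cdot> zhu_star V v u"
      by (simp add: z)
    also have "z = (parity_sign (p * q) * parity_sign (p * q)) \<cdot> z"
      by (simp add: power_int_mult_distrib[symmetric])
    also have "(parity_sign (p * q) * parity_sign (p * q)) \<cdot> z - parity_sign (p * q) \<cdot> zhu_star V v u
        = (- parity_sign (p * q)) \<cdot> (zhu_star V v u - parity_sign (p * q) \<cdot> z)"
      by (simp add: scale_right_diff_distrib)
    also have "\<dots> \<in> zhu_O V"
      using star_swap_mod_O[OF bihomogeneous v] by (simp only: z_def O_scale)
    finally show ?case .
  next
    case (add v v')
    from O_add[OF add] show ?case
      by (simp add: star_add_left star_add_right zhu_bracket_add_right scale_right_distrib algebra_simps)
  qed
next
  case (add u u')
  from O_add[OF add] show ?case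
    by (simp add: star_add_left star_add_right zhu_bracket_add_left scale_right_distrib algebra_simps)
qed


section \<open>Parity and the ideal property of O(V)\<close>

lemma weighted_res_degrees:
  assumes u: "u \<in> vdeg V p" and v: "v \<in> vdeg V q" and F: "\<And>a k. k < m \<Longrightarrow> fls_nth (F a) k = 0"
  shows "weighted_res F u v \<in> deg.supported {d. d \<le> p + q - 2 * m - 2 \<and> even (d - p - q)}"
  using u
proof (induction rule: vdeg_induct)
  case (bihomogeneous k u)
  thus ?case using res_degrees[OF _ v, of u p m "F (of_int k / 2)"] F
    by (simp add: weighted_res_homogeneous)
next
  case (add u u')
  thus ?case
    by (simp add: vs_linear_add[OF linear_weighted_res_state] subspace_add[OF deg.subspace_supported])
qed

text \<open>
  The generators \<open>u \<circ> v\<close> are not homogeneous for the cohomological degree, but the modes change it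
  only by even amounts, so \<open>O(V)\<close> is graded by its parity.
\<close>

lemma O_parity:
  assumes "x \<in> zhu_O V"
  obtains x0 x1 where "x = x0 + x1" "x0 \<in> zhu_O V" "x1 \<in> zhu_O V"
    "x0 \<in> deg.supported {d. even (d - p)}" "x1 \<in> deg.supported {d. odd (d - p)}"
proof -
  note subs = subspace_0[OF deg.subspace_supported]
  from assms have "\<exists>x0 x1. x = x0 + x1 \<and> x0 \<in> zhu_O V \<and> x1 \<in> zhu_O V
    \<and> x0 \<in> deg.supported {d. even (d - p)} \<and> x1 \<in> deg.supported {d. odd (d - p)}"
  proof (induction rule: O_induct)
    case (circ q r k u v)
    have deg: "zhu_circ V u v \<in> deg.supported {d. even (d - q - r)}"
      using weighted_res_degrees[OF circ(1,3), of "- 2" "\<lambda>a. binom_series a * xpow (- 2)"]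
        deg.supported_mono[of "{d. d \<le> q + r - 2 * - 2 - 2 \<and> even (d - q - r)}" "{d. even (d - q - r)}"]
      by (auto simp: zhu_circ_eq)
    show ?case
    proof (cases "even (q + r - p)")
      case True
      hence "{d. even (d - q - r)} = {d. even (d - p)}" by auto
      thus ?thesis using deg circ_in_O[of u v] subs O_0
        by (intro exI[of _ "zhu_circ V u v"] exI[of _ 0]) simp
    next
      case False
      hence "{d. even (d - q - r)} = {d. odd (d - p)}" by auto
      thus ?thesis using deg circ_in_O[of u v] subs O_0
        by (intro exI[of _ 0] exI[of _ "zhu_circ V u v"]) simp
    qed
  next
    case zero
    show ?case using O_0 subs by (intro exI[of _ 0]) simp
  next
    case (add x y)
    then obtain x0 x1 y0 y1 where "x = x0 + x1" "y = y0 + y1"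
      "x0 \<in> zhu_O V" "x1 \<in> zhu_O V" "y0 \<in> zhu_O V" "y1 \<in> zhu_O V"
      "x0 \<in> deg.supported {d. even (d - p)}" "x1 \<in> deg.supported {d. odd (d - p)}"
      "y0 \<in> deg.supported {d. even (d - p)}" "y1 \<in> deg.supported {d. odd (d - p)}" by blast
    thus ?case
      by (intro exI[of _ "x0 + y0"] exI[of _ "x1 + y1"])
        (simp add: O_add subspace_add[OF deg.subspace_supported])
  next
    case (scale c x)
    then obtain x0 x1 where "x = x0 + x1" "x0 \<in> zhu_O V" "x1 \<in> zhu_O V"
      "x0 \<in> deg.supported {d. even (d - p)}" "x1 \<in> deg.supported {d. odd (d - p)}" by blast
    thus ?case
      by (intro exI[of _ "c \<cdot> x0"] exI[of _ "c \<cdot> x1"])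
        (simp add: scale_right_distrib O_scale subspace_scale[OF deg.subspace_supported])
  qed
  thus ?thesis using that by blast
qed

lemma parity_sign_cong: "even (a - b) \<Longrightarrow> parity_sign (a * q) = parity_sign (b * q)"
  by (auto simp: power_int_minus_left)

text \<open>
  The sign in the commutator depends on parities alone, so one argument may be an inhomogeneous
  vector of a given parity.
\<close>

lemma star_commutator_parity:
  assumes u: "u \<in> deg.supported S" and S: "\<And>d. d \<in> S \<Longrightarrow> even (d - p)" and v: "v \<in> vdeg V q"
  shows "zhu_star V u v - parity_sign (p * q) \<cdot> zhu_star V v u - zhu_bracket u v \<in> zhu_O V"
  using u
proof (induction rule: deg.supported_induct)
  case zero
  show ?case by (simp add: star_zero_left star_zero_right zhu_bracket_zero_left O_0)
next
  case (homogeneous d u)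
  thus ?case using star_commutator_mod_O[OF homogeneous(2) v] parity_sign_cong[OF S] by simp
next
  case (add u u')
  from O_add[OF add] show ?case
    by (simp add: star_add_left star_add_right zhu_bracket_add_left scale_right_distrib algebra_simps)
qed

lemma star_commutator_parity_right:
  assumes u: "u \<in> vdeg V p" and v: "v \<in> deg.supported S" and S: "\<And>d. d \<in> S \<Longrightarrow> even (d - q)"
  shows "zhu_star V u v - parity_sign (p * q) \<cdot> zhu_star V v u - zhu_bracket u v \<in> zhu_O V"
  using v
proof (induction rule: deg.supported_induct)
  case zero
  show ?case by (simp add: star_zero_left star_zero_right zhu_bracket_zero_right O_0)
next
  case (homogeneous d v)
  thus ?case
    using star_commutator_mod_O[OF u homogeneous(2)] parity_sign_cong[OF S, of d p] by (simp add: mult.commute)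
next
  case (add v v')
  from O_add[OF add] show ?case
    by (simp add: star_add_left star_add_right zhu_bracket_add_right scale_right_distrib algebra_simps)
qed

text \<open>
  Up to sign and modulo \<open>O(V)\<close>, the product \<open>x * v\<close> is \<open>v * x\<close> minus the bracket of \<open>v\<close> with \<open>x\<close>,
  and these are already known to lie in \<open>O(V)\<close>. The sign needs \<open>x\<close> to have a parity.
\<close>

lemma star_O_left: "x \<in> zhu_O V \<Longrightarrow> zhu_star V x v \<in> zhu_O V"
proof (induction v rule: deg.homogeneous_induct)
  case (homogeneous q v)
  have part: "zhu_star V x' v \<in> zhu_O V"
    if x': "x' \<in> zhu_O V" "x' \<in> deg.supported S" "\<And>d. d \<in> S \<Longrightarrow> even (d - p)" for x' S p
  proof -
    have "zhu_star V v x' - parity_sign (q * p) \<cdot> zhu_star V x' v - zhu_bracket v x' \<in> zhu_O V"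
      by (rule star_commutator_parity_right[OF homogeneous(1) x'(2,3)])
    from O_diff[OF O_diff[OF star_O_right[OF x'(1), of v] bracket_O_right[OF x'(1), of v]] this]
    have "parity_sign (q * p) \<cdot> zhu_star V x' v \<in> zhu_O V" by simp
    from O_scale[OF this, of "parity_sign (q * p)"] show ?thesis by simp
  qed
  obtain x0 x1 where x: "x = x0 + x1" "x0 \<in> zhu_O V" "x1 \<in> zhu_O V"
    "x0 \<in> deg.supported {d. even (d - 0)}" "x1 \<in> deg.supported {d. odd (d - 0)}"
    by (rule O_parity[OF homogeneous(2)])
  have "zhu_star V x0 v \<in> zhu_O V" by (rule part[OF x(2,4), of 0]) auto
  moreover have "zhu_star V x1 v \<in> zhu_O V" by (rule part[OF x(3,5), of 1]) auto
  ultimately show ?case by (simp add: x(1) star_add_left O_add)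
qed (simp add: star_add_right O_add)

lemma diff_O: "x \<in> zhu_O V \<Longrightarrow> vdiff V x \<in> zhu_O V"
proof (induction rule: O_induct)
  case (circ p q k u v)
  define f where "f = binom_series (of_int k / 2) * xpow (- 2)"
  define N where "N = max (trunc u v) (max (trunc (vdiff V u) v) (trunc u (vdiff V v)))"
  have eq: "res f a b = (\<Sum>n\<in>{- 2..<N}. fls_nth f n \<cdot> mode a n b)"
    if "trunc a b \<le> N" for a b
    by (rule res_eq_sum) (use that in \<open>auto simp: f_def mode_trunc\<close>)
  have "vdiff V (mode u n v) = mode (vdiff V u) n v + parity_sign p \<cdot> mode u n (vdiff V v)" for n
    using diff_mode[OF circ(1), of n v] by simp
  hence "vdiff V (res f u v) = res f (vdiff V u) v + parity_sign p \<cdot> res f u (vdiff V v)"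
    by (simp add: eq N_def vs_linear_sum[OF diff_linear] diff_scale scale_right_distrib sum.distrib
        scale_sum_right mult.commute)
  moreover have "res f (vdiff V u) v = zhu_circ V (vdiff V u) v"
    "res f u (vdiff V v) = zhu_circ V u (vdiff V v)" "res f u v = zhu_circ V u v"
    by (simp_all add: f_def circ_homogeneous[OF circ(2)] circ_homogeneous[OF diff_half_weight[OF circ(2)]])
  ultimately show ?case by (simp add: O_add O_scale circ_in_O)
qed (auto simp: diff_add diff_scale intro: O_0 O_add O_scale)


section \<open>Leading terms with respect to the cohomological degree\<close>

lemmas supported_add = subspace_add[OF deg.subspace_supported]
  and supported_diff = subspace_diff[OF deg.subspace_supported]
  and supported_neg = subspace_neg[OF deg.subspace_supported]
  and supported_scale = subspace_scale[OF deg.subspace_supported]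
  and supported_zero = subspace_0[OF deg.subspace_supported]

lemma weighted_res_degree_le:
  assumes u: "u \<in> deg.supported {..p}" and v: "v \<in> deg.supported {..q}"
    and F: "\<And>a k. k < m \<Longrightarrow> fls_nth (F a) k = 0"
  shows "weighted_res F u v \<in> deg.supported {..p + q - 2 * m - 2}"
  using u
proof (induction rule: deg.supported_induct)
  case (homogeneous i u)
  show ?case using v
  proof (induction rule: deg.supported_induct)
    case v: (homogeneous j v)
    have "{d. d \<le> i + j - 2 * m - 2 \<and> even (d - i - j)} \<subseteq> {..p + q - 2 * m - 2}"
      using homogeneous(1) v(1) by auto
    from subsetD[OF deg.supported_mono[OF this] weighted_res_degrees[OF homogeneous(2) v(2) F]]
    show ?case .
  qed (auto simp: vs_linear_0[OF linear_weighted_res] vs_linear_add[OF linear_weighted_res]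
      intro: supported_zero supported_add)
qed (auto simp: vs_linear_0[OF linear_weighted_res_state] vs_linear_add[OF linear_weighted_res_state]
    intro: supported_zero supported_add)

lemma star_degree_le:
  "u \<in> deg.supported {..p} \<Longrightarrow> v \<in> deg.supported {..q} \<Longrightarrow> zhu_star V u v \<in> deg.supported {..p + q}"
  using weighted_res_degree_le[of u p v q "- 1" "\<lambda>a. binom_series a * xpow (- 1)"]
  by (simp add: zhu_star_eq)

lemma bracket_degree_le:
  "u \<in> deg.supported {..p} \<Longrightarrow> v \<in> deg.supported {..q} \<Longrightarrow> zhu_bracket u v \<in> deg.supported {..p + q - 2}"
  using weighted_res_degree_le[of u p v q 0 "\<lambda>a. binom_series (a - 1)"]
  by (simp add: zhu_bracket_def)

lemma vdeg_le: "v \<in> vdeg V p \<Longrightarrow> v \<in> deg.supported {..p}"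
  by (rule deg.homogeneous_supported) auto

lemma res_leading:
  assumes u: "u \<in> vdeg V p" and v: "v \<in> vdeg V q"
    and f: "\<And>k. k < m \<Longrightarrow> fls_nth f k = 0" "fls_nth f m = 1"
  shows "res f u v - mode u m v \<in> deg.supported {..p + q - 2 * m - 4}"
proof -
  have "res f u v - mode u m v = res (f + fls_const (- 1) * xpow m) u v"
    by (simp add: res_add res_const_mult del: fls_const_uminus)
  also have "\<dots> \<in> deg.supported {d. d \<le> p + q - 2 * (m + 1) - 2 \<and> even (d - p - q)}"
  proof (rule res_degrees[OF u v])
    fix k assume "k < m + 1"
    thus "fls_nth (f + fls_const (- 1) * xpow m) k = 0"
      using f by (cases "k = m") (auto simp del: fls_const_uminus)
  qed
  finally show ?thesis
    by (rule subsetD[OF deg.supported_mono, rotated]) auto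
qed

lemma star_leading:
  assumes u: "u \<in> vdeg V p" and v: "v \<in> vdeg V q"
  shows "zhu_star V u v - mode u (- 1) v \<in> deg.supported {..p + q - 2}"
  using u
proof (induction rule: vdeg_induct)
  case (bihomogeneous k u)
  thus ?case
    using res_leading[OF bihomogeneous(1) v, of "- 1" "binom_series (of_int k / 2) * xpow (- 1)"]
    by (simp add: star_homogeneous)
next
  case (add u u')
  from supported_add[OF add] show ?case by (simp add: star_add_left mode_add_left algebra_simps)
qed

lemma bracket_leading:
  assumes u: "u \<in> vdeg V p" and v: "v \<in> vdeg V q"
  shows "zhu_bracket u v - mode u 0 v \<in> deg.supported {..p + q - 4}"
  using u
proof (induction rule: vdeg_induct)
  case (bihomogeneous k u)
  thus ?case
    using res_leading[OF bihomogeneous(1) v, of 0 "binom_series (of_int k / 2 - 1)"]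
    by (simp add: bracket_homogeneous)
next
  case (add u u')
  from supported_add[OF add] show ?case by (simp add: zhu_bracket_add_left mode_add_left algebra_simps)
qed


section \<open>The kernel of the projection to the associated graded\<close>

text \<open>
  The kernel of the map from the vectors of degree \<open>p\<close> to the piece of degree \<open>p\<close> of the associated
  graded.
\<close>

definition gr_kernel :: "int \<Rightarrow> 'v set" where
  "gr_kernel p = {u \<in> vdeg V p. \<exists>w\<in>deg.supported {..p - 1}. u - w \<in> zhu_O V}"

lemma gr_kernelI:
  "u \<in> vdeg V p \<Longrightarrow> w \<in> deg.supported {..p - 1} \<Longrightarrow> u - w \<in> zhu_O V \<Longrightarrow> u \<in> gr_kernel p"
  by (auto simp: gr_kernel_def)

lemma gr_kernel_degree: "u \<in> gr_kernel p \<Longrightarrow> u \<in> vdeg V p"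
  by (simp add: gr_kernel_def)

lemma subspace_gr_kernel: "subspace (gr_kernel p)"
proof -
  have "u + v \<in> gr_kernel p" if "u \<in> gr_kernel p" "v \<in> gr_kernel p" for u v
  proof -
    from that obtain w w' where w: "w \<in> deg.supported {..p - 1}" "u - w \<in> zhu_O V"
      "w' \<in> deg.supported {..p - 1}" "v - w' \<in> zhu_O V" by (auto simp: gr_kernel_def)
    from O_add[OF w(2,4)] have "u + v - (w + w') \<in> zhu_O V" by (simp add: algebra_simps)
    thus ?thesis
      using that w by (intro gr_kernelI[of _ _ "w + w'"])
        (auto intro: supported_add subspace_add[OF deg.subspace_piece] dest: gr_kernel_degree)
  qed
  moreover have "c \<cdot> u \<in> gr_kernel p" if "u \<in> gr_kernel p" for c u
  proof -
    from that obtain w where w: "w \<in> deg.supported {..p - 1}" "u - w \<in> zhu_O V"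
      by (auto simp: gr_kernel_def)
    from O_scale[OF w(2), of c] have "c \<cdot> u - c \<cdot> w \<in> zhu_O V" by (simp add: scale_right_diff_distrib)
    thus ?thesis
      using that w by (intro gr_kernelI[of _ _ "c \<cdot> w"])
        (auto intro: supported_scale subspace_scale[OF deg.subspace_piece] dest: gr_kernel_degree)
  qed
  moreover have "0 \<in> gr_kernel p"
    by (rule gr_kernelI[of _ _ 0]) (auto intro: subspace_0[OF deg.subspace_piece] supported_zero O_0)
  ultimately show ?thesis by (simp add: subspace_def)
qed

lemmas gr_kernel_0 = subspace_0[OF subspace_gr_kernel]
  and gr_kernel_add = subspace_add[OF subspace_gr_kernel]
  and gr_kernel_diff = subspace_diff[OF subspace_gr_kernel]
  and gr_kernel_scale = subspace_scale[OF subspace_gr_kernel]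
  and gr_kernel_sum = subspace_sum[OF subspace_gr_kernel]

text \<open>
  Since \<open>O(V)\<close> is graded by parity, a drop by one is in fact a drop by two, by vectors of the same
  parity. The bracket is independent of representatives for this reason: it lowers the
  filtration by two, and its sign is only right for vectors of the expected parity.
\<close>

lemma gr_kernel_parity:
  assumes "u \<in> gr_kernel p"
  obtains w where "w \<in> deg.supported {d. d \<le> p - 2 \<and> even (d - p)}" "u - w \<in> zhu_O V"
proof -
  from assms obtain w where u: "u \<in> vdeg V p" and w: "w \<in> deg.supported {..p - 1}" "u - w \<in> zhu_O V"
    by (auto simp: gr_kernel_def)
  obtain w0 w1 where w01: "w = w0 + w1"
    "w0 \<in> deg.supported ({..p - 1} \<inter> {d. even (d - p)})"
    "w1 \<in> deg.supported ({..p - 1} - {d. even (d - p)})"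
    by (rule deg.supported_split[OF w(1)])
  obtain x0 x1 where x: "u - w = x0 + x1" "x0 \<in> zhu_O V" "x1 \<in> zhu_O V"
    "x0 \<in> deg.supported {d. even (d - p)}" "x1 \<in> deg.supported {d. odd (d - p)}"
    by (rule O_parity[OF w(2)])
  have "u - w0 - x0 \<in> deg.supported {d. even (d - p)}"
    using u w01(2) x(4) deg.supported_mono[of "{..p - 1} \<inter> {d. even (d - p)}" "{d. even (d - p)}"]
    by (intro supported_diff) (auto intro: deg.homogeneous_supported)
  moreover have "u - w0 - x0 = w1 + x1" using w01(1) x(1) by (simp add: algebra_simps)
  moreover have "w1 + x1 \<in> deg.supported {d. odd (d - p)}"
    using w01(3) x(5) deg.supported_mono[of "{..p - 1} - {d. even (d - p)}" "{d. odd (d - p)}"]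
    by (intro supported_add) auto
  ultimately have "u - w0 - x0 = 0"
    by (intro deg.supported_disjoint[of _ "{d. even (d - p)}" "{d. odd (d - p)}"]) auto
  hence "u - w0 \<in> zhu_O V" using x(2) by simp
  moreover have "{..p - 1} \<inter> {d. even (d - p)} = {d. d \<le> p - 2 \<and> even (d - p)}"
  proof -
    have "(d \<le> p - 1 \<and> even (d - p)) = (d \<le> p - 2 \<and> even (d - p))" for d
      by presburger
    thus ?thesis by (auto simp only: Int_def atMost_iff mem_Collect_eq)
  qed
  ultimately show ?thesis using that[of w0] w01(2) by simp
qed

text \<open>
  The vectors \<open>u\<^sub>n v\<close> with \<open>n \<le> - 2\<close> are the leading terms of the elements of \<open>O(V)\<close> given by
  kernels with a pole of order \<open>- n\<close>. The vectors \<open>u\<^sub>-\<^sub>2 v\<close> span Zhu's subspace \<open>C\<^sub>2(V)\<close>, so the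
  associated graded is a quotient of the Poisson algebra \<open>V / C\<^sub>2(V)\<close>.
\<close>

lemma gr_kernel_pole:
  assumes u: "u \<in> vdeg V p" and v: "v \<in> vdeg V q" and n: "n \<le> - 2" and d: "d = p + q - 2 * n - 2"
  shows "mode u n v \<in> gr_kernel d"
  using u
proof (induction rule: vdeg_induct)
  case (bihomogeneous k u)
  define x where "x = res (binom_series (of_int k / 2) * xpow n) u v"
  have "n = - int (nat (- n - 2) + 2)" using n by simp
  hence "x \<in> zhu_O V"
    using res_pole_in_O[OF bihomogeneous(2), of "nat (- n - 2)" v] by (simp only: x_def)
  moreover have "x - mode u n v \<in> deg.supported {..p + q - 2 * n - 4}"
    unfolding x_def by (rule res_leading[OF bihomogeneous(1) v]) auto
  hence "mode u n v - x \<in> deg.supported {..p + q - 2 * n - 4}"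
    using supported_neg by fastforce
  hence "mode u n v - x \<in> deg.supported {..d - 1}"
    using deg.supported_mono[of "{..p + q - 2 * n - 4}" "{..d - 1}"] d by auto
  moreover have "p - 2 * n - 2 + q = d" using d by simp
  hence "mode u n v \<in> vdeg V d"
    using mode_degree[OF bihomogeneous(1) v, of n] by (simp only:)
  ultimately show ?case by (intro gr_kernelI[of _ _ "mode u n v - x"]) auto
qed (simp add: mode_add_left gr_kernel_add)

text \<open>In skew symmetry all terms but the first are of the form \<open>y\<^sub>n \<one>\<close> with \<open>n \<le> - 2\<close>.\<close>

lemma skew_symmetry_gr:
  assumes u: "u \<in> vdeg V p" and v: "v \<in> vdeg V q"
  shows "mode v l u + (parity_sign (p * q) * parity_sign l) \<cdot> mode u l v \<in> gr_kernel (p + q - 2 * l - 2)"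
proof -
  define J where "J = nat (trunc u v - l)"
  have "mode v l u = (- parity_sign (p * q) * parity_sign l) \<cdot>
    (\<Sum>i<Suc J. (- 1) ^ i \<cdot> mode (mode u (l + int i) v) (- 1 - int i) (vvac V))"
    by (rule skew_symmetry[OF u v]) (auto simp: J_def intro!: mode_trunc)
  also have "\<dots> = (- parity_sign (p * q) * parity_sign l) \<cdot> (mode u l v +
    (\<Sum>i<J. (- 1) ^ Suc i \<cdot> mode (mode u (l + int (Suc i)) v) (- 1 - int (Suc i)) (vvac V)))"
    by (subst sum.lessThan_Suc_shift) (simp add: creation)
  finally have "mode v l u + (parity_sign (p * q) * parity_sign l) \<cdot> mode u l v = (- parity_sign (p * q) * parity_sign l) \<cdot>
    (\<Sum>i<J. (- 1) ^ Suc i \<cdot> mode (mode u (l + int (Suc i)) v) (- 1 - int (Suc i)) (vvac V))"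
    by (simp add: scale_right_distrib)
  also have "\<dots> \<in> gr_kernel (p + q - 2 * l - 2)"
    by (intro gr_kernel_scale gr_kernel_sum gr_kernel_pole[OF mode_degree[OF u v] vac_degree])
      (auto simp: algebra_simps)
  finally show ?thesis .
qed

text \<open>
  The Jacobi identity with \<open>l = n = - 1\<close>, \<open>m = 0\<close>: apart from the two products, only modes with
  index at most \<open>- 2\<close> are applied last.
\<close>

lemma associative_gr:
  assumes u: "u \<in> vdeg V p" and v: "v \<in> vdeg V q" and w: "w \<in> vdeg V r"
  shows "mode (mode u (- 1) v) (- 1) w - mode u (- 1) (mode v (- 1) w) \<in> gr_kernel (p + q + r)"
proof -
  define J where "J = nat (max (trunc v w) (trunc u w))"
  define t where "t i = mode u (- 1 - int i) (mode v (- 1 + int i) w)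
      + parity_sign (p * q) \<cdot> mode v (- 2 - int i) (mode u (int i) w)" for i
  have bin: "(- 1) ^ i * ((- 1 :: complex) gchoose i) = 1" for i
  proof -
    have "(of_int (- 1) gchoose i :: complex) = (- 1) ^ i"
      by (simp only: of_int_gbinomial[symmetric] uminus_one_gbinomial) simp
    thus ?thesis by (simp flip: power_mult_distrib)
  qed
  have t0: "t i = 0" if "Suc J \<le> i" for i
    using that by (simp add: t_def J_def mode_trunc)
  have "Sum_any t = (\<Sum>i<Suc J. t i)"
    by (rule Sum_any.expand_superset) (use t0 in \<open>auto simp flip: not_le\<close>)
  moreover have "Sum_any (\<lambda>i::nat. vscale V ((- 1) ^ i * (of_int (- 1) gchoose i))
        (vmode V u (0 + (- 1) - int i) (vmode V v (- 1 + int i) w)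
         - vscale V ((- 1) powi (- 1) * (- 1) powi (p * q))
             (vmode V v (- 1 + (- 1) - int i) (vmode V u (0 + int i) w)))) = Sum_any t"
    by (rule Sum_any.cong) (simp add: bin t_def)
  moreover have "Sum_any (\<lambda>i::nat. vscale V (of_int 0 gchoose i)
          (vmode V (vmode V u (- 1 + int i) v) (0 + (- 1) - int i) w))
      = mode (mode u (- 1) v) (- 1) w"
    by (subst Sum_any.expand_superset[where A = "{0}"]) (auto simp: gbinomial_0_left split: if_splits)
  ultimately have "mode (mode u (- 1) v) (- 1) w = (\<Sum>i<Suc J. t i)"
    using jacobi[OF u v, of "- 1" 0 "- 1" w] by simp
  also have "\<dots> = t 0 + (\<Sum>i<J. t (Suc i))" by (rule sum.lessThan_Suc_shift)
  finally have "mode (mode u (- 1) v) (- 1) w - mode u (- 1) (mode v (- 1) w)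
      = parity_sign (p * q) \<cdot> mode v (- 2) (mode u 0 w) + (\<Sum>i<J. t (Suc i))"
    by (simp add: t_def)
  moreover have "mode v (- 2) (mode u 0 w) \<in> gr_kernel (p + q + r)"
    by (rule gr_kernel_pole[OF v mode_degree[OF u w]]) auto
  moreover have "t (Suc i) \<in> gr_kernel (p + q + r)" for i
    unfolding t_def
    by (intro gr_kernel_add gr_kernel_scale gr_kernel_pole[OF u mode_degree[OF v w]]
        gr_kernel_pole[OF v mode_degree[OF u w]]) auto
  ultimately show ?thesis by (simp add: gr_kernel_add gr_kernel_scale gr_kernel_sum)
qed

text \<open>For \<open>n = 0\<close> this becomes the Jacobi identity of the bracket, for \<open>n = - 1\<close> the Leibniz rule.\<close>

lemma zero_mode_derivation:
  assumes u: "u \<in> vdeg V p" and v: "v \<in> vdeg V q"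
  shows "mode u 0 (mode v n w) = mode (mode u 0 v) n w + parity_sign (p * q) \<cdot> mode v n (mode u 0 w)"
proof -
  define J where "J = nat (trunc u v)"
  have "mode u 0 (mode v n w) - parity_sign (p * q) \<cdot> mode v n (mode u 0 w)
    = (\<Sum>i<Suc J. (of_int 0 gchoose i) \<cdot> mode (mode u (int i) v) (0 + n - int i) w)"
    by (rule mode_commutator[OF u v]) (simp add: J_def mode_trunc)
  also have "\<dots> = mode (mode u 0 v) n w"
    by (subst sum.lessThan_Suc_shift) (simp add: gbinomial_0_left)
  finally show ?thesis by (simp add: algebra_simps)
qed

lemma gr_kernel_mult_left:
  assumes u: "u \<in> gr_kernel p" and v: "v \<in> vdeg V q"
  shows "mode u (- 1) v \<in> gr_kernel (p + q)"
proof -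
  from u obtain w where w: "w \<in> deg.supported {..p - 1}" "u - w \<in> zhu_O V"
    by (auto simp: gr_kernel_def)
  note u' = gr_kernel_degree[OF u]
  have "mode u (- 1) v - (zhu_star V w v - (zhu_star V u v - mode u (- 1) v)) \<in> zhu_O V"
    using star_O_left[OF w(2), of v] by (simp add: star_diff_left)
  moreover have "zhu_star V w v \<in> deg.supported {..p + q - 1}"
    using star_degree_le[OF w(1) vdeg_le[OF v]] by (simp add: algebra_simps)
  moreover have "zhu_star V u v - mode u (- 1) v \<in> deg.supported {..p + q - 1}"
    using star_leading[OF u' v] deg.supported_mono[of "{..p + q - 2}" "{..p + q - 1}"] by auto
  moreover have "mode u (- 1) v \<in> vdeg V (p + q)"
    using mode_degree[OF u' v, of "- 1"] by simp
  ultimately show ?thesis by (blast intro: gr_kernelI supported_diff)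
qed

text \<open>
  Replace \<open>u\<close> by a congruent \<open>w\<close> of the same parity and degree at most \<open>p - 2\<close>; since \<open>O(V)\<close> is an
  ideal, the graded commutators with \<open>v\<close> are congruent, hence so are the brackets, and the bracket
  of \<open>w\<close> with \<open>v\<close> has degree at most \<open>p + q - 4\<close>.
\<close>

lemma gr_kernel_bracket_left:
  assumes u: "u \<in> gr_kernel p" and v: "v \<in> vdeg V q"
  shows "mode u 0 v \<in> gr_kernel (p + q - 2)"
proof -
  obtain w where w: "w \<in> deg.supported {d. d \<le> p - 2 \<and> even (d - p)}" "u - w \<in> zhu_O V"
    by (rule gr_kernel_parity[OF u])
  have w': "w \<in> deg.supported {..p - 2}"
    using w(1) deg.supported_mono[of "{d. d \<le> p - 2 \<and> even (d - p)}" "{..p - 2}"] by auto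
  note u' = gr_kernel_degree[OF u]
  define s where "s = parity_sign (p * q)"
  have "zhu_star V u v - s \<cdot> zhu_star V v u - zhu_bracket u v \<in> zhu_O V"
    unfolding s_def by (rule star_commutator_mod_O[OF u' v])
  moreover have "zhu_star V w v - s \<cdot> zhu_star V v w - zhu_bracket w v \<in> zhu_O V"
    unfolding s_def by (rule star_commutator_parity[OF w(1) _ v]) auto
  moreover have "zhu_star V (u - w) v - s \<cdot> zhu_star V v (u - w) \<in> zhu_O V"
    by (intro O_diff O_scale star_O_left star_O_right w)
  ultimately have "(zhu_star V (u - w) v - s \<cdot> zhu_star V v (u - w))
      - (zhu_star V u v - s \<cdot> zhu_star V v u - zhu_bracket u v)
      + (zhu_star V w v - s \<cdot> zhu_star V v w - zhu_bracket w v) \<in> zhu_O V"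
    by (simp only: O_add O_diff)
  hence "zhu_bracket u v - zhu_bracket w v \<in> zhu_O V"
    by (simp add: star_diff_left star_diff_right scale_right_diff_distrib)
  hence "mode u 0 v - (zhu_bracket w v - (zhu_bracket u v - mode u 0 v)) \<in> zhu_O V"
    by simp
  moreover have "zhu_bracket w v \<in> deg.supported {..p + q - 2 - 1}"
    using bracket_degree_le[OF w' vdeg_le[OF v]]
      deg.supported_mono[of "{..p - 2 + q - 2}" "{..p + q - 2 - 1}"] by auto
  moreover have "zhu_bracket u v - mode u 0 v \<in> deg.supported {..p + q - 2 - 1}"
    using bracket_leading[OF u' v] deg.supported_mono[of "{..p + q - 4}" "{..p + q - 2 - 1}"] by auto
  moreover have "mode u 0 v \<in> vdeg V (p + q - 2)"
    using mode_degree[OF u' v, of 0] by (simp add: algebra_simps)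
  ultimately show ?thesis by (blast intro: gr_kernelI supported_diff)
qed

lemma gr_kernel_mode_right:
  assumes u: "u \<in> vdeg V p" and v: "v \<in> gr_kernel q"
    and left: "mode v l u \<in> gr_kernel (q + p - 2 * l - 2)"
  shows "mode u l v \<in> gr_kernel (p + q - 2 * l - 2)"
proof -
  have "mode u l v + (parity_sign (q * p) * parity_sign l) \<cdot> mode v l u \<in> gr_kernel (q + p - 2 * l - 2)"
    by (rule skew_symmetry_gr[OF gr_kernel_degree[OF v] u])
  from gr_kernel_diff[OF this gr_kernel_scale[OF left]]
  have "mode u l v + (parity_sign (q * p) * parity_sign l) \<cdot> mode v l u - (parity_sign (q * p) * parity_sign l) \<cdot> mode v l u
    \<in> gr_kernel (q + p - 2 * l - 2)" .
  thus ?thesis by (simp add: add.commute)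
qed

lemma gr_kernel_bracket_right:
  "u \<in> vdeg V p \<Longrightarrow> v \<in> gr_kernel q \<Longrightarrow> mode u 0 v \<in> gr_kernel (p + q - 2)"
  using gr_kernel_mode_right[of u p v q 0] gr_kernel_bracket_left[of v q u p] by simp

lemma diff_degree_le: "v \<in> deg.supported {..p} \<Longrightarrow> vdiff V v \<in> deg.supported {..p + 1}"
  by (induction rule: deg.supported_induct)
    (auto simp: diff_add intro: supported_zero supported_add deg.homogeneous_supported[OF diff_degree])

end


section \<open>The Zhu algebra and its filtration in terms of representatives\<close>

lemma UN_constant_eq: "x \<in> S \<Longrightarrow> (\<And>y. y \<in> S \<Longrightarrow> f y = c) \<Longrightarrow> (\<Union>y\<in>S. f y) = c"
  by blast

context dg_vertex_operator_algebra
begin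

abbreviation cl :: "'v \<Rightarrow> 'v set" where "cl \<equiv> zhu_class V"
abbreviation A where "A \<equiv> zhu_algebra V"

lemma cl_eq_iff: "cl u = cl v \<longleftrightarrow> u - v \<in> zhu_O V"
proof
  assume "cl u = cl v"
  moreover have "u \<in> cl u" by (simp add: zhu_class_def O_0)
  ultimately have "u \<in> cl v" by simp
  thus "u - v \<in> zhu_O V" by (simp add: zhu_class_def)
next
  assume uv: "u - v \<in> zhu_O V"
  have "w - u \<in> zhu_O V \<longleftrightarrow> w - v \<in> zhu_O V" for w
    using O_add[OF _ uv, of "w - u"] O_diff[OF _ uv, of "w - v"] by auto
  thus "cl u = cl v" by (simp add: zhu_class_def)
qed

lemma in_cl_iff: "w \<in> cl u \<longleftrightarrow> w - u \<in> zhu_O V"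
  by (simp add: zhu_class_def)

lemma cl_self [simp]: "u \<in> cl u"
  by (simp add: in_cl_iff O_0)

lemma carrier_A: "carrier A = range cl"
  by (simp add: zhu_algebra_def)

lemma cl_carrier [simp]: "cl u \<in> carrier A"
  by (simp add: carrier_A)

lemma zero_A: "\<zero>\<^bsub>A\<^esub> = cl 0"
  and one_A: "\<one>\<^bsub>A\<^esub> = cl (vvac V)"
  by (simp_all add: zhu_algebra_def)

lemma UN_cl_eq: "(\<And>u'. u' \<in> cl u \<Longrightarrow> f u' = c) \<Longrightarrow> (\<Union>u'\<in>cl u. f u') = c"
  by (rule UN_constant_eq[OF cl_self])

lemma cl_add: "cl u \<oplus>\<^bsub>A\<^esub> cl v = cl (u + v)"
proof -
  have "cl (u' + v') = cl (u + v)" if "u' \<in> cl u" "v' \<in> cl v" for u' v'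
  proof -
    have "(u' - u) + (v' - v) \<in> zhu_O V" using that by (simp add: in_cl_iff O_add)
    thus ?thesis by (simp add: cl_eq_iff algebra_simps)
  qed
  hence "(\<Union>u'\<in>cl u. \<Union>v'\<in>cl v. cl (u' + v')) = cl (u + v)"
    by (intro UN_cl_eq)
  thus ?thesis by (simp add: zhu_algebra_def)
qed

lemma cl_mult: "cl u \<otimes>\<^bsub>A\<^esub> cl v = cl (zhu_star V u v)"
proof -
  have "cl (zhu_star V u' v') = cl (zhu_star V u v)" if "u' \<in> cl u" "v' \<in> cl v" for u' v'
  proof -
    have "zhu_star V (u' - u) v' + zhu_star V u (v' - v) \<in> zhu_O V"
      using that by (simp add: in_cl_iff O_add star_O_left star_O_right)
    thus ?thesis by (simp add: cl_eq_iff star_diff_left star_diff_right)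
  qed
  hence "(\<Union>u'\<in>cl u. \<Union>v'\<in>cl v. cl (zhu_star V u' v')) = cl (zhu_star V u v)"
    by (intro UN_cl_eq)
  thus ?thesis by (simp add: zhu_algebra_def)
qed

lemma cl_smult: "c \<odot>\<^bsub>A\<^esub> cl u = cl (c \<cdot> u)"
proof -
  have "cl (c \<cdot> u') = cl (c \<cdot> u)" if "u' \<in> cl u" for u'
    using O_scale[of "u' - u" c] that by (simp add: in_cl_iff cl_eq_iff scale_right_diff_distrib)
  hence "(\<Union>u'\<in>cl u. cl (c \<cdot> u')) = cl (c \<cdot> u)"
    by (intro UN_cl_eq)
  thus ?thesis by (simp add: zhu_algebra_def)
qed

lemma cl_diff: "zhu_diff V (cl u) = cl (vdiff V u)"
proof -
  have "cl (vdiff V u') = cl (vdiff V u)" if "u' \<in> cl u" for u'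
    using diff_O[of "u' - u"] that by (simp add: in_cl_iff cl_eq_iff vs_linear_diff[OF diff_linear])
  thus ?thesis unfolding zhu_diff_def by (intro UN_cl_eq)
qed

lemma abelian_group_A: "abelian_group A"
proof (rule abelian_groupI)
  show "\<exists>y\<in>carrier A. y \<oplus>\<^bsub>A\<^esub> x = \<zero>\<^bsub>A\<^esub>" if "x \<in> carrier A" for x
  proof -
    from that obtain u where "x = cl u" by (auto simp: carrier_A)
    thus ?thesis by (intro bexI[of _ "cl (- u)"]) (simp_all add: cl_add zero_A)
  qed
qed (auto simp: carrier_A cl_add zero_A algebra_simps)

lemma cl_minus: "cl u \<ominus>\<^bsub>A\<^esub> cl v = cl (u - v)"
proof -
  interpret A: abelian_group A by (rule abelian_group_A)
  have "\<ominus>\<^bsub>A\<^esub> cl v = cl (- v)"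
    by (rule A.minus_equality) (simp_all add: cl_add zero_A)
  thus ?thesis by (simp add: a_minus_def cl_add)
qed

lemma zhu_commutator_cl:
  "zhu_commutator V p q (cl u) (cl v) = cl (zhu_star V u v - parity_sign (p * q) \<cdot> zhu_star V v u)"
  by (simp add: zhu_commutator_def cl_mult cl_smult cl_minus)

lemma zhu_filt_eq: "zhu_filt V p = cl ` deg.supported {..p}"
  by (simp add: zhu_filt_def deg.span_pieces_eq_supported)

lemma cl_in_filt_iff: "cl u \<in> zhu_filt V p \<longleftrightarrow> (\<exists>w\<in>deg.supported {..p}. u - w \<in> zhu_O V)"
  by (auto simp: zhu_filt_eq cl_eq_iff)

text \<open>The symbol map: the class in the \<open>p\<close>-th piece represented by a vector.\<close>

definition gr_proj :: "int \<Rightarrow> 'v \<Rightarrow> 'v set set" where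
  "gr_proj p u = gr_class V p (cl u)"

lemma gr_proj_eq: "gr_proj p u = (\<lambda>w. cl (w + u)) ` deg.supported {..p - 1}"
  by (auto simp: gr_proj_def gr_class_def a_r_coset_def r_coset_def zhu_filt_eq cl_add)

lemma cl_in_gr_proj: "cl u \<in> gr_proj p u"
  using imageI[OF supported_zero, of "\<lambda>w. cl (w + u)"] by (simp add: gr_proj_eq)

lemma UN_gr_proj_eq:
  "(\<And>x. x \<in> gr_proj p u \<Longrightarrow> f x = c) \<Longrightarrow> (\<Union>x\<in>gr_proj p u. f x) = c"
  by (rule UN_constant_eq[OF cl_in_gr_proj])

lemma gr_proj_eq_iff: "gr_proj p u = gr_proj p v \<longleftrightarrow> cl (u - v) \<in> zhu_filt V (p - 1)"
proof
  assume eq: "gr_proj p u = gr_proj p v"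
  from cl_in_gr_proj[of u p] obtain w where "w \<in> deg.supported {..p - 1}" "u - (w + v) \<in> zhu_O V"
    unfolding eq by (auto simp: gr_proj_eq cl_eq_iff)
  thus "cl (u - v) \<in> zhu_filt V (p - 1)"
    by (auto simp: cl_in_filt_iff algebra_simps)
next
  assume "cl (u - v) \<in> zhu_filt V (p - 1)"
  then obtain w where w: "w \<in> deg.supported {..p - 1}" "u - v - w \<in> zhu_O V"
    by (auto simp: cl_in_filt_iff)
  have "cl (w' + u) = cl ((w' + w) + v)" for w'
    using w(2) by (simp add: cl_eq_iff algebra_simps)
  moreover have "cl (w' + v) = cl ((w' - w) + u)" for w'
    using O_neg[OF w(2)] by (simp add: cl_eq_iff algebra_simps)
  ultimately show "gr_proj p u = gr_proj p v"
    unfolding gr_proj_eq using supported_add[OF _ w(1)] supported_diff[OF _ w(1)] by fast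
qed

lemma gr_proj_eqI: "u - v - w \<in> zhu_O V \<Longrightarrow> w \<in> deg.supported {..p - 1} \<Longrightarrow> gr_proj p u = gr_proj p v"
  by (auto simp: gr_proj_eq_iff cl_in_filt_iff)

lemma gr_proj_eqI_degree: "u - v \<in> deg.supported {..p - 1} \<Longrightarrow> gr_proj p u = gr_proj p v"
  by (rule gr_proj_eqI[of _ _ "u - v"]) (simp_all add: O_0)

lemma gr_proj_eq_iff_kernel:
  "u \<in> vdeg V p \<Longrightarrow> v \<in> vdeg V p \<Longrightarrow> gr_proj p u = gr_proj p v \<longleftrightarrow> u - v \<in> gr_kernel p"
  by (auto simp: gr_proj_eq_iff cl_in_filt_iff gr_kernel_def subspace_diff[OF deg.subspace_piece])

lemma diff_comp_lower: "u \<in> deg.supported {..p} \<Longrightarrow> u - deg.comp p u \<in> deg.supported {..p - 1}"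
  by (auto simp: deg.supported_def deg.comp_diff deg.comp_homogeneous[OF deg.comp_in] split: if_splits)

lemma gr_proj_comp: "u \<in> deg.supported {..p} \<Longrightarrow> gr_proj p (deg.comp p u) = gr_proj p u"
  by (rule gr_proj_eqI_degree[symmetric]) (rule diff_comp_lower)

lemma gr_piece_add: "gr_proj p u \<otimes>\<^bsub>gr_piece V p\<^esub> gr_proj p v = gr_proj p (u + v)"
proof -
  have "gr_proj p u \<otimes>\<^bsub>gr_piece V p\<^esub> gr_proj p v
      = (\<Union>x\<in>gr_proj p u. \<Union>y\<in>gr_proj p v. {x \<oplus>\<^bsub>A\<^esub> y})"
    by (simp add: gr_piece_def A_FactGroup_def FactGroup_def set_mult_def)
  also have "\<dots> = {cl ((w + w') + (u + v)) |w w'. w \<in> deg.supported {..p - 1} \<and> w' \<in> deg.supported {..p - 1}}"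
    by (auto simp: gr_proj_eq cl_add algebra_simps)
  also have "\<dots> = gr_proj p (u + v)"
    unfolding gr_proj_eq
    using supported_add[of _ "{..p - 1}"] supported_zero[of "{..p - 1}"] by (auto simp: image_iff) force
  finally show ?thesis .
qed

lemma gr_piece_one: "\<one>\<^bsub>gr_piece V p\<^esub> = gr_proj p 0"
  by (simp add: gr_piece_def A_FactGroup_def FactGroup_def gr_proj_eq zhu_filt_eq)

lemma gr_piece_carrier_filt: "carrier (gr_piece V p) = gr_proj p ` deg.supported {..p}"
  by (auto simp: gr_piece_def A_FactGroup_def FactGroup_def RCOSETS_def gr_proj_def gr_class_def
      a_r_coset_def r_coset_def zhu_filt_eq)

lemma gr_piece_carrier: "carrier (gr_piece V p) = gr_proj p ` vdeg V p"
  unfolding gr_piece_carrier_filt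
  using gr_proj_comp[of _ p] deg.comp_in[of p] vdeg_le[of _ p] by (auto simp: image_iff)

lemma gr_proj_carrier [simp]: "u \<in> vdeg V p \<Longrightarrow> gr_proj p u \<in> carrier (gr_piece V p)"
  by (auto simp: gr_piece_carrier)

lemma comm_monoid_gr_piece: "comm_monoid (gr_piece V p)"
  by (rule comm_monoidI)
    (auto simp: gr_piece_carrier gr_piece_add gr_piece_one algebra_simps
      intro!: imageI subspace_add[OF deg.subspace_piece] subspace_0[OF deg.subspace_piece])

lemma finprod_gr_piece:
  assumes "\<And>i. i \<in> F \<Longrightarrow> a i \<in> vdeg V p" "finite F"
  shows "finprod (gr_piece V p) (\<lambda>i. gr_proj p (a i)) F = gr_proj p (sum a F)"
  using assms(2,1)
proof (induction F)
  case empty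
  show ?case using comm_monoid.finprod_empty[OF comm_monoid_gr_piece] by (simp add: gr_piece_one)
next
  case (insert i F)
  have "finprod (gr_piece V p) (\<lambda>i. gr_proj p (a i)) (insert i F)
      = gr_proj p (a i) \<otimes>\<^bsub>gr_piece V p\<^esub> finprod (gr_piece V p) (\<lambda>i. gr_proj p (a i)) F"
    by (rule comm_monoid.finprod_insert[OF comm_monoid_gr_piece]) (use insert in auto)
  thus ?case using insert by (simp add: gr_piece_add)
qed

lemma gr_preimages_proj:
  assumes "u \<in> deg.supported {..p}"
  shows "gr_preimages V p (gr_proj p u) = {v \<in> vdeg V p. gr_proj p v = gr_proj p u}"
proof -
  have "(\<exists>x\<in>zhu_filt V p. gr_proj p u = gr_class V p x \<and> cl v \<ominus>\<^bsub>A\<^esub> x \<in> zhu_filt V (p - 1))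
      \<longleftrightarrow> (\<exists>a\<in>deg.supported {..p}. gr_proj p u = gr_proj p a \<and> gr_proj p v = gr_proj p a)" for v
    unfolding zhu_filt_eq[of p] by (simp add: cl_minus gr_proj_eq_iff[of p v] gr_proj_def[symmetric])
  hence "(\<exists>x\<in>zhu_filt V p. gr_proj p u = gr_class V p x \<and> cl v \<ominus>\<^bsub>A\<^esub> x \<in> zhu_filt V (p - 1))
      \<longleftrightarrow> gr_proj p v = gr_proj p u" for v
    using assms by auto
  thus ?thesis by (simp add: gr_preimages_def)
qed

text \<open>
  Corrections of lower degree to a factor contribute only in degrees below \<open>p + q\<close>, as do the terms
  of \<open>u * v\<close> after the first.
\<close>

lemma star_top_degree:
  assumes u: "u \<in> vdeg V p" and v: "v \<in> vdeg V q"
    and a: "a - u \<in> deg.supported {..p - 1}" and b: "b - v \<in> deg.supported {..q - 1}"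
  shows "gr_proj (p + q) (zhu_star V a b) = gr_proj (p + q) (mode u (- 1) v)"
proof (rule gr_proj_eqI_degree)
  have "zhu_star V a b - mode u (- 1) v
    = zhu_star V (a - u) (b - v) + zhu_star V (a - u) v + zhu_star V u (b - v)
      + (zhu_star V u v - mode u (- 1) v)"
    by (simp add: star_diff_left star_diff_right)
  moreover have "zhu_star V (a - u) (b - v) \<in> deg.supported {..p + q - 1}"
    using star_degree_le[OF a b] deg.supported_mono[of "{..p - 1 + (q - 1)}" "{..p + q - 1}"] by auto
  moreover have "zhu_star V (a - u) v \<in> deg.supported {..p + q - 1}"
    using star_degree_le[OF a vdeg_le[OF v]] by (simp add: algebra_simps)
  moreover have "zhu_star V u (b - v) \<in> deg.supported {..p + q - 1}"
    using star_degree_le[OF vdeg_le[OF u] b] by (simp add: algebra_simps)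
  moreover have "zhu_star V u v - mode u (- 1) v \<in> deg.supported {..p + q - 1}"
    using star_leading[OF u v] deg.supported_mono[of "{..p + q - 2}" "{..p + q - 1}"] by auto
  ultimately show "zhu_star V a b - mode u (- 1) v \<in> deg.supported {..p + q - 1}"
    by (simp only: supported_add)
qed

lemma commutator_top_degree:
  assumes u: "u \<in> vdeg V p" and v: "v \<in> vdeg V q"
  shows "gr_proj (p + q - 2) (zhu_star V u v - parity_sign (p * q) \<cdot> zhu_star V v u)
    = gr_proj (p + q - 2) (mode u 0 v)"
proof (rule gr_proj_eqI)
  show "zhu_star V u v - parity_sign (p * q) \<cdot> zhu_star V v u - mode u 0 v
      - (zhu_bracket u v - mode u 0 v) \<in> zhu_O V"
    using star_commutator_mod_O[OF u v] by simp
  show "zhu_bracket u v - mode u 0 v \<in> deg.supported {..p + q - 2 - 1}"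
    using bracket_leading[OF u v] deg.supported_mono[of "{..p + q - 4}" "{..p + q - 2 - 1}"] by auto
qed

lemma gr_piece_smult_proj: "gr_piece_smult V p c (gr_proj p u) = gr_proj p (c \<cdot> u)"
proof -
  have "gr_class V p (c \<odot>\<^bsub>A\<^esub> x) = gr_proj p (c \<cdot> u)" if "x \<in> gr_proj p u" for x
  proof -
    from that obtain w where w: "w \<in> deg.supported {..p - 1}" "x = cl (w + u)"
      by (auto simp: gr_proj_eq)
    have "gr_proj p (c \<cdot> (w + u)) = gr_proj p (c \<cdot> u)"
      using w(1) by (intro gr_proj_eqI_degree) (simp add: scale_right_distrib supported_scale)
    thus ?thesis by (simp add: w(2) cl_smult gr_proj_def)
  qed
  thus ?thesis unfolding gr_piece_smult_def by (intro UN_gr_proj_eq)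
qed

lemma gr_piece_mult_proj:
  assumes u: "u \<in> vdeg V p" and v: "v \<in> vdeg V q"
  shows "gr_piece_mult V p q (gr_proj p u) (gr_proj q v) = gr_proj (p + q) (mode u (- 1) v)"
proof -
  have "gr_class V (p + q) (x \<otimes>\<^bsub>A\<^esub> y) = gr_proj (p + q) (mode u (- 1) v)"
    if x: "x \<in> gr_proj p u" and y: "y \<in> gr_proj q v" for x y
  proof -
    from x obtain w where w: "w \<in> deg.supported {..p - 1}" "x = cl (w + u)"
      by (auto simp: gr_proj_eq)
    from y obtain w' where w': "w' \<in> deg.supported {..q - 1}" "y = cl (w' + v)"
      by (auto simp: gr_proj_eq)
    show ?thesis
      using star_top_degree[OF u v, of "w + u" "w' + v"] w(1) w'(1)
      by (simp add: w(2) w'(2) cl_mult gr_proj_def)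
  qed
  thus ?thesis unfolding gr_piece_mult_def
    by (intro UN_gr_proj_eq)
qed

lemma gr_piece_bracket_proj:
  assumes u: "u \<in> vdeg V p" and v: "v \<in> vdeg V q"
  shows "gr_piece_bracket V p q (gr_proj p u) (gr_proj q v) = gr_proj (p + q - 2) (mode u 0 v)"
proof -
  have pre: "u' \<in> gr_preimages V r (gr_proj r w) \<longleftrightarrow> u' \<in> vdeg V r \<and> u' - w \<in> gr_kernel r"
    if "w \<in> vdeg V r" for u' w r
    using gr_proj_eq_iff_kernel[OF _ that, of u'] by (simp add: gr_preimages_proj[OF vdeg_le[OF that]]) blast
  have "gr_class V (p + q - 2) (zhu_commutator V p q (cl u') (cl v')) = gr_proj (p + q - 2) (mode u 0 v)"
    if u': "u' \<in> gr_preimages V p (gr_proj p u)" and v': "v' \<in> gr_preimages V q (gr_proj q v)" for u' v'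
  proof -
    have "gr_class V (p + q - 2) (zhu_commutator V p q (cl u') (cl v')) = gr_proj (p + q - 2) (mode u' 0 v')"
      using commutator_top_degree[of u' p v' q] u' v'
      by (simp add: pre u v zhu_commutator_cl gr_proj_def[symmetric])
    also have "mode u' 0 v' - mode u 0 v = mode (u' - u) 0 v' + mode u 0 (v' - v)"
      by (simp add: mode_diff_left mode_diff_right)
    moreover have "\<dots> \<in> gr_kernel (p + q - 2)"
      using u' v' u v by (intro gr_kernel_add gr_kernel_bracket_left gr_kernel_bracket_right) (simp_all add: pre)
    ultimately have "mode u' 0 v' - mode u 0 v \<in> gr_kernel (p + q - 2)" by simp
    hence "gr_proj (p + q - 2) (mode u' 0 v') = gr_proj (p + q - 2) (mode u 0 v)"
      using mode_degree[of u' p v' q 0] mode_degree[of u p v q 0] u' v' u v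
      by (subst gr_proj_eq_iff_kernel) (simp_all add: pre algebra_simps)
    thus ?thesis
      using commutator_top_degree[of u' p v' q] u' v'
      by (simp add: pre u v zhu_commutator_cl gr_proj_def[symmetric])
  qed
  moreover have "u \<in> gr_preimages V p (gr_proj p u)" "v \<in> gr_preimages V q (gr_proj q v)"
    by (simp_all add: pre u v gr_kernel_0)
  ultimately show ?thesis unfolding gr_piece_bracket_def
    by (intro UN_constant_eq[of u] UN_constant_eq[of v])
qed

lemma gr_piece_diff_proj: "gr_piece_diff V p (gr_proj p u) = gr_proj (p + 1) (vdiff V u)"
proof -
  have "gr_class V (p + 1) (zhu_diff V x) = gr_proj (p + 1) (vdiff V u)" if "x \<in> gr_proj p u" for x
  proof -
    from that obtain w where w: "w \<in> deg.supported {..p - 1}" "x = cl (w + u)"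
      by (auto simp: gr_proj_eq)
    have "gr_proj (p + 1) (vdiff V (w + u)) = gr_proj (p + 1) (vdiff V u)"
      using diff_degree_le[OF w(1)] by (intro gr_proj_eqI_degree) (simp add: diff_add)
    thus ?thesis by (simp add: w(2) cl_diff gr_proj_def)
  qed
  thus ?thesis unfolding gr_piece_diff_def by (intro UN_gr_proj_eq)
qed


section \<open>The associated graded as a quotient of V\<close>

abbreviation G where "G \<equiv> gr_algebra V"

text \<open>
  Sending a vector to the family of classes of its homogeneous components identifies the associated
  graded with the quotient of \<open>V\<close> by a graded subspace. Under this map the product, the bracket
  and the differential come from \<open>u\<^sub>-\<^sub>1 v\<close>, \<open>u\<^sub>0 v\<close> and \<open>d u\<close>, so that all axioms become statements
  about vectors modulo the kernel.
\<close>

definition to_gr :: "'v \<Rightarrow> int \<Rightarrow> 'v set set" where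
  "to_gr u = (\<lambda>p. gr_proj p (deg.comp p u))"

definition total_kernel :: "'v set" where
  "total_kernel = {u. \<forall>p. deg.comp p u \<in> gr_kernel p}"

lemma subspace_total_kernel: "subspace total_kernel"
  by (auto simp: subspace_def total_kernel_def deg.comp_add deg.comp_scale gr_kernel_0
      gr_kernel_add gr_kernel_scale)

lemma gr_kernel_total: "u \<in> gr_kernel p \<Longrightarrow> u \<in> total_kernel"
  by (auto simp: total_kernel_def deg.comp_homogeneous[OF gr_kernel_degree] gr_kernel_0)

lemma to_gr_eq_iff: "to_gr u = to_gr v \<longleftrightarrow> u - v \<in> total_kernel"
  by (simp add: to_gr_def fun_eq_iff gr_proj_eq_iff_kernel total_kernel_def deg.comp_diff)

lemma to_gr_homogeneous: "u \<in> vdeg V p \<Longrightarrow> to_gr u = gr_incl V p (gr_proj p u)"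
  by (rule ext) (simp add: to_gr_def gr_incl_def deg.comp_homogeneous gr_piece_one)

lemma gr_deg_eq: "gr_deg V p = to_gr ` vdeg V p"
  by (auto simp: gr_deg_def gr_piece_carrier to_gr_homogeneous image_iff)

lemma gr_support_to_gr: "gr_support V (to_gr u) = {p. deg.comp p u \<notin> gr_kernel p}"
  using gr_proj_eq_iff_kernel[OF deg.comp_in subspace_0[OF deg.subspace_piece]]
  by (simp add: gr_support_def to_gr_def gr_piece_one)

lemma gr_support_subset: "gr_support V (to_gr u) \<subseteq> {p. deg.comp p u \<noteq> 0}"
  by (auto simp: gr_support_to_gr gr_kernel_0)

lemma finite_gr_support: "finite (gr_support V (to_gr u))"
  by (rule finite_subset[OF gr_support_subset deg.finite_comp])

lemma carrier_gr: "carrier G = range to_gr"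
proof
  show "range to_gr \<subseteq> carrier G"
    by (auto simp: gr_algebra_def finite_gr_support) (simp add: to_gr_def)
  show "carrier G \<subseteq> range to_gr"
  proof
    fix x assume "x \<in> carrier G"
    hence x: "\<And>p. x p \<in> gr_proj p ` vdeg V p" "finite (gr_support V x)"
      by (auto simp: gr_algebra_def gr_piece_carrier)
    have "\<forall>p. \<exists>u\<in>vdeg V p. x p = gr_proj p u \<and> (p \<notin> gr_support V x \<longrightarrow> u = 0)"
    proof
      fix p
      show "\<exists>u\<in>vdeg V p. x p = gr_proj p u \<and> (p \<notin> gr_support V x \<longrightarrow> u = 0)"
        using x(1)[of p] subspace_0[OF deg.subspace_piece, of p]
        by (cases "p \<in> gr_support V x") (auto simp: gr_support_def gr_piece_one)
    qed
    then obtain a where a: "\<And>p. a p \<in> vdeg V p" "\<And>p. x p = gr_proj p (a p)"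
      "\<And>p. p \<notin> gr_support V x \<Longrightarrow> a p = 0"
      by metis
    have "deg.comp p (\<Sum>q\<in>gr_support V x. a q) = a p" for p
      using x(2) a(3)[of p] by (simp add: deg.comp_sum deg.comp_homogeneous[OF a(1)])
    hence "x = to_gr (\<Sum>q\<in>gr_support V x. a q)"
      by (simp add: to_gr_def a(2) fun_eq_iff)
    thus "x \<in> range to_gr" by blast
  qed
qed

lemma to_gr_carrier [simp]: "to_gr u \<in> carrier G"
  by (simp add: carrier_gr)

lemma to_gr_add: "to_gr u \<oplus>\<^bsub>G\<^esub> to_gr v = to_gr (u + v)"
  by (simp add: gr_algebra_def to_gr_def gr_piece_add deg.comp_add)

lemma to_gr_zero: "\<zero>\<^bsub>G\<^esub> = to_gr 0"
  by (simp add: gr_algebra_def to_gr_def gr_piece_one)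

lemma to_gr_smult: "c \<odot>\<^bsub>G\<^esub> to_gr u = to_gr (c \<cdot> u)"
  by (simp add: gr_algebra_def to_gr_def gr_piece_smult_proj deg.comp_scale)

lemma to_gr_one: "\<one>\<^bsub>G\<^esub> = to_gr (vvac V)"
  by (simp add: to_gr_homogeneous[OF vac_degree]) (simp add: gr_algebra_def one_A gr_proj_def)

lemma to_gr_diff: "gr_diff V (to_gr u) = to_gr (vdiff V u)"
  by (rule ext) (simp add: gr_diff_def to_gr_def gr_piece_diff_proj
      deg.comp_linear_shift[OF diff_linear diff_degree])

lemma comp_mode: "deg.comp n (mode u m v)
    = (\<Sum>p\<in>{p. deg.comp p u \<noteq> 0}. mode (deg.comp p u) m (deg.comp (n + 2 * m + 2 - p) v))"
proof -
  have "deg.comp n (mode u m v) = (\<Sum>p\<in>{p. deg.comp p u \<noteq> 0}. deg.comp n (mode (deg.comp p u) m v))"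
    by (subst deg.sum_comp[of u, symmetric]) (simp only: mode_sum_left deg.comp_sum)
  thus ?thesis
    by (simp add: linear_mode_right_deg[OF deg.comp_in] algebra_simps)
qed

text \<open>
  The product and the bracket are extended bilinearly by the same formula, so both are treated at
  once: the mode \<open>m\<close> has degree \<open>- 2 * m - 2\<close>, and \<open>n + 2 * m + 2 - p\<close> is the degree of the right
  factor if the left factor has degree \<open>p\<close> and the result has degree \<open>n\<close>. The sum runs over the
  support of the image of \<open>u\<close>, which may be smaller than that of \<open>u\<close>; this is where the kernel
  has to be stable under the operation.
\<close>

lemma to_gr_mode:
  assumes opn: "\<And>p q u v. u \<in> vdeg V p \<Longrightarrow> v \<in> vdeg V q \<Longrightarrow>
      f p q (gr_proj p u) (gr_proj q v) = gr_proj (p + q - 2 * m - 2) (mode u m v)"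
    and ker: "\<And>p q u v. u \<in> gr_kernel p \<Longrightarrow> v \<in> vdeg V q \<Longrightarrow> mode u m v \<in> gr_kernel (p + q - 2 * m - 2)"
  shows "(\<Otimes>\<^bsub>gr_piece V n\<^esub>p\<in>gr_support V (to_gr u).
      f p (n + 2 * m + 2 - p) (to_gr u p) (to_gr v (n + 2 * m + 2 - p))) = to_gr (mode u m v) n"
proof -
  define a where "a p = mode (deg.comp p u) m (deg.comp (n + 2 * m + 2 - p) v)" for p
  have a: "a p \<in> vdeg V n" for p
    using mode_degree[OF deg.comp_in deg.comp_in, of p u m "n + 2 * m + 2 - p" v] by (simp add: a_def)
  have "f p (n + 2 * m + 2 - p) (to_gr u p) (to_gr v (n + 2 * m + 2 - p)) = gr_proj n (a p)" for p
    using opn[of "deg.comp p u" p "deg.comp (n + 2 * m + 2 - p) v" "n + 2 * m + 2 - p"] by (simp add: to_gr_def a_def)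
  hence "(\<Otimes>\<^bsub>gr_piece V n\<^esub>p\<in>gr_support V (to_gr u).
      f p (n + 2 * m + 2 - p) (to_gr u p) (to_gr v (n + 2 * m + 2 - p)))
      = gr_proj n (sum a (gr_support V (to_gr u)))"
    using finprod_gr_piece[OF a finite_gr_support] by simp
  also have "\<dots> = gr_proj n (deg.comp n (mode u m v))"
  proof -
    have "sum a {p. deg.comp p u \<noteq> 0} - sum a (gr_support V (to_gr u))
        = sum a ({p. deg.comp p u \<noteq> 0} - gr_support V (to_gr u))"
      by (rule sum_diff[OF deg.finite_comp gr_support_subset, symmetric])
    also have "\<dots> \<in> gr_kernel n"
    proof (rule gr_kernel_sum)
      fix p assume "p \<in> {p. deg.comp p u \<noteq> 0} - gr_support V (to_gr u)"
      hence "deg.comp p u \<in> gr_kernel p" by (simp add: gr_support_to_gr)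
      from ker[OF this deg.comp_in, of "n + 2 * m + 2 - p" v]
      show "a p \<in> gr_kernel n" by (simp add: a_def)
    qed
    finally have "sum a {p. deg.comp p u \<noteq> 0} - sum a (gr_support V (to_gr u)) \<in> gr_kernel n" .
    moreover have "deg.comp n (mode u m v) = sum a {p. deg.comp p u \<noteq> 0}"
      by (simp only: comp_mode a_def[abs_def])
    moreover have "sum a (gr_support V (to_gr u)) \<in> vdeg V n"
      by (rule subspace_sum[OF deg.subspace_piece]) (rule a)
    ultimately show ?thesis
      by (metis deg.comp_in gr_proj_eq_iff_kernel)
  qed
  finally show ?thesis by (simp add: to_gr_def)
qed

lemma to_gr_mult: "to_gr u \<otimes>\<^bsub>G\<^esub> to_gr v = to_gr (mode u (- 1) v)"
proof
  fix n
  show "(to_gr u \<otimes>\<^bsub>G\<^esub> to_gr v) n = to_gr (mode u (- 1) v) n"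
    using to_gr_mode[of "gr_piece_mult V" "- 1" n u v] gr_piece_mult_proj gr_kernel_mult_left
    by (simp add: gr_algebra_def)
qed

lemma to_gr_bracket: "gr_bracket V (to_gr u) (to_gr v) = to_gr (mode u 0 v)"
proof
  fix n
  show "gr_bracket V (to_gr u) (to_gr v) n = to_gr (mode u 0 v) n"
    using to_gr_mode[of "gr_piece_bracket V" 0 n u v] gr_piece_bracket_proj gr_kernel_bracket_left
    by (simp add: gr_bracket_def)
qed


section \<open>The Poisson structure\<close>

lemmas total_kernel_add = subspace_add[OF subspace_total_kernel]
  and total_kernel_sum = subspace_sum[OF subspace_total_kernel]

lemma to_gr_eqI: "u - v \<in> gr_kernel p \<Longrightarrow> to_gr u = to_gr v"
  by (simp add: to_gr_eq_iff gr_kernel_total)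

lemma mult_assoc_total:
  "mode (mode u (- 1) v) (- 1) w - mode u (- 1) (mode v (- 1) w) \<in> total_kernel"
proof (induction u rule: deg.homogeneous_induct)
  case u: (homogeneous p u)
  show ?case
  proof (induction v rule: deg.homogeneous_induct)
    case v: (homogeneous q v)
    show ?case
    proof (induction w rule: deg.homogeneous_induct)
      case (homogeneous r w)
      show ?case by (rule gr_kernel_total[OF associative_gr[OF u v homogeneous]])
    next
      case (add w w')
      from total_kernel_add[OF add] show ?case by (simp add: mode_add_right algebra_simps)
    qed
  next
    case (add v v')
    from total_kernel_add[OF add] show ?case by (simp add: mode_add_right mode_add_left algebra_simps)
  qed
next
  case (add u u')
  from total_kernel_add[OF add] show ?case by (simp add: mode_add_left algebra_simps)
qed

lemma abelian_group_gr: "abelian_group G"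
proof (rule abelian_groupI)
  show "\<exists>y\<in>carrier G. y \<oplus>\<^bsub>G\<^esub> x = \<zero>\<^bsub>G\<^esub>" if "x \<in> carrier G" for x
  proof -
    from that obtain u where "x = to_gr u" by (auto simp: carrier_gr)
    thus ?thesis by (intro bexI[of _ "to_gr (- u)"]) (simp_all add: to_gr_add to_gr_zero)
  qed
qed (auto simp: carrier_gr to_gr_add to_gr_zero algebra_simps)

lemma to_gr_minus: "\<ominus>\<^bsub>G\<^esub> to_gr u = to_gr (- u)"
proof -
  interpret G: abelian_group G by (rule abelian_group_gr)
  show ?thesis by (rule G.minus_equality) (simp_all add: to_gr_add to_gr_zero)
qed

lemma module_gr: "Module.module complex_field G"
  by (rule moduleI[OF cring_from_type_algebra abelian_group_gr])
    (auto simp: carrier_gr to_gr_add to_gr_smult ring_of_type_algebra_def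
      scale_left_distrib scale_right_distrib)

lemma ring_gr: "ring G"
proof (rule ringI[OF abelian_group_gr])
  show "monoid G"
  proof (rule monoidI)
    fix x y z assume "x \<in> carrier G" "y \<in> carrier G" "z \<in> carrier G"
    then obtain u v w where "x = to_gr u" "y = to_gr v" "z = to_gr w"
      by (auto simp: carrier_gr)
    thus "x \<otimes>\<^bsub>G\<^esub> y \<in> carrier G" and "x \<otimes>\<^bsub>G\<^esub> y \<otimes>\<^bsub>G\<^esub> z = x \<otimes>\<^bsub>G\<^esub> (y \<otimes>\<^bsub>G\<^esub> z)"
      by (simp_all add: to_gr_mult to_gr_eq_iff mult_assoc_total)
  qed (auto simp: carrier_gr to_gr_mult to_gr_one vac_mode creation)
qed (auto simp: carrier_gr to_gr_add to_gr_mult mode_add_left mode_add_right)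

lemma finsum_to_gr: "finite F \<Longrightarrow> (\<Oplus>\<^bsub>G\<^esub>i\<in>F. to_gr (a i)) = to_gr (sum a F)"
proof (induction F rule: finite_induct)
  case empty
  interpret G: abelian_group G by (rule abelian_group_gr)
  show ?case by (simp add: to_gr_zero)
next
  case (insert i F)
  interpret G: abelian_group G by (rule abelian_group_gr)
  have "(\<Oplus>\<^bsub>G\<^esub>i\<in>insert i F. to_gr (a i)) = to_gr (a i) \<oplus>\<^bsub>G\<^esub> (\<Oplus>\<^bsub>G\<^esub>i\<in>F. to_gr (a i))"
    by (rule G.finsum_insert) (use insert in auto)
  thus ?case using insert by (simp add: to_gr_add)
qed

lemma direct_sum_gr:
  assumes x: "x \<in> carrier G"
  shows "\<exists>!f. (\<forall>p. f p \<in> gr_deg V p) \<and> finite {p. f p \<noteq> \<zero>\<^bsub>G\<^esub>}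
    \<and> (\<Oplus>\<^bsub>G\<^esub>p\<in>{p. f p \<noteq> \<zero>\<^bsub>G\<^esub>}. f p) = x"
proof -
  obtain u where u: "x = to_gr u" using x by (auto simp: carrier_gr)
  define f where "f p = to_gr (deg.comp p u)" for p
  define S where "S = {p. f p \<noteq> \<zero>\<^bsub>G\<^esub>}"
  have subset: "S \<subseteq> {p. deg.comp p u \<noteq> 0}"
    by (auto simp: S_def f_def to_gr_zero)
  hence fin: "finite S" by (rule finite_subset[OF _ deg.finite_comp])
  show ?thesis
  proof (rule ex1I[of _ f])
    have "sum (\<lambda>p. deg.comp p u) {p. deg.comp p u \<noteq> 0} - sum (\<lambda>p. deg.comp p u) S
        = sum (\<lambda>p. deg.comp p u) ({p. deg.comp p u \<noteq> 0} - S)"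
      by (rule sum_diff[OF deg.finite_comp subset, symmetric])
    also have "\<dots> \<in> total_kernel"
      by (rule total_kernel_sum) (auto simp: S_def f_def to_gr_zero to_gr_eq_iff)
    finally have "to_gr u = to_gr (sum (\<lambda>p. deg.comp p u) S)"
      by (simp add: to_gr_eq_iff deg.sum_comp)
    hence "(\<Oplus>\<^bsub>G\<^esub>p\<in>S. f p) = x"
      unfolding f_def using finsum_to_gr[OF fin, of "\<lambda>p. deg.comp p u"] by (simp add: u)
    thus "(\<forall>p. f p \<in> gr_deg V p) \<and> finite {p. f p \<noteq> \<zero>\<^bsub>G\<^esub>}
        \<and> (\<Oplus>\<^bsub>G\<^esub>p\<in>{p. f p \<noteq> \<zero>\<^bsub>G\<^esub>}. f p) = x"
      using fin unfolding S_def by (auto simp: f_def gr_deg_eq)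
  next
    fix g assume g: "(\<forall>p. g p \<in> gr_deg V p) \<and> finite {p. g p \<noteq> \<zero>\<^bsub>G\<^esub>}
        \<and> (\<Oplus>\<^bsub>G\<^esub>p\<in>{p. g p \<noteq> \<zero>\<^bsub>G\<^esub>}. g p) = x"
    define R where "R = {p. g p \<noteq> \<zero>\<^bsub>G\<^esub>}"
    have R: "finite R" "(\<Oplus>\<^bsub>G\<^esub>p\<in>R. g p) = x" using g by (simp_all add: R_def)
    have "\<forall>p. \<exists>a. a \<in> vdeg V p \<and> g p = to_gr a" using g by (auto simp: gr_deg_eq)
    then obtain a where a: "\<And>p. a p \<in> vdeg V p" "\<And>p. g p = to_gr (a p)" by metis
    have "to_gr (sum a R) = to_gr u"
      using R finsum_to_gr[OF R(1), of a] by (simp add: a(2) u)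
    hence diff: "deg.comp q (sum a R) - deg.comp q u \<in> gr_kernel q" for q
      by (simp add: to_gr_eq_iff total_kernel_def deg.comp_diff)
    show "g = f"
    proof
      fix q
      have comp: "deg.comp q (sum a R) = (if q \<in> R then a q else 0)"
        using R(1) by (simp add: deg.comp_sum deg.comp_homogeneous[OF a(1)])
      show "g q = f q"
      proof (cases "q \<in> R")
        case True
        thus ?thesis using diff[of q] by (simp add: comp a(2) f_def to_gr_eqI)
      next
        case False
        hence "g q = to_gr 0" by (simp add: R_def to_gr_zero)
        thus ?thesis using False diff[of q] to_gr_eqI[of 0 "deg.comp q u" q] by (simp add: comp f_def)
      qed
    qed
  qed
qed

lemma gr_deg_submodule: "submodule (gr_deg V p) complex_field G"
  by (rule module.submoduleI[OF module_gr])
    (auto simp: gr_deg_eq to_gr_zero to_gr_minus to_gr_add to_gr_smult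
      intro!: imageI subspace_0[OF deg.subspace_piece] subspace_neg[OF deg.subspace_piece]
        subspace_add[OF deg.subspace_piece] subspace_scale[OF deg.subspace_piece])

lemma diff_of_mode:
  "u \<in> vdeg V p \<Longrightarrow> vdiff V (mode u n v) = mode (vdiff V u) n v + parity_sign p \<cdot> mode u n (vdiff V v)"
  using diff_mode[of u p n v] by simp

lemma dg_algebra_gr: "dg_algebra G (gr_deg V) (gr_diff V)"
proof (intro dg_algebra.intro dg_algebra_axioms.intro module_gr ring_gr gr_deg_submodule direct_sum_gr)
  fix a b c p q
  show "a \<in> gr_deg V p \<Longrightarrow> b \<in> gr_deg V q \<Longrightarrow> a \<otimes>\<^bsub>G\<^esub> b \<in> gr_deg V (p + q)"
    using mode_degree[of _ p _ q "- 1"] by (auto simp: gr_deg_eq to_gr_mult)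
qed (auto simp: carrier_gr gr_deg_eq to_gr_smult to_gr_mult mode_scale_left mode_scale_right to_gr_one
    vac_degree to_gr_add to_gr_diff diff_add diff_scale diff_degree diff_diff to_gr_zero diff_of_mode)

lemma skew_to_gr:
  assumes u: "u \<in> vdeg V p" and v: "v \<in> vdeg V q"
  shows "to_gr (mode u l v) = to_gr ((- parity_sign (p * q) * parity_sign l) \<cdot> mode v l u)"
proof -
  have "mode u l v + (parity_sign (q * p) * parity_sign l) \<cdot> mode v l u \<in> gr_kernel (q + p - 2 * l - 2)"
    by (rule skew_symmetry_gr[OF v u])
  thus ?thesis by (intro to_gr_eqI[of _ _ "q + p - 2 * l - 2"]) (simp add: mult.commute)
qed

lemma poisson_algebra_gr:
  "graded_commutative_dg_poisson_algebra G (gr_deg V) (gr_diff V) (gr_bracket V) (- 2)"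
proof (intro graded_commutative_dg_poisson_algebra.intro dg_algebra_gr
    graded_commutative_dg_poisson_algebra_axioms.intro)
  fix a b p q
  show "a \<in> gr_deg V p \<Longrightarrow> b \<in> gr_deg V q \<Longrightarrow> a \<otimes>\<^bsub>G\<^esub> b = parity_sign (p * q) \<odot>\<^bsub>G\<^esub> (b \<otimes>\<^bsub>G\<^esub> a)"
    using skew_to_gr[of _ p _ q "- 1"] by (auto simp: gr_deg_eq to_gr_mult to_gr_smult)
  show "a \<in> gr_deg V p \<Longrightarrow> b \<in> gr_deg V q \<Longrightarrow>
      gr_bracket V a b = \<ominus>\<^bsub>G\<^esub> (parity_sign (p * q) \<odot>\<^bsub>G\<^esub> gr_bracket V b a)"
    using skew_to_gr[of _ p _ q 0] by (auto simp: gr_deg_eq to_gr_bracket to_gr_smult to_gr_minus)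
  show "a \<in> gr_deg V p \<Longrightarrow> b \<in> gr_deg V q \<Longrightarrow> gr_bracket V a b \<in> gr_deg V (p + q + - 2)"
    using mode_degree[of _ p _ q 0] by (auto simp: gr_deg_eq to_gr_bracket algebra_simps)
next
  fix a b c p q r
  assume "a \<in> gr_deg V p" "b \<in> gr_deg V q" "c \<in> gr_deg V r"
  then obtain u v w where u: "u \<in> vdeg V p" "a = to_gr u" and v: "v \<in> vdeg V q" "b = to_gr v"
    and w: "c = to_gr w"
    by (auto simp: gr_deg_eq)
  show "gr_bracket V a (gr_bracket V b c)
      = gr_bracket V (gr_bracket V a b) c \<oplus>\<^bsub>G\<^esub> parity_sign (p * q) \<odot>\<^bsub>G\<^esub> gr_bracket V b (gr_bracket V a c)"
    by (simp add: u(2) v(2) w to_gr_bracket to_gr_add to_gr_smult)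
      (simp only: zero_mode_derivation[OF u(1) v(1), of 0 w])
  show "gr_bracket V a (b \<otimes>\<^bsub>G\<^esub> c)
      = gr_bracket V a b \<otimes>\<^bsub>G\<^esub> c \<oplus>\<^bsub>G\<^esub> parity_sign (p * q) \<odot>\<^bsub>G\<^esub> (b \<otimes>\<^bsub>G\<^esub> gr_bracket V a c)"
    by (simp add: u(2) v(2) w to_gr_bracket to_gr_mult to_gr_add to_gr_smult)
      (simp only: zero_mode_derivation[OF u(1) v(1), of "- 1" w])
qed (auto simp: carrier_gr gr_deg_eq to_gr_bracket to_gr_add to_gr_smult to_gr_diff
    mode_add_left mode_add_right mode_scale_left mode_scale_right diff_of_mode)


section \<open>Symbols of elements of the filtration\<close>

lemma gr_tilde_eq: "gr_tilde V p (cl a) = gr_incl V p (gr_proj p a)"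
  by (simp add: gr_tilde_def gr_proj_def)

lemma gr_tilde_comp: "a \<in> deg.supported {..p} \<Longrightarrow> gr_tilde V p (cl a) = to_gr (deg.comp p a)"
  by (simp only: gr_tilde_eq to_gr_homogeneous[OF deg.comp_in] gr_proj_comp)

lemma gr_tilde_homogeneous: "u \<in> vdeg V p \<Longrightarrow> gr_tilde V p (cl u) = to_gr u"
  by (simp add: gr_tilde_eq to_gr_homogeneous)

lemma gr_tilde_cong: "gr_proj p a = gr_proj p b \<Longrightarrow> gr_tilde V p (cl a) = gr_tilde V p (cl b)"
  by (simp add: gr_tilde_eq)

lemma filt_mult:
  assumes "x \<in> zhu_filt V p" "y \<in> zhu_filt V q"
  shows "x \<otimes>\<^bsub>A\<^esub> y \<in> zhu_filt V (p + q)"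
    and "gr_tilde V p x \<otimes>\<^bsub>G\<^esub> gr_tilde V q y = gr_tilde V (p + q) (x \<otimes>\<^bsub>A\<^esub> y)"
proof -
  obtain a b where a: "a \<in> deg.supported {..p}" "x = cl a" and b: "b \<in> deg.supported {..q}" "y = cl b"
    using assms by (auto simp: zhu_filt_eq)
  show "x \<otimes>\<^bsub>A\<^esub> y \<in> zhu_filt V (p + q)"
    using star_degree_le[OF a(1) b(1)] by (auto simp: a b cl_mult zhu_filt_eq)
  have "mode (deg.comp p a) (- 1) (deg.comp q b) \<in> vdeg V (p + q)"
    using mode_degree[of "deg.comp p a" p "deg.comp q b" q "- 1"] by simp
  hence "gr_tilde V (p + q) (x \<otimes>\<^bsub>A\<^esub> y) = to_gr (mode (deg.comp p a) (- 1) (deg.comp q b))"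
    using gr_tilde_cong[OF star_top_degree[OF deg.comp_in deg.comp_in diff_comp_lower[OF a(1)] diff_comp_lower[OF b(1)]]]
    by (simp add: a(2) b(2) cl_mult gr_tilde_homogeneous)
  thus "gr_tilde V p x \<otimes>\<^bsub>G\<^esub> gr_tilde V q y = gr_tilde V (p + q) (x \<otimes>\<^bsub>A\<^esub> y)"
    by (simp add: a b gr_tilde_comp to_gr_mult)
qed

lemma filt_diff:
  assumes "x \<in> zhu_filt V p"
  shows "zhu_diff V x \<in> zhu_filt V (p + 1)"
    and "gr_diff V (gr_tilde V p x) = gr_tilde V (p + 1) (zhu_diff V x)"
proof -
  obtain a where a: "a \<in> deg.supported {..p}" "x = cl a"
    using assms by (auto simp: zhu_filt_eq)
  show "zhu_diff V x \<in> zhu_filt V (p + 1)"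
    using diff_degree_le[OF a(1)] by (auto simp: a cl_diff zhu_filt_eq)
  show "gr_diff V (gr_tilde V p x) = gr_tilde V (p + 1) (zhu_diff V x)"
    using diff_degree_le[OF a(1)]
    by (simp add: a gr_tilde_comp cl_diff to_gr_diff deg.comp_linear_shift[OF diff_linear diff_degree])
qed

lemma gr_deg_preimage:
  assumes "\<xi> \<in> gr_deg V p" "u \<in> gr_preimages V p (\<xi> p)"
  shows "u \<in> vdeg V p" and "\<xi> = to_gr u"
proof -
  obtain a where a: "a \<in> vdeg V p" "\<xi> = to_gr a" using assms(1) by (auto simp: gr_deg_eq)
  have "\<xi> p = gr_proj p a" by (simp add: a(2) to_gr_def deg.comp_homogeneous[OF a(1)])
  hence u: "u \<in> vdeg V p \<and> gr_proj p u = gr_proj p a"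
    using assms(2) by (simp add: gr_preimages_proj[OF vdeg_le[OF a(1)]])
  thus "u \<in> vdeg V p" by blast
  show "\<xi> = to_gr u"
    using u by (simp add: a(2) to_gr_homogeneous[OF a(1)] to_gr_homogeneous[of u p])
qed

lemma commutator_symbol:
  assumes u: "u \<in> vdeg V p" and v: "v \<in> vdeg V q"
  shows "zhu_commutator V p q (cl u) (cl v) \<in> zhu_filt V (p + q - 2)"
    and "gr_tilde V (p + q - 2) (zhu_commutator V p q (cl u) (cl v)) = to_gr (mode u 0 v)"
    and "gr_tilde V (p + q - 2) (cl (mode u 0 v)) = to_gr (mode u 0 v)"
    and "gr_tilde V (p + q) (cl (mode u (- 1) v)) = to_gr (mode u (- 1) v)"
proof -
  have deg: "mode u 0 v \<in> vdeg V (p + q - 2)" "mode u (- 1) v \<in> vdeg V (p + q)"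
    using mode_degree[OF u v, of 0] mode_degree[OF u v, of "- 1"] by (simp_all add: algebra_simps)
  show "gr_tilde V (p + q - 2) (cl (mode u 0 v)) = to_gr (mode u 0 v)"
    and "gr_tilde V (p + q) (cl (mode u (- 1) v)) = to_gr (mode u (- 1) v)"
    by (simp_all add: gr_tilde_homogeneous deg)
  thus "gr_tilde V (p + q - 2) (zhu_commutator V p q (cl u) (cl v)) = to_gr (mode u 0 v)"
    using gr_tilde_cong[OF commutator_top_degree[OF u v]] by (simp add: zhu_commutator_cl)
  have "zhu_bracket u v \<in> deg.supported {..p + q - 2}"
    by (rule bracket_degree_le[OF vdeg_le[OF u] vdeg_le[OF v]])
  thus "zhu_commutator V p q (cl u) (cl v) \<in> zhu_filt V (p + q - 2)"
    using star_commutator_mod_O[OF u v] by (auto simp: zhu_commutator_cl cl_in_filt_iff)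
qed

end

theorem proposition6p9:
  fixes V :: "'v::ab_group_add dg_voa_data"
  assumes "dg_vertex_operator_algebra V"
  shows
    "graded_commutative_dg_poisson_algebra
       (gr_algebra V) (gr_deg V) (gr_diff V) (gr_bracket V) (- 2)
     \<and> (\<forall>u v. zhu_class V u \<otimes>\<^bsub>zhu_algebra V\<^esub> zhu_class V v = zhu_class V (zhu_star V u v))
     \<and> (\<forall>p q. \<forall>x\<in>zhu_filt V p. \<forall>y\<in>zhu_filt V q.
           x \<otimes>\<^bsub>zhu_algebra V\<^esub> y \<in> zhu_filt V (p + q) \<and>
           gr_tilde V p x \<otimes>\<^bsub>gr_algebra V\<^esub> gr_tilde V q y
             = gr_tilde V (p + q) (x \<otimes>\<^bsub>zhu_algebra V\<^esub> y))
     \<and> (\<forall>v. zhu_diff V (zhu_class V v) = zhu_class V (vdiff V v))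
     \<and> (\<forall>p. \<forall>x\<in>zhu_filt V p.
           zhu_diff V x \<in> zhu_filt V (p + 1) \<and>
           gr_diff V (gr_tilde V p x) = gr_tilde V (p + 1) (zhu_diff V x))
     \<and> (\<forall>p q. \<forall>\<xi>\<in>gr_deg V p. \<forall>\<eta>\<in>gr_deg V q.
         \<forall>u\<in>gr_preimages V p (\<xi> p). \<forall>v\<in>gr_preimages V q (\<eta> q).
           zhu_commutator V p q (zhu_class V u) (zhu_class V v) \<in> zhu_filt V (p + q - 2) \<and>
           gr_bracket V \<xi> \<eta>
             = gr_tilde V (p + q - 2) (zhu_commutator V p q (zhu_class V u) (zhu_class V v)))
     \<and> (\<forall>p q. \<forall>\<xi>\<in>gr_deg V p. \<forall>\<eta>\<in>gr_deg V q.
         \<forall>u\<in>gr_preimages V p (\<xi> p). \<forall>v\<in>gr_preimages V q (\<eta> q).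
           \<xi> \<otimes>\<^bsub>gr_algebra V\<^esub> \<eta> = gr_tilde V (p + q) (zhu_class V (vmode V u (- 1) v)) \<and>
           gr_bracket V \<xi> \<eta> = gr_tilde V (p + q - 2) (zhu_class V (vmode V u 0 v)))"
proof -
  interpret dg_vertex_operator_algebra V by (rule assms)
  have preimages:
    "zhu_commutator V p q (zhu_class V u) (zhu_class V v) \<in> zhu_filt V (p + q - 2)"
    "gr_bracket V \<xi> \<eta>
       = gr_tilde V (p + q - 2) (zhu_commutator V p q (zhu_class V u) (zhu_class V v))"
    "\<xi> \<otimes>\<^bsub>gr_algebra V\<^esub> \<eta> = gr_tilde V (p + q) (zhu_class V (vmode V u (- 1) v))"
    "gr_bracket V \<xi> \<eta> = gr_tilde V (p + q - 2) (zhu_class V (vmode V u 0 v))"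
    if "\<xi> \<in> gr_deg V p" "\<eta> \<in> gr_deg V q"
      "u \<in> gr_preimages V p (\<xi> p)" "v \<in> gr_preimages V q (\<eta> q)" for p q \<xi> \<eta> u v
  proof -
    note u = gr_deg_preimage[OF that(1,3)] and v = gr_deg_preimage[OF that(2,4)]
    show "zhu_commutator V p q (zhu_class V u) (zhu_class V v) \<in> zhu_filt V (p + q - 2)"
      by (rule commutator_symbol(1)[OF u(1) v(1)])
    show "gr_bracket V \<xi> \<eta>
       = gr_tilde V (p + q - 2) (zhu_commutator V p q (zhu_class V u) (zhu_class V v))"
      by (simp only: u(2) v(2) to_gr_bracket commutator_symbol(2)[OF u(1) v(1)])
    show "\<xi> \<otimes>\<^bsub>gr_algebra V\<^esub> \<eta> = gr_tilde V (p + q) (zhu_class V (vmode V u (- 1) v))"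
      by (simp only: u(2) v(2) to_gr_mult commutator_symbol(4)[OF u(1) v(1)])
    show "gr_bracket V \<xi> \<eta> = gr_tilde V (p + q - 2) (zhu_class V (vmode V u 0 v))"
      by (simp only: u(2) v(2) to_gr_bracket commutator_symbol(3)[OF u(1) v(1)])
  qed
  show ?thesis
    by (intro conjI allI ballI poisson_algebra_gr cl_mult cl_diff filt_mult filt_diff)
      (assumption | erule (3) preimages)+
qed

end
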